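(* Let $\delta\in(-1,1)\setminus\{0\}$ and let $K=SO(2)\mathsf F_1\cup SO(2)\mathsf F_2$ with $\mathsf F_1=\begin{pmatrix}1&0\\0&1+\delta\end{pmatrix}$ and $\mathsf F_2=\begin{pmatrix}1&0\\0&1-\delta\end{pmatrix}$. Let $\Omega\subset\mathbb R^2$ be open, bounded, Lipschitz, and let $\mathsf F\in\mathbb R^{2\times2}$. Let $\mathbf y^j\rightharpoonup\mathbf y$ in $W^{1,\infty}(\Omega)$ (weak-$*$ convergence) with $\mathbf y^j\in\mathcal A_{\mathsf F}:=\{\mathbf y\in W^{1,\infty}(\Omega,\mathbb R^2):\mathbf y|_{\partial\Omega}=\mathsf F\mathbf x\}$. Let $(\nu_{\mathbf x})_{\mathbf x\in\Omega}$ denote the associated gradient Young measure and assume that $\operatorname{supp}\nu_{\mathbf x}\subset K$ for a.e. $\mathbf x\in\Omega$. Then there exist $\mathsf Q\in SO(2)$ and $\lambda\in[0,1]$ (independent of $\mathbf x$) such that, for a.e. $\mathbf x\in\Omega$, $$\nu_{\mathbf x}=\lambda\,\delta_{\mathsf Q\mathsf F_1}+(1-\lambda)\,\delta_{\mathsf Q\mathsf F_2}.$$ This representation is unique.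
   Context: Here $\delta_{\mathsf A}$ denotes the Dirac mass at the matrix $\mathsf A\in\mathbb R^{2\times2}$ (not to be confused with the parameter $\delta$). The associated gradient Young measure is the Young measure generated by (a subsequence of) the sequence of gradients $\nabla\mathbf y^j$. *)

theory Defs
  imports "HOL-Probability.Probability"
begin

section \<open>Lipschitz domains in the plane\<close>

text \<open>Near each boundary point, after an orthogonal change of coordinates, the set is the
  strict epigraph of a Lipschitz function. Connectedness is not required.\<close>

definition lipschitz_boundary :: "(real^2) set \<Rightarrow> bool" where
  "lipschitz_boundary \<Omega> \<longleftrightarrow>
     (\<forall>p\<in>frontier \<Omega>. \<exists>r>0. \<exists>T \<gamma> L. orthogonal_transformation (T :: real^2 \<Rightarrow> real^2) \<and>
        L-lipschitz_on UNIV (\<gamma> :: real \<Rightarrow> real) \<and>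
        \<Omega> \<inter> ball p r = {x \<in> ball p r. \<gamma> (T x $ 1) < T x $ 2})"

section \<open>Weak gradients and the space \<open>W\<^sup>1\<^sup>,\<^sup>\<infinity>\<close>\<close>

definition partial_deriv :: "'n::finite \<Rightarrow> (real^'n \<Rightarrow> real) \<Rightarrow> real^'n \<Rightarrow> real" where
  "partial_deriv k f x = frechet_derivative f (at x) (axis k 1)"

text \<open>The largest class of differentiable functions that is closed under partial derivatives,
  that is, the functions of class \<open>C\<^sup>\<infinity>\<close>.\<close>

coinductive smooth_fun :: "(real^'n::finite \<Rightarrow> real) \<Rightarrow> bool" where
  "(\<forall>x. f differentiable (at x)) \<Longrightarrow> (\<forall>k. smooth_fun (partial_deriv k f)) \<Longrightarrow> smooth_fun f"

definition test_functions :: "(real^'n::finite) set \<Rightarrow> (real^'n \<Rightarrow> real) set" where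
  "test_functions \<Omega> = {\<phi>. smooth_fun \<phi> \<and>
     compact (closure {x. \<phi> x \<noteq> 0}) \<and> closure {x. \<phi> x \<noteq> 0} \<subseteq> \<Omega>}"

definition locally_integrable :: "(real^'n::finite) set \<Rightarrow> (real^'n \<Rightarrow> 'b::euclidean_space) \<Rightarrow> bool" where
  "locally_integrable \<Omega> u \<longleftrightarrow> (\<forall>C. compact C \<and> C \<subseteq> \<Omega> \<longrightarrow> integrable (lebesgue_on C) u)"

text \<open>Row \<open>i\<close>, column \<open>k\<close> of the gradient is the distributional derivative of \<open>u\<^sub>i\<close>
  in direction \<open>k\<close>.\<close>

definition has_weak_gradient ::
    "(real^'n::finite) set \<Rightarrow> (real^'n \<Rightarrow> real^'m::finite) \<Rightarrow> (real^'n \<Rightarrow> real^'n^'m) \<Rightarrow> bool" where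
  "has_weak_gradient \<Omega> u G \<longleftrightarrow> locally_integrable \<Omega> u \<and> locally_integrable \<Omega> G \<and>
     (\<forall>\<phi>\<in>test_functions \<Omega>. \<forall>i k.
        (LINT x|lebesgue_on \<Omega>. u x $ i * partial_deriv k \<phi> x)
          = - (LINT x|lebesgue_on \<Omega>. G x $ i $ k * \<phi> x))"

text \<open>The weak gradient is determined up to null sets only; all notions below that mention it
  are insensitive to the choice of representative.\<close>

definition weak_gradient ::
    "(real^'n::finite) set \<Rightarrow> (real^'n \<Rightarrow> real^'m::finite) \<Rightarrow> real^'n \<Rightarrow> real^'n^'m" where
  "weak_gradient \<Omega> u = (SOME G. has_weak_gradient \<Omega> u G)"

definition L_infty :: "(real^'n::finite) set \<Rightarrow> (real^'n \<Rightarrow> 'b::euclidean_space) set" where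
  "L_infty \<Omega> = {u \<in> borel_measurable (lebesgue_on \<Omega>). \<exists>C. AE x in lebesgue_on \<Omega>. norm (u x) \<le> C}"

definition W1_infty :: "(real^'n::finite) set \<Rightarrow> (real^'n \<Rightarrow> real^'m::finite) set" where
  "W1_infty \<Omega> = {u \<in> L_infty \<Omega>. (\<exists>G. has_weak_gradient \<Omega> u G) \<and> weak_gradient \<Omega> u \<in> L_infty \<Omega>}"

text \<open>On a bounded Lipschitz domain every element of \<open>W\<^sup>1\<^sup>,\<^sup>\<infinity>\<close> has a representative that is
  continuous up to the boundary, and its trace is the restriction of that representative.\<close>

definition admissible :: "(real^'n::finite) set \<Rightarrow> real^'n^'m::finite \<Rightarrow> (real^'n \<Rightarrow> real^'m) set" where
  "admissible \<Omega> F = {u \<in> W1_infty \<Omega>.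
     \<exists>v. continuous_on (closure \<Omega>) v \<and> (AE x in lebesgue_on \<Omega>. u x = v x) \<and>
         (\<forall>x\<in>frontier \<Omega>. v x = F *v x)}"

section \<open>Weak-* convergence and Young measures\<close>

definition weak_star_L_infty ::
    "(real^'n::finite) set \<Rightarrow> (nat \<Rightarrow> real^'n \<Rightarrow> 'b::euclidean_space) \<Rightarrow> (real^'n \<Rightarrow> 'b) \<Rightarrow> bool" where
  "weak_star_L_infty \<Omega> f g \<longleftrightarrow> (\<forall>j. f j \<in> L_infty \<Omega>) \<and> g \<in> L_infty \<Omega> \<and>
     (\<forall>h. integrable (lebesgue_on \<Omega>) h \<longrightarrow>
        (\<lambda>j. LINT x|lebesgue_on \<Omega>. f j x \<bullet> h x) \<longlonglongrightarrow> (LINT x|lebesgue_on \<Omega>. g x \<bullet> h x))"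

definition weak_star_W1_infty ::
    "(real^'n::finite) set \<Rightarrow> (nat \<Rightarrow> real^'n \<Rightarrow> real^'m::finite) \<Rightarrow> (real^'n \<Rightarrow> real^'m) \<Rightarrow> bool" where
  "weak_star_W1_infty \<Omega> u v \<longleftrightarrow> (\<forall>j. u j \<in> W1_infty \<Omega>) \<and> v \<in> W1_infty \<Omega> \<and>
     weak_star_L_infty \<Omega> u v \<and>
     weak_star_L_infty \<Omega> (\<lambda>j. weak_gradient \<Omega> (u j)) (weak_gradient \<Omega> v)"

text \<open>A parametrised family of Borel probability measures such that \<open>f (z\<^sub>j)\<close> converges
  weakly-* to \<open>x \<mapsto> \<integral> f d\<nu>\<^sub>x\<close> for all \<open>f \<in> C\<^sub>0\<close>. Weak-* measurability of \<open>\<nu>\<close> is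
  contained in the requirement that these limits belong to \<open>L\<^sup>\<infinity>\<close>.\<close>

definition generates_young_measure ::
    "(real^'n::finite) set \<Rightarrow> (nat \<Rightarrow> real^'n \<Rightarrow> 'b::euclidean_space) \<Rightarrow> (real^'n \<Rightarrow> 'b measure) \<Rightarrow> bool" where
  "generates_young_measure \<Omega> z \<nu> \<longleftrightarrow>
     (AE x in lebesgue_on \<Omega>. sets (\<nu> x) = sets borel \<and> prob_space (\<nu> x)) \<and>
     (\<forall>f :: 'b \<Rightarrow> real. continuous_on UNIV f \<and> (f \<longlongrightarrow> 0) at_infinity \<longrightarrow>
        weak_star_L_infty \<Omega> (\<lambda>j x. f (z j x)) (\<lambda>x. LINT A|\<nu> x. f A))"

definition gradient_young_measure ::
    "(real^'n::finite) set \<Rightarrow> (nat \<Rightarrow> real^'n \<Rightarrow> real^'m::finite) \<Rightarrow> (real^'n \<Rightarrow> (real^'n^'m) measure) \<Rightarrow> bool" where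
  "gradient_young_measure \<Omega> y \<nu> \<longleftrightarrow>
     (\<exists>r. strict_mono r \<and> generates_young_measure \<Omega> (\<lambda>j. weak_gradient \<Omega> (y (r j))) \<nu>)"

definition measure_support :: "'b::topological_space measure \<Rightarrow> 'b set" where
  "measure_support \<mu> = {a. \<forall>U. open U \<and> a \<in> U \<longrightarrow> emeasure \<mu> U \<noteq> 0}"

definition add_measure :: "'b measure \<Rightarrow> 'b measure \<Rightarrow> 'b measure" where
  "add_measure \<mu> \<mu>' = measure_of (space \<mu>) (sets \<mu>) (\<lambda>B. emeasure \<mu> B + emeasure \<mu>' B)"

lemma sets_add_measure [simp]: "sets (add_measure \<mu> \<mu>') = sets \<mu>"
  by (simp add: add_measure_def)

lemma emeasure_add_measure:
  assumes "sets \<mu>' = sets \<mu>" and "B \<in> sets \<mu>"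
  shows "emeasure (add_measure \<mu> \<mu>') B = emeasure \<mu> B + emeasure \<mu>' B"
  unfolding add_measure_def
proof (rule emeasure_measure_of_sigma)
  show "sigma_algebra (space \<mu>) (sets \<mu>)" ..
  show "positive (sets \<mu>) (\<lambda>B. emeasure \<mu> B + emeasure \<mu>' B)"
    by (simp add: positive_def)
  show "countably_additive (sets \<mu>) (\<lambda>B. emeasure \<mu> B + emeasure \<mu>' B)"
    using assms(1) by (auto simp: countably_additive_def suminf_add[symmetric] suminf_emeasure)
qed fact

abbreviation dirac :: "'b::topological_space \<Rightarrow> 'b measure" where
  "dirac a \<equiv> return borel a"

section \<open>The two wells\<close>

definition well_F1 :: "real \<Rightarrow> real^2^2" where
  "well_F1 \<delta> = vector [vector [1, 0], vector [0, 1 + \<delta>]]"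

definition well_F2 :: "real \<Rightarrow> real^2^2" where
  "well_F2 \<delta> = vector [vector [1, 0], vector [0, 1 - \<delta>]]"

definition SO2 :: "(real^2^2) set" where
  "SO2 = {Q. rotation_matrix Q}"

definition wells :: "real \<Rightarrow> (real^2^2) set" where
  "wells \<delta> = (\<lambda>Q. Q ** well_F1 \<delta>) ` SO2 \<union> (\<lambda>Q. Q ** well_F2 \<delta>) ` SO2"

end

theory Submission
  imports Defs
begin

text \<open>Write a matrix of the wells by columns as \<open>A = (a, s J a)\<close>, where \<open>a\<close> is a unit vector, \<open>J\<close> is
the rotation by a right angle and \<open>s = det A\<close> is one of the positive numbers \<open>1 + \<delta>\<close>,
\<open>1 - \<delta>\<close>. Let \<open>a\<^sub>0\<close> be the first column of \<open>F\<close>. The function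
\<open>g A = det A - F\<^sub>1\<^sub>1 A\<^sub>2\<^sub>2 + F\<^sub>2\<^sub>1 A\<^sub>1\<^sub>2\<close> is a combination of minors that vanishes at
\<open>F\<close>, and on the wells it equals \<open>s (1 - a\<^sub>0 \<bullet> a)\<close>.

The minors of an admissible gradient have averages that depend on the boundary values alone:
\<open>\<integral> \<nabla>y = F |\<Omega>|\<close> and \<open>\<integral> det \<nabla>y = det F |\<Omega>|\<close> (\<open>admissible_minors\<close>). In the limit the
average of \<open>a\<close> over \<open>\<Omega>\<close> and \<open>\<nu>\<^sub>x\<close> is \<open>a\<^sub>0\<close>, so \<open>|a\<^sub>0| \<le> 1\<close> and hence \<open>g \<ge> 0\<close> on the wells,
while the average of \<open>g\<close> is zero. Therefore \<open>g = 0\<close> almost everywhere, which forces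
\<open>a = a\<^sub>0\<close>: every \<open>\<nu>\<^sub>x\<close> is carried by \<open>Q F\<^sub>1\<close> and \<open>Q F\<^sub>2\<close>, where \<open>Q\<close> is the rotation with
first column \<open>a\<^sub>0\<close> (\<open>wells_sign\<close>).

The weights could still depend on \<open>x\<close>. The field \<open>\<nabla>y - F\<close>, extended by zero, is curl free in
the whole plane, that is, \<open>\<integral> (\<nabla>y - F) e\<^sub>2 \<partial>\<^sub>1\<phi> = \<integral> (\<nabla>y - F) e\<^sub>1 \<partial>\<^sub>2\<phi>\<close> even when \<open>\<phi>\<close> does not
vanish near the boundary of \<open>\<Omega>\<close>. In the limit the first column of the field vanishes, so its
second column is orthogonal to all derivatives \<open>\<partial>\<^sub>1\<phi>\<close>. Every bump function is such a
derivative, hence the second column vanishes too (\<open>vanishing_of_directional_tests\<close>). The barycentre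
of \<open>\<nu>\<^sub>x\<close> is therefore \<open>F\<close>, and this determines the weight.

Two analytic facts carry this argument. First, for a function \<open>u\<close> with bounded weak gradient and
zero boundary values, the extension by zero has the extended gradient as its weak gradient in the
plane (\<open>weak_global\<close>); this gives both the curl identity and, by mollification, the null Lagrangian
property of the determinant (\<open>null_lagrangian\<close>). Cutting off near the boundary costs an error
\<open>\<integral> u \<phi> \<partial>\<eta>\<close> with \<open>|\<partial>\<eta>|\<close> of order \<open>1 / eps\<close>, which is harmless because \<open>|u| \<le> 2 M dist(\<cdot>, \<partial>\<Omega>)\<close>
(\<open>decay\<close>) and because the layer where \<open>\<partial>\<eta> \<noteq> 0\<close> leaves every compact subset of \<open>\<Omega>\<close>. Second, a
Young measure is tested only with functions that vanish at infinity, which the minors do not; the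
uniform boundedness principle (\<open>uniformly_bounded_of_pairings\<close>) confines the gradients to a fixed
ball, and there the minors can be truncated without any change (\<open>young_measure_limit\<close>).\<close>

section \<open>Smooth functions of one variable\<close>

coinductive smooth_real :: "(real \<Rightarrow> real) \<Rightarrow> bool" where
  "(\<And>t. (f has_real_derivative f' t) (at t)) \<Longrightarrow> smooth_real f' \<Longrightarrow> smooth_real f"

text \<open>Leibniz' rule leaves the class of products of smooth functions but not the algebra that they generate,
so this algebra is what the coinduction for \<open>smooth_real_mult\<close> has to run on.\<close>

inductive smooth_algebra :: "(real \<Rightarrow> real) \<Rightarrow> bool" where
  smooth: "smooth_real f \<Longrightarrow> smooth_algebra f"
| add: "smooth_algebra f \<Longrightarrow> smooth_algebra g \<Longrightarrow> smooth_algebra (\<lambda>t. f t + g t)"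
| mult: "smooth_algebra f \<Longrightarrow> smooth_algebra g \<Longrightarrow> smooth_algebra (\<lambda>t. f t * g t)"

lemma smooth_algebra_deriv:
  "smooth_algebra f \<Longrightarrow> \<exists>f'. (\<forall>t. (f has_real_derivative f' t) (at t)) \<and> smooth_algebra f'"
proof (induction rule: smooth_algebra.induct)
  case (smooth f)
  then show ?case
    by (cases rule: smooth_real.cases) (auto intro: smooth_algebra.smooth)
next
  case (add f g)
  then obtain f' g' where d: "\<And>t. (f has_real_derivative f' t) (at t)" "smooth_algebra f'"
    "\<And>t. (g has_real_derivative g' t) (at t)" "smooth_algebra g'" by blast
  show ?case
    by (rule exI[of _ "\<lambda>t. f' t + g' t"])
      (use d in \<open>auto intro!: derivative_eq_intros smooth_algebra.add\<close>)
next
  case (mult f g)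
  then obtain f' g' where d: "\<And>t. (f has_real_derivative f' t) (at t)" "smooth_algebra f'"
    "\<And>t. (g has_real_derivative g' t) (at t)" "smooth_algebra g'" by blast
  show ?case
    by (rule exI[of _ "\<lambda>t. f' t * g t + f t * g' t"])
      (use d mult.hyps in \<open>auto intro!: derivative_eq_intros smooth_algebra.add smooth_algebra.mult\<close>)
qed

lemma smooth_algebra_imp_smooth: "smooth_algebra f \<Longrightarrow> smooth_real f"
proof (coinduction arbitrary: f)
  case smooth_real
  then show ?case using smooth_algebra_deriv[of f] by blast
qed

lemma smooth_real_mult:
  "smooth_real f \<Longrightarrow> smooth_real g \<Longrightarrow> smooth_real (\<lambda>t. f t * g t)"
  by (rule smooth_algebra_imp_smooth, rule smooth_algebra.mult; rule smooth_algebra.smooth)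

lemma smooth_real_const: "smooth_real (\<lambda>_. c)"
proof (coinduction arbitrary: c)
  case smooth_real
  then show ?case by (intro exI[of _ "\<lambda>_. c"] exI[of _ "\<lambda>_. 0"]) auto
qed

lemma smooth_real_affine:
  assumes "smooth_real f" shows "smooth_real (\<lambda>t. f (a * t + b))"
proof -
  have "smooth_real f \<Longrightarrow> smooth_real (\<lambda>t. c * f (a * t + b))" for c
  proof (coinduction arbitrary: f c)
    case smooth_real
    from smooth_real obtain f' where d: "\<And>t. (f has_real_derivative f' t) (at t)" "smooth_real f'"
      by (cases rule: smooth_real.cases) auto
    show ?case
      using d(2) by (intro exI[of _ "\<lambda>t. c * f (a * t + b)"] exI[of _ "\<lambda>t. (c * a) * f' (a * t + b)"])
        (auto intro!: derivative_eq_intros DERIV_chain2[OF d(1)])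
  qed
  from this[OF assms, of 1] show ?thesis by simp
qed

lemma smooth_real_continuous: "smooth_real f \<Longrightarrow> continuous_on UNIV f"
  by (cases rule: smooth_real.cases) (auto intro!: continuous_at_imp_continuous_on DERIV_isCont)

lemma smooth_real_measurable: "smooth_real f \<Longrightarrow> f \<in> borel_measurable borel"
  by (rule borel_measurable_continuous_onI[OF smooth_real_continuous])

text \<open>The functions \<open>exp (-1/t) / t\<^sup>n\<close>, extended by zero. They are flat at the origin, and their linear
span is closed under differentiation.\<close>

definition flat :: "nat \<Rightarrow> real \<Rightarrow> real" where
  "flat n t = (if t > 0 then exp (- inverse t) * inverse t ^ n else 0)"

lemma flat_tendsto_0: "((\<lambda>t. flat n t) \<longlongrightarrow> 0) (at 0)"
proof -
  have "((\<lambda>s::real. s ^ n / exp s) \<longlongrightarrow> 0) at_top"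
    by (rule tendsto_power_div_exp_0)
  then have "((\<lambda>t::real. inverse t ^ n / exp (inverse t)) \<longlongrightarrow> 0) (at_right 0)"
    by (rule filterlim_compose[OF _ filterlim_inverse_at_top_right])
  then have "((\<lambda>t. flat n t) \<longlongrightarrow> 0) (at_right 0)"
    by (rule Lim_transform_eventually)
      (auto simp: flat_def eventually_at_right_less exp_minus field_simps intro!: eventually_mono[OF eventually_at_right_less])
  moreover have "((\<lambda>t. flat n t) \<longlongrightarrow> 0) (at_left 0)"
    by (rule Lim_transform_eventually[OF tendsto_const])
      (auto simp: flat_def intro!: eventually_mono[OF eventually_at_left_real[of "-1" 0]])
  ultimately show ?thesis by (simp add: filterlim_at_split)
qed

lemma flat_deriv: "(flat n has_real_derivative flat (n + 2) t - real n * flat (n + 1) t) (at t)"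
proof -
  consider "t > 0" | "t < 0" | "t = 0" by linarith
  then show ?thesis
  proof cases
    case 1
    have "((\<lambda>t. exp (- inverse t) * inverse t ^ n) has_real_derivative
        flat (n + 2) t - real n * flat (n + 1) t) (at t)"
      using 1
      apply (auto intro!: derivative_eq_intros simp: flat_def)
      apply (cases n)
       apply (auto simp: power2_eq_square algebra_simps)
      done
    then show ?thesis
      by (rule has_field_derivative_transform_within_open[of _ _ _ "{0<..}"])
        (use 1 in \<open>auto simp: flat_def\<close>)
  next
    case 2
    have "((\<lambda>t. 0) has_real_derivative 0) (at t)" by simp
    then have "(flat n has_real_derivative 0) (at t)"
      by (rule has_field_derivative_transform_within_open[of _ _ _ "{..<0}"])
        (use 2 in \<open>auto simp: flat_def\<close>)
    with 2 show ?thesis by (simp add: flat_def)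
  next
    case 3
    have "((\<lambda>h. flat (n + 1) h) \<longlongrightarrow> 0) (at 0)" by (rule flat_tendsto_0)
    then have "((\<lambda>h. (flat n (0 + h) - flat n 0) / h) \<longlongrightarrow> 0) (at 0)"
      by (rule Lim_transform_eventually)
       (auto simp: flat_def field_simps eventually_at_filter)
    with 3 show ?thesis by (simp add: DERIV_def flat_def)
  qed
qed

lemma smooth_real_flat: "smooth_real (flat n)"
proof -
  define X where "X f \<longleftrightarrow> (\<exists>N::nat. \<exists>c. f = (\<lambda>t. \<Sum>n<N. c n * flat n t))" for f
  have "X f \<Longrightarrow> smooth_real f" for f
  proof (coinduction arbitrary: f)
    case (smooth_real f)
    then obtain N c where f: "f = (\<lambda>t. \<Sum>n<N. c n * flat n t)" by (auto simp: X_def)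
    define c' where "c' m = (if 2 \<le> m then c (m - 2) else 0)
      - (if 1 \<le> m \<and> m \<le> N then real (m - 1) * c (m - 1) else 0)" for m
    define f' where "f' = (\<lambda>t. \<Sum>n<N. c n * (flat (n + 2) t - real n * flat (n + 1) t))"
    have "(\<Sum>n<N. c n * flat (n + 2) t) = (\<Sum>m<N+2. (if 2 \<le> m then c (m - 2) else 0) * flat m t)" for t
      by (simp add: sum.lessThan_Suc_shift del: sum.lessThan_Suc)
    moreover have "(\<Sum>n<N. c n * (real n * flat (n + 1) t)) =
       (\<Sum>m<N+2. (if 1 \<le> m \<and> m \<le> N then real (m - 1) * c (m - 1) else 0) * flat m t)" for t
    proof -
      have "(\<Sum>m<Suc (Suc N). (if 1 \<le> m \<and> m \<le> N then real (m - 1) * c (m - 1) else 0) * flat m t) =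
        (\<Sum>m<Suc N. (if 1 \<le> m \<and> m \<le> N then real (m - 1) * c (m - 1) else 0) * flat m t)"
        by (subst sum.lessThan_Suc) simp
      also have "\<dots> = (\<Sum>n<N. c n * (real n * flat (n + 1) t))"
        by (subst sum.lessThan_Suc_shift) (auto intro!: sum.cong)
      finally show ?thesis by simp
    qed
    ultimately have "f' = (\<lambda>t. \<Sum>m<N+2. c' m * flat m t)"
      unfolding f'_def c'_def by (simp only: right_diff_distrib left_diff_distrib sum_subtractf)
    then have "X f'" unfolding X_def by blast
    moreover have "(f has_real_derivative f' t) (at t)" for t
      unfolding f f'_def by (auto intro!: derivative_eq_intros flat_deriv sum.cong)
    ultimately show ?case by blast
  qed
  moreover have "flat n = (\<lambda>t. \<Sum>m<Suc n. (if m = n then 1 else 0) * flat m t)"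
    by (auto simp: fun_eq_iff if_distrib[of "\<lambda>x. x * _"] cong: if_cong)
  then have "X (flat n)" unfolding X_def
    by (intro exI[of _ "Suc n"] exI[of _ "\<lambda>m. if m = n then 1 else 0"])
  ultimately show ?thesis by blast
qed

text \<open>The derivative of the step is a normalised multiple of \<open>flat 0 t * flat 0 (1 - t)\<close>, which is smooth,
positive on the open unit interval and zero elsewhere.\<close>

lemma smooth_step_exists:
  "\<exists>S b. smooth_real S \<and> smooth_real b \<and> (\<forall>t. (S has_real_derivative b t) (at t)) \<and> (\<forall>t. b t \<ge> 0)
     \<and> (\<forall>t. t \<notin> {0..1} \<longrightarrow> b t = 0) \<and> (\<forall>t\<le>0. S t = 0) \<and> (\<forall>t\<ge>1. S t = 1)"
proof -
  define f where "f t = flat 0 t * flat 0 (1 - t)" for t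
  have sf: "smooth_real f"
    using smooth_real_mult[OF smooth_real_flat[of 0] smooth_real_affine[OF smooth_real_flat[of 0], of "-1" 1]]
    by (simp add: f_def[abs_def])
  have cf: "continuous_on S f" for S
    using smooth_real_continuous[OF sf] continuous_on_subset by blast
  have f0: "f t = 0" if "t \<notin> {0<..<1}" for t using that by (auto simp: f_def flat_def)
  have fpos: "f t \<ge> 0" for t by (auto simp: f_def flat_def)
  (* The lower limit -1 lies left of the support, so T is differentiable at 0 as well. *)
  define T where "T t = integral {-1..t} f" for t
  have dT: "(T has_real_derivative f t) (at t)" for t
  proof (cases "t > -1")
    case True
    have "(T has_real_derivative f t) (at t within {-1..t+1})"
      unfolding T_def by (rule integral_has_real_derivative[OF cf]) (use True in auto)
    then show ?thesis using True by (simp add: at_within_Icc_at)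
  next
    case False
    have "((\<lambda>t. 0) has_real_derivative 0) (at t)" by simp
    then have "(T has_real_derivative 0) (at t)"
    proof (rule has_field_derivative_transform_within_open[of _ _ _ "{..<0}"])
      fix x :: real assume "x \<in> {..<0}"
      then show "0 = T x" unfolding T_def
        using integral_cong[of "{-1..x}" f "\<lambda>_. 0"] f0 by auto
    qed (use False in auto)
    then show ?thesis using False f0[of t] by simp
  qed
  have T0: "T t = 0" if "t \<le> 0" for t
    unfolding T_def using integral_cong[of "{-1..t}" f "\<lambda>_. 0"] f0 that by auto
  have "T 1 > 0"
  proof -
    have "\<exists>z. z > 0 \<and> z < 1 \<and> T 1 - T 0 = (1 - 0) * f z"
      by (rule MVT2) (use dT in auto)
    then obtain z where "0 < z" "z < 1" "T 1 = f z" using T0[of 0] by auto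
    moreover have "f z > 0" using \<open>0 < z\<close> \<open>z < 1\<close> by (simp add: f_def flat_def)
    ultimately show ?thesis by simp
  qed
  have T1: "T t = T 1" if "t \<ge> 1" for t
  proof (cases "t = 1")
    case False
    have "\<exists>z. z > 1 \<and> z < t \<and> T t - T 1 = (t - 1) * f z"
      by (rule MVT2) (use dT that False in auto)
    then show ?thesis using f0 by auto
  qed simp
  have c: "smooth_real (\<lambda>t. inverse (T 1) * f t)"
    by (rule smooth_real_mult[OF smooth_real_const sf])
  have d: "((\<lambda>t. inverse (T 1) * T t) has_real_derivative inverse (T 1) * f t) (at t)" for t
    by (rule DERIV_cmult[OF dT])
  have "smooth_real (\<lambda>t. inverse (T 1) * T t)"
    by (rule smooth_real.intros[OF d c])
  moreover have "\<forall>t. 0 \<le> inverse (T 1) * f t" using \<open>T 1 > 0\<close> fpos by simp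
  moreover have "\<forall>t. t \<notin> {0..1} \<longrightarrow> inverse (T 1) * f t = 0" using f0 by auto
  moreover have "\<forall>t\<le>0. inverse (T 1) * T t = 0" using T0 by simp
  moreover have "\<forall>t\<ge>1. inverse (T 1) * T t = 1"
  proof (intro allI impI)
    fix t :: real assume "1 \<le> t"
    then show "inverse (T 1) * T t = 1" using T1[of t] \<open>T 1 > 0\<close> by (metis left_inverse less_irrefl)
  qed
  ultimately show ?thesis using c d
    by (intro exI[of _ "\<lambda>t. inverse (T 1) * T t"] exI[of _ "\<lambda>t. inverse (T 1) * f t"] conjI) simp_all
qed

definition step :: "real \<Rightarrow> real" where
  "step = (SOME S. \<exists>b. smooth_real S \<and> smooth_real b \<and> (\<forall>t. (S has_real_derivative b t) (at t))
     \<and> (\<forall>t. b t \<ge> 0) \<and> (\<forall>t. t \<notin> {0..1} \<longrightarrow> b t = 0) \<and> (\<forall>t\<le>0. S t = 0) \<and> (\<forall>t\<ge>1. S t = 1))"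

definition bump :: "real \<Rightarrow> real" where "bump = deriv step"

lemma shows smooth_step: "smooth_real step"
  and smooth_bump: "smooth_real bump"
  and step_deriv: "(step has_real_derivative bump t) (at t)"
  and bump_nonneg: "bump t \<ge> 0"
  and bump_outside: "t \<notin> {0..1} \<Longrightarrow> bump t = 0"
  and step_0: "t \<le> 0 \<Longrightarrow> step t = 0"
  and step_1: "t \<ge> 1 \<Longrightarrow> step t = 1"
proof -
  obtain b where b: "smooth_real step \<and> smooth_real b \<and> (\<forall>t. (step has_real_derivative b t) (at t))
     \<and> (\<forall>t. b t \<ge> 0) \<and> (\<forall>t. t \<notin> {0..1} \<longrightarrow> b t = 0) \<and> (\<forall>t\<le>0. step t = 0) \<and> (\<forall>t\<ge>1. step t = 1)"
    using someI_ex[OF smooth_step_exists] unfolding step_def by blast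
  have "bump = b" unfolding bump_def
  proof
    fix t show "deriv step t = b t" by (rule DERIV_imp_deriv) (use b in \<open>elim conjE allE\<close>)
  qed
  note * = b[folded this]
  from * show "smooth_real step" by (elim conjE)
  from * show "smooth_real bump" by (elim conjE)
  from * show "(step has_real_derivative bump t) (at t)" by (elim conjE allE)
  from * show "bump t \<ge> 0" by (elim conjE) (erule spec)
  from * show "t \<notin> {0..1} \<Longrightarrow> bump t = 0" by (elim conjE) (drule spec, erule mp)
  from * show "t \<le> 0 \<Longrightarrow> step t = 0" by (elim conjE) (drule spec, erule mp)
  from * show "t \<ge> 1 \<Longrightarrow> step t = 1" by (elim conjE) (drule spec, erule mp)
qed

lemma step_mono: "s \<le> t \<Longrightarrow> step s \<le> step t"
  by (rule DERIV_nonneg_imp_nondecreasing) (auto intro!: exI[of _ "bump _"] step_deriv bump_nonneg)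

lemma step_bounds: "0 \<le> step t" "step t \<le> 1"
  using step_mono[of "min t 0" t] step_0[of "min t 0"] step_mono[of t "max t 1"] step_1[of "max t 1"] by auto

section \<open>Tensor products as test functions\<close>

text \<open>All test functions below are products of functions of one coordinate each: their smoothness reduces to
one variable, partial derivatives replace a single factor, and integrals factorise.\<close>

definition tens :: "('n::finite \<Rightarrow> real \<Rightarrow> real) \<Rightarrow> real^'n \<Rightarrow> real" where
  "tens p x = (\<Prod>i\<in>UNIV. p i (x $ i))"

lemma tens_upd: "tens (p(k := q)) x = q (x $ k) * (\<Prod>i\<in>UNIV - {k}. p i (x $ i))"
  unfolding tens_def by (subst prod.remove[of _ k]) (auto intro!: prod.cong)

lemma tens_has_derivative:
  assumes "\<And>i. (p i has_real_derivative p' i (x $ i)) (at (x $ i))"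
  shows "(tens p has_derivative
    (\<lambda>h. \<Sum>k\<in>UNIV. p' k (x $ k) * h $ k * (\<Prod>i\<in>UNIV - {k}. p i (x $ i)))) (at x)"
proof -
  have "((\<lambda>x. p i (x $ i)) has_derivative (\<lambda>h. p' i (x $ i) * h $ i)) (at x)" for i
    using has_derivative_compose[OF bounded_linear_imp_has_derivative[OF bounded_linear_vec_nth[of i]]
        assms[of i, unfolded has_field_derivative_def], of UNIV] by simp
  from has_derivative_prod[of UNIV "\<lambda>i x. p i (x $ i)" "\<lambda>i h. p' i (x $ i) * h $ i" x UNIV, OF this]
  show ?thesis by (simp add: tens_def[abs_def])
qed

lemma partial_deriv_tens:
  assumes "\<And>i t. (p i has_real_derivative p' i t) (at t)"
  shows "partial_deriv k (tens p) = tens (p(k := p' k))"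
proof
  fix x :: "real^'a"
  have "(tens p has_derivative
     (\<lambda>h. \<Sum>k\<in>UNIV. p' k (x $ k) * h $ k * (\<Prod>i\<in>UNIV - {k}. p i (x $ i)))) (at x)"
    by (rule tens_has_derivative) (rule assms)
  then have "frechet_derivative (tens p) (at x) =
     (\<lambda>h. \<Sum>k\<in>UNIV. p' k (x $ k) * h $ k * (\<Prod>i\<in>UNIV - {k}. p i (x $ i)))"
    by (rule frechet_derivative_at[symmetric])
  then have "partial_deriv k (tens p) x =
     (\<Sum>j\<in>UNIV. p' j (x $ j) * axis k 1 $ j * (\<Prod>i\<in>UNIV - {j}. p i (x $ i)))"
    unfolding partial_deriv_def by simp
  also have "\<dots> = (\<Sum>j\<in>UNIV. if j = k then p' k (x $ k) * (\<Prod>i\<in>UNIV - {k}. p i (x $ i)) else 0)"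
    by (rule sum.cong) (auto simp: axis_def)
  finally have "partial_deriv k (tens p) x = p' k (x $ k) * (\<Prod>i\<in>UNIV - {k}. p i (x $ i))"
    by simp
  then show "partial_deriv k (tens p) x = tens (p(k := p' k)) x"
    unfolding tens_upd by simp
qed

lemma smooth_fun_tens:
  assumes "\<And>i. smooth_real (p i)" shows "smooth_fun (tens p)"
  using assms
proof (coinduction arbitrary: p)
  case smooth_fun
  have "\<forall>i. \<exists>q. (\<forall>t. (p i has_real_derivative q t) (at t)) \<and> smooth_real q"
    using smooth_fun by (metis smooth_real.cases)
  then obtain p' where p': "\<And>i t. (p i has_real_derivative p' i t) (at t)" "\<And>i. smooth_real (p' i)"
    by metis
  have "\<exists>q. partial_deriv k (tens p) = tens q \<and> (\<forall>i. smooth_real (q i))" for k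
    using p' smooth_fun
    by (intro exI[of _ "p(k := p' k)"]) (auto simp: partial_deriv_tens[OF p'(1)])
  moreover have "tens p differentiable (at x)" for x
    using tens_has_derivative[of p p' x] p'(1) unfolding differentiable_def by blast
  ultimately show ?case by blast
qed

lemma tens_test_function:
  assumes p: "\<And>i. smooth_real (p i)" and 0: "\<And>i t. t \<notin> {a $ i..b $ i} \<Longrightarrow> p i t = 0"
    and sub: "cbox a b \<subseteq> \<Omega>"
  shows "tens p \<in> test_functions \<Omega>"
proof -
  have "{x. tens p x \<noteq> 0} \<subseteq> cbox a b"
    using 0 by (force simp: tens_def mem_box_cart)
  then have "closure {x. tens p x \<noteq> 0} \<subseteq> cbox a b" by (rule closure_minimal) (rule closed_cbox)
  then show ?thesis using sub smooth_fun_tens[OF p] unfolding test_functions_def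
    by (auto intro: compact_closure[THEN iffD2] bounded_subset[OF bounded_cbox] closure_subset[THEN subsetD])
qed

section \<open>Integration over Euclidean space\<close>

lemma integrable_bounded_support:
  fixes f :: "'a::euclidean_space \<Rightarrow> real"
  assumes [measurable]: "f \<in> borel_measurable borel" and C: "\<And>x. \<bar>f x\<bar> \<le> C"
    and S: "bounded S" "\<And>x. x \<notin> S \<Longrightarrow> f x = 0"
  shows "integrable lborel f"
proof -
  obtain a where a: "S \<subseteq> cbox (-a) a" using bounded_subset_cbox_symmetric[OF S(1)] by blast
  have "integrable lborel (\<lambda>x. C * indicator (cbox (-a) a) x)"
    by (intro integrable_mult_right integrable_real_indicator) (auto simp: emeasure_lborel_cbox_eq)
  then show ?thesis
  proof (rule Bochner_Integration.integrable_bound)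
    show "AE x in lborel. norm (f x) \<le> norm (C * indicator (cbox (- a) a) x)"
      using C S(2) a order_trans[OF C abs_ge_self] by (intro AE_I2) (auto simp: indicator_def)
  qed simp
qed

lemma integrable_pair_bounded_support:
  fixes f :: "'a::euclidean_space \<times> 'b::euclidean_space \<Rightarrow> real"
  assumes "f \<in> borel_measurable (borel \<Otimes>\<^sub>M borel)" and C: "\<And>x. \<bar>f x\<bar> \<le> C"
    and S: "bounded S" "bounded T" "\<And>x y. x \<notin> S \<or> y \<notin> T \<Longrightarrow> f (x, y) = 0"
  shows "integrable (lborel \<Otimes>\<^sub>M lborel) f"
  unfolding lborel_prod
  by (rule integrable_bounded_support[of _ C "S \<times> T"]) (use assms in \<open>auto simp: borel_prod intro: bounded_Times\<close>)

lemma measurable_vec_nth [measurable (raw)]: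
  fixes f :: "'a \<Rightarrow> real^'n::finite"
  shows "f \<in> borel_measurable M \<Longrightarrow> (\<lambda>x. f x $ i) \<in> borel_measurable M"
  by (rule measurable_compose[OF _ borel_measurable_nth])

lemma integral_tens:
  fixes p :: "'n::finite \<Rightarrow> real \<Rightarrow> real"
  assumes "\<And>i. integrable lborel (p i)"
  shows "(LBINT x. tens p x) = (\<Prod>i\<in>UNIV. LBINT t. p i t)"
proof -
  have [measurable]: "p i \<in> borel_measurable borel" for i
    using borel_measurable_integrable[OF assms[of i]] by simp
  interpret product_sigma_finite "\<lambda>_. lborel :: real measure" ..
  let ?e = "\<lambda>i::'n. axis i (1::real)"
  have inj: "inj ?e" by (simp add: inj_on_def axis_eq_axis)
  have B: "(Basis :: (real^'n) set) = range ?e"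
    by (auto simp: Basis_vec_def)
  define P where "P b = p (inv ?e b)" for b :: "real^'n"
  have P: "P (?e i) = p i" for i by (simp add: P_def inv_f_f[OF inj])
  have m: "tens p \<in> borel_measurable borel" unfolding tens_def[abs_def] by measurable
  have comp: "(\<Sum>b\<in>Basis. f b *\<^sub>R b) $ i = f (?e i)" for f and i :: 'n
  proof -
    have "(\<Sum>b\<in>Basis. f b *\<^sub>R b) $ i = (\<Sum>j\<in>UNIV. f (?e j) * ?e j $ i)"
      unfolding B by (subst sum.reindex[OF inj]) (simp add: o_def)
    also have "\<dots> = (\<Sum>j\<in>UNIV. if j = i then f (?e j) else 0)"
      by (intro sum.cong) (auto simp: axis_def)
    finally show ?thesis by simp
  qed
  have "(LBINT x. tens p x) = (LINT f|(\<Pi>\<^sub>M b\<in>Basis. lborel). tens p (\<Sum>b\<in>Basis. f b *\<^sub>R b))"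
    by (subst lborel_eq, rule integral_distr) (use m in auto)
  also have "\<dots> = (LINT f|(\<Pi>\<^sub>M b\<in>Basis. lborel). (\<Prod>b\<in>Basis. P b (f b)))"
    unfolding tens_def comp unfolding B by (subst prod.reindex[OF inj]) (simp add: P o_def)
  also have "\<dots> = (\<Prod>b\<in>Basis. LBINT t. P b t)"
    by (rule product_integral_prod) (use assms in \<open>auto simp: P_def\<close>)
  also have "\<dots> = (\<Prod>i\<in>UNIV. LBINT t. p i t)"
    unfolding B by (subst prod.reindex[OF inj]) (simp add: P o_def)
  finally show ?thesis .
qed

lemma borel_measurable_tens [measurable (raw)]:
  assumes "\<And>i. p i \<in> borel_measurable borel" "f \<in> borel_measurable M"
  shows "(\<lambda>x. tens p (f x)) \<in> borel_measurable M"
proof -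
  note [measurable] = assms
  show ?thesis unfolding tens_def by measurable
qed

lemma tens_abs_le:
  assumes "\<And>i t. \<bar>p i t\<bar> \<le> C i" shows "\<bar>tens p x\<bar> \<le> (\<Prod>i\<in>UNIV. C i)"
  unfolding tens_def abs_prod by (rule prod_mono) (simp add: assms)

lemma tens_outside:
  assumes "\<And>i t. t \<notin> {a $ i..b $ i} \<Longrightarrow> p i t = 0" "x \<notin> cbox a b" shows "tens p x = 0"
  using assms by (auto simp: tens_def mem_box_cart) 

lemma deriv_outside:
  assumes "\<And>t. (f has_real_derivative f' t) (at t)" "\<And>t. t \<notin> {a..b} \<Longrightarrow> f t = (0::real)"
    and "t \<notin> {a..b}"
  shows "f' t = 0"
proof -
  have "((\<lambda>t. 0::real) has_real_derivative 0) (at t)" by simp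
  then have "(f has_real_derivative 0) (at t)"
    by (rule has_field_derivative_transform_within_open[of _ _ _ "- {a..b}"]) (use assms in \<open>auto simp: open_Compl\<close>)
  with assms(1) show ?thesis by (rule DERIV_unique)
qed

lemma cont_compact_support:
  assumes "continuous_on UNIV f" "\<And>t. t \<notin> {a..b} \<Longrightarrow> f t = (0::real)"
  shows "\<exists>C. \<forall>t::real. \<bar>f t\<bar> \<le> C" "integrable lborel f"
proof -
  have "compact (f ` {a..b})"
    by (rule compact_continuous_image) (use assms(1) continuous_on_subset in auto)
  then obtain C where C: "\<forall>y\<in>f ` {a..b}. norm y \<le> C" using compact_imp_bounded bounded_iff by blast
  have "\<bar>f t\<bar> \<le> max C 0" for t
    by (cases "t \<in> {a..b}") (use C assms(2) in \<open>auto simp: le_max_iff_disj\<close>)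
  then show "\<exists>C. \<forall>t. \<bar>f t\<bar> \<le> C" and "integrable lborel f"
    using integrable_bounded_support[OF borel_measurable_continuous_onI[OF assms(1)], of "max C 0" "{a..b}"] assms(2)
    by auto
qed

lemma integral_deriv_compact_support:
  assumes d: "\<And>t. (f has_real_derivative f' t) (at t)" and c: "continuous_on UNIV f'"
    and 0: "\<And>t. t \<notin> {a..b} \<Longrightarrow> f t = (0::real)"
  shows "(LBINT t. f' t) = 0" and "(LBINT t. t * f' t) = - (LBINT t. f t)"
proof -
  have *: "(LBINT t. h' t) = 0" if d: "\<And>t. (h has_real_derivative h' t) (at t)" and c: "continuous_on UNIV h'"
    and 0: "\<And>t. t \<notin> {a..b} \<Longrightarrow> h t = (0::real)" for h h'
  proof -
    have h': "h' t = 0" if "t \<notin> {a..b}" for t using d 0 that by (rule deriv_outside)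
    have "h' t = h' t * indicator {a-1..max b a+1} t" for t
      using h'[of t] by (cases "t \<in> {a..b}") (auto simp: indicator_def)
    then have "(LBINT t. h' t) = (LBINT t. h' t * indicator {a-1..max b a+1} t)"
      by (rule Bochner_Integration.integral_cong[OF refl])
    also have "\<dots> = h (max b a + 1) - h (a - 1)"
      by (rule integral_FTC_Icc_real) (use d c in \<open>auto simp: continuous_on_eq_continuous_at\<close>)
    also have "\<dots> = 0" using 0[of "max b a + 1"] 0[of "a - 1"] by (simp add: max_def split: if_splits)
    finally show ?thesis .
  qed
  show "(LBINT t. f' t) = 0" by (rule *[OF d c 0])
  have cf: "continuous_on UNIV f" using d by (auto intro!: continuous_at_imp_continuous_on DERIV_isCont)
  have i1: "integrable lborel f" by (rule cont_compact_support(2)[OF cf 0])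
  have f': "f' t = 0" if "t \<notin> {a..b}" for t using d 0 that by (rule deriv_outside)
  have i2: "integrable lborel (\<lambda>t. t * f' t)"
    by (rule cont_compact_support(2)[of _ a b]) (use c f' in \<open>auto intro!: continuous_intros\<close>)
  have "(LBINT t. f t + t * f' t) = 0"
    by (rule *[of "\<lambda>t. t * f t"]) (use d c cf 0 in \<open>auto intro!: derivative_eq_intros continuous_intros\<close>)
  then show "(LBINT t. t * f' t) = - (LBINT t. f t)"
    using i1 i2 by simp
qed

lemma integral_lborel_affine:
  fixes f :: "'a::euclidean_space \<Rightarrow> real"
  assumes [measurable]: "f \<in> borel_measurable borel" and "c \<noteq> 0"
  shows "(LBINT x. f x) = \<bar>c\<bar> ^ DIM('a) * (LBINT x. f (t + c *\<^sub>R x))"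
  by (subst lborel_affine[OF assms(2), of t])
    (simp add: integral_density integral_distr)

lemma integrable_lborel_translate:
  fixes f :: "'a::euclidean_space \<Rightarrow> real"
  assumes "integrable lborel f"
  shows "integrable lborel (\<lambda>x. f (x - t))" "(LBINT x. f (x - t)) = (LBINT x. f x)"
proof -
  have [measurable]: "f \<in> borel_measurable borel" using borel_measurable_integrable[OF assms] by simp
  have *: "distr lborel borel (\<lambda>x. x - t) = lborel"
    using lborel_distr_plus[of "-t"] by (metis (no_types, lifting) ext add.commute uminus_add_conv_diff)
  show "integrable lborel (\<lambda>x. f (x - t))"
    using assms by (subst (asm) *[symmetric]) (simp add: integrable_distr_eq)
  show "(LBINT x. f (x - t)) = (LBINT x. f x)"
    by (subst (2) *[symmetric]) (simp add: integral_distr)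
qed

text \<open>Where \<open>x\<close> lies in the open set \<open>U\<close>, the shifted indicator converges to 1 pointwise, so the part of
\<open>U\<close> that is lost by the shift tends to zero. The part that is gained has the same measure, because
translations preserve Lebesgue measure.\<close>

lemma translation_L1_open:
  fixes U :: "'a::euclidean_space set" and t :: "nat \<Rightarrow> 'a"
  assumes U: "open U" "emeasure lborel U < \<infinity>" and t: "t \<longlonglongrightarrow> 0"
  shows "(\<lambda>n. LBINT x. \<bar>indicator U (x - t n) - indicator U x :: real\<bar>) \<longlonglongrightarrow> 0"
proof -
  let ?I = "indicator U :: 'a \<Rightarrow> real"
  have [measurable]: "U \<in> sets borel" using U by auto
  have i: "integrable lborel ?I" using U by simp
  note tr = integrable_lborel_translate[OF i]
  have "(\<lambda>n. LBINT x. max 0 (?I x - ?I (x - t n))) \<longlonglongrightarrow> (LINT x|(lborel::'a measure). (0::real))"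
  proof (rule integral_dominated_convergence[where w="?I"])
    show "AE x in lborel. (\<lambda>n. max 0 (?I x - ?I (x - t n))) \<longlonglongrightarrow> (0::real)"
    proof (rule AE_I2)
      fix x :: 'a
      show "(\<lambda>n. max 0 (?I x - ?I (x - t n))) \<longlonglongrightarrow> (0::real)"
      proof (cases "x \<in> U")
        case True
        have "(\<lambda>n. x - t n) \<longlonglongrightarrow> x - 0" by (intro tendsto_intros t)
        then have "\<forall>\<^sub>F n in sequentially. x - t n \<in> U"
          using U(1) True by (auto dest: topological_tendstoD)
        then show ?thesis
          by (intro tendsto_eventually) (auto elim!: eventually_mono)
      next
        case False
        then have "max 0 (?I x - ?I (x - t n)) = 0" for n by (simp add: indicator_def)
        then show ?thesis by simp
      qed
    qed
  qed (use i in \<open>auto simp: indicator_def\<close>)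
  then have "(\<lambda>n. 2 * (LBINT x. max 0 (?I x - ?I (x - t n)))) \<longlonglongrightarrow> 2 * 0"
    by (intro tendsto_intros) simp
  moreover have "(LBINT x. \<bar>?I (x - t n) - ?I x\<bar>) = 2 * (LBINT x. max 0 (?I x - ?I (x - t n)))" for n
  proof -
    have im: "integrable lborel (\<lambda>x. max 0 (?I x - ?I (x - t n)))"
      using i tr(1)[of "t n"] by (intro integrable_max) auto
    have "(LBINT x. \<bar>?I (x - t n) - ?I x\<bar>) =
       (LBINT x. 2 * max 0 (?I x - ?I (x - t n)) + (?I (x - t n) - ?I x))"
      by (intro Bochner_Integration.integral_cong) (auto simp: indicator_def)
    also have "\<dots> = 2 * (LBINT x. max 0 (?I x - ?I (x - t n)))"
      using im i tr[of "t n"] by (subst Bochner_Integration.integral_add) auto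
    finally show ?thesis .
  qed
  ultimately show ?thesis by simp
qed

lemma translation_L1_triangle:
  fixes f g :: "'a::euclidean_space \<Rightarrow> real"
  assumes f: "integrable lborel f" and g: "integrable lborel g"
  shows "(LBINT x. \<bar>f (x - t) - f x\<bar>) \<le>
    (LBINT x. \<bar>g (x - t) - g x\<bar>) + 2 * (LBINT x. \<bar>f x - g x\<bar>)"
proof -
  have fg: "integrable lborel (\<lambda>x. \<bar>f x - g x\<bar>)" using f g by auto
  note tf = integrable_lborel_translate(1)[OF f, of t] note tg = integrable_lborel_translate(1)[OF g, of t]
  note tfg = integrable_lborel_translate[OF fg, of t]
  have "(LBINT x. \<bar>f (x - t) - f x\<bar>) \<le>
    (LBINT x. \<bar>g (x - t) - g x\<bar> + (\<bar>f (x - t) - g (x - t)\<bar> + \<bar>f x - g x\<bar>))"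
    by (intro integral_mono) (use f g tf tg tfg in auto)
  also have "\<dots> = (LBINT x. \<bar>g (x - t) - g x\<bar>) + (LBINT x. \<bar>f (x - t) - g (x - t)\<bar> + \<bar>f x - g x\<bar>)"
    by (intro Bochner_Integration.integral_add) (use f g tf tg tfg in auto)
  also have "(LBINT x. \<bar>f (x - t) - g (x - t)\<bar> + \<bar>f x - g x\<bar>) = 2 * (LBINT x. \<bar>f x - g x\<bar>)"
    by (subst Bochner_Integration.integral_add) (use fg tfg in auto)
  finally show ?thesis .
qed

lemma translation_L1_approx:
  fixes f :: "'a::euclidean_space \<Rightarrow> real"
  assumes f: "integrable lborel f"
    and app: "\<And>e. e > 0 \<Longrightarrow> \<exists>g. integrable lborel g \<and> (LBINT x. \<bar>f x - g x\<bar>) \<le> e \<and>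
       (\<lambda>n. LBINT x. \<bar>g (x - t n) - g x\<bar>) \<longlonglongrightarrow> 0"
  shows "(\<lambda>n. LBINT x. \<bar>f (x - t n) - f x\<bar>) \<longlonglongrightarrow> 0"
proof (rule LIMSEQ_I)
  fix r :: real assume "r > 0"
  then obtain g where g: "integrable lborel g" "(LBINT x. \<bar>f x - g x\<bar>) \<le> r / 4"
       "(\<lambda>n. LBINT x. \<bar>g (x - t n) - g x\<bar>) \<longlonglongrightarrow> 0" using app[of "r/4"] by auto
  obtain N where N: "\<And>n. n \<ge> N \<Longrightarrow> norm ((LBINT x. \<bar>g (x - t n) - g x\<bar>) - 0) < r / 2"
    using LIMSEQ_D[OF g(3), of "r/2"] \<open>r > 0\<close> by auto
  show "\<exists>no. \<forall>n\<ge>no. norm ((LBINT x. \<bar>f (x - t n) - f x\<bar>) - 0) < r"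
  proof (intro exI allI impI)
    fix n assume "N \<le> n"
    from N[OF this] have "\<bar>LBINT x. \<bar>g (x - t n) - g x\<bar>\<bar> < r / 2" by simp
    moreover have "0 \<le> (LBINT x. \<bar>f (x - t n) - f x\<bar>)" by simp
    ultimately show "norm ((LBINT x. \<bar>f (x - t n) - f x\<bar>) - 0) < r"
      using translation_L1_triangle[OF f g(1), of "t n"] g(2) by simp
  qed
qed

text \<open>Continuity of translations in \<open>L\<^sup>1\<close>: outer regularity passes from open sets to measurable sets of
finite measure, and the property is stable under sums and \<open>L\<^sup>1\<close> limits.\<close>

lemma translation_L1:
  fixes f :: "'a::euclidean_space \<Rightarrow> real" and t :: "nat \<Rightarrow> 'a"
  assumes "integrable lborel f" and t: "t \<longlonglongrightarrow> 0"
  shows "(\<lambda>n. LBINT x. \<bar>f (x - t n) - f x\<bar>) \<longlonglongrightarrow> 0"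
  using assms(1)
proof (induction rule: integrable_induct)
  case (base A c)
  then have [measurable]: "A \<in> sets borel" by simp
  have iA: "integrable lborel (indicator A :: 'a \<Rightarrow> real)" using base by simp
  have "(\<lambda>n. LBINT x. \<bar>indicator A (x - t n) - indicator A x :: real\<bar>) \<longlonglongrightarrow> 0"
  proof (rule translation_L1_approx[OF iA])
    fix e :: real assume "e > 0"
    then obtain U where U: "open U" "A \<subseteq> U" "emeasure lborel (U - A) < e"
      using outer_regular_lborel[of A e] by auto
    then have [measurable]: "U \<in> sets borel" by auto
    have "emeasure lborel U \<le> emeasure lborel A + emeasure lborel (U - A)"
      using U(2) by (subst plus_emeasure) (auto simp: Un_absorb1)
    also have "\<dots> < \<infinity>" using base(2) U(3) by (auto simp: less_top[symmetric] top_unique)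
    finally have fU: "emeasure lborel U < \<infinity>" .
    have "(LBINT x. \<bar>indicator A x - indicator U x :: real\<bar>) = (LBINT x. indicator (U - A) x)"
      using U(2) by (intro Bochner_Integration.integral_cong) (auto simp: indicator_def)
    also have "\<dots> = measure lborel (U - A)" by simp
    also have "\<dots> \<le> e" using U(3) \<open>e > 0\<close>
      unfolding measure_def by (intro enn2real_leI) auto
    finally show "\<exists>g. integrable lborel g \<and> (LBINT x. \<bar>indicator A x - g x\<bar>) \<le> e \<and>
       (\<lambda>n. LBINT x. \<bar>g (x - t n) - g x\<bar>) \<longlonglongrightarrow> 0"
      using fU translation_L1_open[OF U(1) fU t] by (intro exI[of _ "indicator U"]) auto
  qed
  then have "(\<lambda>n. (LBINT x. \<bar>indicator A (x - t n) - indicator A x :: real\<bar>) * \<bar>c\<bar>) \<longlonglongrightarrow> 0 * \<bar>c\<bar>"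
    by (intro tendsto_intros)
  then show ?case
    by (simp add: left_diff_distrib[symmetric] abs_mult)
next
  case (add f g)
  have "(\<lambda>n. (LBINT x. \<bar>f (x - t n) - f x\<bar>) + (LBINT x. \<bar>g (x - t n) - g x\<bar>)) \<longlonglongrightarrow> 0 + 0"
    by (intro tendsto_intros add.IH)
  then have "(\<lambda>n. (LBINT x. \<bar>f (x - t n) - f x\<bar>) + (LBINT x. \<bar>g (x - t n) - g x\<bar>)) \<longlonglongrightarrow> 0" by simp
  then show ?case
  proof (rule Lim_null_comparison[rotated], intro always_eventually allI)
    fix n
    note i = integrable_lborel_translate(1)[OF add.hyps(1), of "t n"]
       integrable_lborel_translate(1)[OF add.hyps(2), of "t n"] add.hyps
    have "(LBINT x. \<bar>f (x - t n) + g (x - t n) - (f x + g x)\<bar>)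
      \<le> (LBINT x. \<bar>f (x - t n) - f x\<bar> + \<bar>g (x - t n) - g x\<bar>)"
      by (intro integral_mono) (use i in auto)
    also have "\<dots> = (LBINT x. \<bar>f (x - t n) - f x\<bar>) + (LBINT x. \<bar>g (x - t n) - g x\<bar>)"
      by (intro Bochner_Integration.integral_add) (use i in auto)
    finally show "norm (LBINT x. \<bar>f (x - t n) + g (x - t n) - (f x + g x)\<bar>) \<le>
       (LBINT x. \<bar>f (x - t n) - f x\<bar>) + (LBINT x. \<bar>g (x - t n) - g x\<bar>)" by simp
  qed
next
  case (lim f s)
  show ?case
  proof (rule translation_L1_approx[OF \<open>integrable lborel f\<close>])
    fix e :: real assume "e > 0"
    have "(\<lambda>i. LBINT x. \<bar>f x - s i x\<bar>) \<longlonglongrightarrow> (LINT x|(lborel::'a measure). (0::real))"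
    proof (rule integral_dominated_convergence[where w="\<lambda>x. 3 * \<bar>f x\<bar>"])
      show "AE x in lborel. (\<lambda>i. \<bar>f x - s i x\<bar>) \<longlonglongrightarrow> 0"
        using lim(2) by (intro AE_I2 tendsto_rabs_zero) (auto intro!: tendsto_eq_intros)
      show "AE x in lborel. norm \<bar>f x - s i x\<bar> \<le> 3 * \<bar>f x\<bar>" for i
      proof (rule AE_I2)
        fix x show "norm \<bar>f x - s i x\<bar> \<le> 3 * \<bar>f x\<bar>" using lim(3)[of x i] by simp
      qed
      show "(\<lambda>x. \<bar>f x - s i x\<bar>) \<in> borel_measurable lborel" for i
        using borel_measurable_integrable[OF lim(4)] borel_measurable_integrable[OF lim(1)[of i]] by measurable
    qed (use lim(4) in auto)
    then have "\<forall>\<^sub>F i in sequentially. (LBINT x. \<bar>f x - s i x\<bar>) < e"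
      using \<open>e > 0\<close> by (intro order_tendstoD(2)[of _ 0]) auto
    then obtain i where "(LBINT x. \<bar>f x - s i x\<bar>) < e"
      using eventually_happens'[OF sequentially_bot] by blast
    then show "\<exists>g. integrable lborel g \<and> (LBINT x. \<bar>f x - g x\<bar>) \<le> e \<and>
       (\<lambda>n. LBINT x. \<bar>g (x - t n) - g x\<bar>) \<longlonglongrightarrow> 0"
      using lim(1)[of i] lim.IH[of i] by (intro exI[of _ "s i"]) auto
  qed
qed

lemma integral_translate_tendsto:
  fixes f g :: "'a::euclidean_space \<Rightarrow> real" and t :: "nat \<Rightarrow> 'a"
  assumes [measurable]: "f \<in> borel_measurable borel" and C: "\<And>x. \<bar>f x\<bar> \<le> C"
    and g: "integrable lborel g" and t: "t \<longlonglongrightarrow> 0"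
  shows "(\<lambda>n. LBINT x. f x * g (x - t n)) \<longlonglongrightarrow> (LBINT x. f x * g x)"
proof -
  have [measurable]: "g \<in> borel_measurable borel" using borel_measurable_integrable[OF g] by simp
  have fi: "integrable lborel (\<lambda>x. f x * h x)" if "integrable lborel h" for h
  proof (rule Bochner_Integration.integrable_bound)
    show "integrable lborel (\<lambda>x. C * h x)" using that by simp
    have [measurable]: "h \<in> borel_measurable borel" using borel_measurable_integrable[OF that] by simp
    show "(\<lambda>x. f x * h x) \<in> borel_measurable lborel" by simp
    show "AE x in lborel. norm (f x * h x) \<le> norm (C * h x)"
      using C order_trans[OF C abs_ge_self] by (intro AE_I2) (auto simp: abs_mult intro!: mult_right_mono)
  qed
  have "(\<lambda>n. C * (LBINT x. \<bar>g (x - t n) - g x\<bar>)) \<longlonglongrightarrow> C * 0"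
    by (intro tendsto_intros translation_L1 g t)
  then have "(\<lambda>n. C * (LBINT x. \<bar>g (x - t n) - g x\<bar>)) \<longlonglongrightarrow> 0" by simp
  then have "(\<lambda>n. (LBINT x. f x * g (x - t n)) - (LBINT x. f x * g x)) \<longlonglongrightarrow> 0"
  proof (rule Lim_null_comparison[rotated], intro always_eventually allI)
    fix n
    note tg = integrable_lborel_translate(1)[OF g, of "t n"]
    have "\<bar>(LBINT x. f x * g (x - t n)) - (LBINT x. f x * g x)\<bar> =
       \<bar>LBINT x. f x * (g (x - t n) - g x)\<bar>"
      by (subst Bochner_Integration.integral_diff[symmetric]) (use fi[OF g] fi[OF tg] in \<open>auto simp: right_diff_distrib\<close>)
    also have "\<dots> \<le> (LBINT x. \<bar>f x * (g (x - t n) - g x)\<bar>)"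
      by (rule integral_abs_bound)
    also have "\<dots> \<le> (LBINT x. C * \<bar>g (x - t n) - g x\<bar>)"
    proof (rule integral_mono)
      have "integrable lborel (\<lambda>x. f x * (g (x - t n) - g x))" by (rule fi) (use tg g in auto)
      then show "integrable lborel (\<lambda>x. \<bar>f x * (g (x - t n) - g x)\<bar>)" by simp
    qed (use tg g C in \<open>auto simp: abs_mult intro!: mult_right_mono\<close>)
    finally show "norm ((LBINT x. f x * g (x - t n)) - (LBINT x. f x * g x)) \<le>
      C * (LBINT x. \<bar>g (x - t n) - g x\<bar>)" by simp
  qed
  then show ?thesis by (rule LIM_zero_cancel)
qed

section \<open>Mollification\<close>

text \<open>Each factor carries its own \<open>1 / eps\<close>, so that tensor products of scaled factors keep their integral
in every dimension.\<close>

definition scaled :: "real \<Rightarrow> ('n::finite \<Rightarrow> real \<Rightarrow> real) \<Rightarrow> 'n \<Rightarrow> real \<Rightarrow> real" where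
  "scaled eps q i t = q i (t / eps) / eps"

definition moll :: "real \<Rightarrow> real^'n::finite \<Rightarrow> real" where
  "moll eps = tens (scaled eps (\<lambda>_. bump))"

lemma measurable_scaled [measurable]:
  assumes "\<And>i. q i \<in> borel_measurable borel"
  shows "scaled eps q i \<in> borel_measurable borel"
proof -
  have "(\<lambda>t. q i (t / eps)) \<in> borel_measurable borel"
    by (rule measurable_compose[OF _ assms]) simp
  then show ?thesis unfolding scaled_def[abs_def] by simp
qed

lemma measurable_bump [measurable]: "bump \<in> borel_measurable borel"
  by (rule smooth_real_measurable[OF smooth_bump])

lemma measurable_moll [measurable]: "moll eps \<in> borel_measurable borel"
  unfolding moll_def[abs_def] by (intro borel_measurable_tens measurable_scaled) simp_all

lemma integral_scaled:
  fixes h :: "real^'n::finite \<Rightarrow> real"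
  assumes [measurable]: "h \<in> borel_measurable borel" "\<And>i. q i \<in> borel_measurable borel" and e: "eps > 0"
  shows "(LBINT z. h z * tens (scaled eps q) (x - z)) = (LBINT v. h (x - eps *\<^sub>R v) * tens q v)"
proof -
  have "tens (scaled eps q) (eps *\<^sub>R v) = tens q v / eps ^ CARD('n)" for v
    using e by (simp add: tens_def scaled_def prod_dividef)
  moreover have "(\<lambda>z. h z * tens (scaled eps q) (x - z)) \<in> borel_measurable borel" by measurable
  from integral_lborel_affine[OF this, of "-eps" x]
  have "(LBINT z. h z * tens (scaled eps q) (x - z)) =
    eps ^ CARD('n) * (LBINT v. h (x - eps *\<^sub>R v) * tens (scaled eps q) (eps *\<^sub>R v))"
    using e by simp
  ultimately show ?thesis using e by simp
qed

lemma bump_bounded: "\<exists>C. \<forall>t. \<bar>bump t\<bar> \<le> C" and integrable_bump: "integrable lborel bump"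
  using cont_compact_support[OF smooth_real_continuous[OF smooth_bump], of 0 1] bump_outside by auto

lemma integral_bump: "(LBINT t. bump t) = 1"
proof -
  have "(LBINT t. bump t) = (LBINT t. bump t * indicator {0..1} t)"
    using bump_outside by (intro Bochner_Integration.integral_cong) (auto simp: indicator_def)
  also have "\<dots> = step 1 - step 0"
    by (rule integral_FTC_Icc_real)
      (use step_deriv smooth_real_continuous[OF smooth_bump] in \<open>auto simp: continuous_on_eq_continuous_at\<close>)
  finally show ?thesis using step_0[of 0] step_1[of 1] by simp
qed

lemma tens_bump:
  fixes x :: "real^'n::finite"
  shows "tens (\<lambda>_. bump) x \<ge> 0" "\<exists>C. \<forall>x::real^'n. \<bar>tens (\<lambda>_. bump) x\<bar> \<le> C"
    "x \<notin> cbox 0 1 \<Longrightarrow> tens (\<lambda>_. bump) x = 0"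
    "integrable lborel (tens (\<lambda>_. bump) :: real^'n \<Rightarrow> real)"
    "(LBINT x. tens (\<lambda>_. bump) (x::real^'n)) = 1"
proof -
  show "tens (\<lambda>_. bump) x \<ge> 0" by (auto simp: tens_def bump_nonneg intro!: prod_nonneg)
  obtain C where "\<And>t. \<bar>bump t\<bar> \<le> C" using bump_bounded by auto
  from tens_abs_le[OF this, of "\<lambda>_. bump"]
  have C: "\<bar>tens (\<lambda>_. bump) (x::real^'n)\<bar> \<le> C ^ CARD('n)" for x
    using tens_abs_le[of "\<lambda>_. bump" "\<lambda>_. C"] \<open>\<And>t. \<bar>bump t\<bar> \<le> C\<close> by simp
  then show "\<exists>C. \<forall>x::real^'n. \<bar>tens (\<lambda>_. bump) x\<bar> \<le> C" by blast
  show out: "x \<notin> cbox 0 1 \<Longrightarrow> tens (\<lambda>_. bump) x = 0" for x :: "real^'n"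
    by (rule tens_outside) (auto simp: bump_outside)
  show "integrable lborel (tens (\<lambda>_. bump) :: real^'n \<Rightarrow> real)"
    by (rule integrable_bounded_support[OF _ C _ out]) auto
  show "(LBINT x. tens (\<lambda>_. bump) (x::real^'n)) = 1"
    by (subst integral_tens) (auto simp: integrable_bump integral_bump)
qed

lemma moll_tendsto_point:
  fixes u :: "real^'n::finite \<Rightarrow> real"
  assumes u: "continuous_on UNIV u" and C: "\<And>x. \<bar>u x\<bar> \<le> C" and e: "eps \<longlonglongrightarrow> 0" "\<And>n. eps n > (0::real)"
  shows "(\<lambda>n. LBINT z. u z * moll (eps n) (x - z)) \<longlonglongrightarrow> u x"
proof -
  have [measurable]: "u \<in> borel_measurable borel" by (rule borel_measurable_continuous_onI[OF u])
  have "(\<lambda>n. LBINT v. u (x - eps n *\<^sub>R v) * tens (\<lambda>_. bump) v) \<longlonglongrightarrow> (LBINT v. u x * tens (\<lambda>_. bump) (v::real^'n))"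
  proof (rule integral_dominated_convergence[where w="\<lambda>v. C * tens (\<lambda>_. bump) v"])
    show "AE v in lborel. (\<lambda>n. u (x - eps n *\<^sub>R v) * tens (\<lambda>_. bump) v) \<longlonglongrightarrow> u x * tens (\<lambda>_. bump) v"
    proof (rule AE_I2)
      fix v
      have "(\<lambda>n. x - eps n *\<^sub>R v) \<longlonglongrightarrow> x - 0 *\<^sub>R v" by (intro tendsto_intros e)
      then have "(\<lambda>n. u (x - eps n *\<^sub>R v)) \<longlonglongrightarrow> u x"
        using u by (intro continuous_on_tendsto_compose[OF u]) auto
      then show "(\<lambda>n. u (x - eps n *\<^sub>R v) * tens (\<lambda>_. bump) v) \<longlonglongrightarrow> u x * tens (\<lambda>_. bump) v"
        by (intro tendsto_intros)
    qed
    show "AE v in lborel. norm (u (x - eps n *\<^sub>R v) * tens (\<lambda>_. bump) v) \<le> C * tens (\<lambda>_. bump) v" for n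
    proof (rule AE_I2)
      fix v show "norm (u (x - eps n *\<^sub>R v) * tens (\<lambda>_. bump) v) \<le> C * tens (\<lambda>_. bump) v"
        using C[of "x - eps n *\<^sub>R v"] tens_bump(1)[of v] by (simp add: abs_mult mult_right_mono)
    qed
    show "integrable lborel (\<lambda>v::real^'n. C * tens (\<lambda>_. bump) v)"
      by (intro integrable_mult_right tens_bump(4))
  qed measurable
  then show ?thesis using integral_scaled[of u "\<lambda>_. bump" "eps _" x] e(2) tens_bump(5)[where 'n='n]
    by (simp add: moll_def)
qed

text \<open>Only the pairing with a fixed bounded function is needed, and after the substitution
\<open>z = x - eps v\<close> and an exchange of integrals it becomes an average of translates.\<close>

lemma moll_tendsto_pairing:
  fixes f g :: "real^'n::finite \<Rightarrow> real"
  assumes [measurable]: "f \<in> borel_measurable borel" "g \<in> borel_measurable borel"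
    and C: "\<And>x. \<bar>f x\<bar> \<le> C" "\<And>x. \<bar>g x\<bar> \<le> C" and S: "bounded S" "\<And>x. x \<notin> S \<Longrightarrow> f x = 0" "\<And>x. x \<notin> S \<Longrightarrow> g x = 0"
    and e: "eps \<longlonglongrightarrow> 0" "\<And>n. eps n > (0::real)"
  shows "(\<lambda>n. LBINT x. f x * (LBINT z. g z * moll (eps n) (x - z))) \<longlonglongrightarrow> (LBINT x. f x * g x)"
proof -
  let ?r = "tens (\<lambda>_. bump) :: real^'n \<Rightarrow> real"
  have C0: "0 \<le> C" using order_trans[OF abs_ge_zero C(1)] .
  obtain D where D: "\<And>x. \<bar>?r x\<bar> \<le> D" using tens_bump(2) by blast
  have fi: "integrable lborel f" by (rule integrable_bounded_support[OF _ C(1) S(1,2)]) simp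
  have gi: "integrable lborel g" by (rule integrable_bounded_support[OF _ C(2) S(1,3)]) simp
  have "(LBINT x. f x * (LBINT z. g z * moll (eps n) (x - z))) =
     (LBINT v. (LBINT x. f x * g (x - eps n *\<^sub>R v)) * ?r v)" for n
  proof -
    have "(LBINT x. f x * (LBINT z. g z * moll (eps n) (x - z))) =
      (LBINT x. (LBINT v. f x * g (x - eps n *\<^sub>R v) * ?r v))"
      unfolding moll_def using e(2) by (subst integral_scaled) (auto simp: mult.assoc)
    also have "\<dots> = (LBINT v. (LBINT x. f x * g (x - eps n *\<^sub>R v) * ?r v))"
    proof (rule lborel_pair.Fubini_integral)
      show "integrable (lborel \<Otimes>\<^sub>M lborel) (\<lambda>(v, x). f x * g (x - eps n *\<^sub>R v) * ?r v)"
      proof (rule integrable_pair_bounded_support[where S="cbox 0 1" and T=S])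
        show "\<bar>case y of (v, x) \<Rightarrow> f x * g (x - eps n *\<^sub>R v) * ?r v\<bar> \<le> C * C * D" for y
          using C D C0 by (auto simp: abs_mult split: prod.split intro!: mult_mono)
        show "(case (v, x) of (v, x) \<Rightarrow> f x * g (x - eps n *\<^sub>R v) * ?r v) = 0" if "v \<notin> cbox 0 1 \<or> x \<notin> S" for v x
          using that S tens_bump(3) by auto
      qed (use S in \<open>simp_all add: split_beta\<close>)
    qed
    finally show ?thesis by simp
  qed
  moreover have "(\<lambda>n. LBINT v. (LBINT x. f x * g (x - eps n *\<^sub>R v)) * ?r v) \<longlonglongrightarrow>
     (LBINT v. (LBINT x. f x * g x) * ?r v)"
  proof (rule integral_dominated_convergence[where w="\<lambda>v. (LBINT x. C * \<bar>f x\<bar>) * ?r v"])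
    show "AE v in lborel. (\<lambda>n. (LBINT x. f x * g (x - eps n *\<^sub>R v)) * ?r v) \<longlonglongrightarrow> (LBINT x. f x * g x) * ?r v"
    proof (rule AE_I2)
      fix v :: "real^'n"
      have "(\<lambda>n. eps n *\<^sub>R v) \<longlonglongrightarrow> 0 *\<^sub>R v" by (intro tendsto_intros e)
      then show "(\<lambda>n. (LBINT x. f x * g (x - eps n *\<^sub>R v)) * ?r v) \<longlonglongrightarrow> (LBINT x. f x * g x) * ?r v"
        using C gi by (intro tendsto_intros integral_translate_tendsto[of f C]) auto
    qed
    show "AE v in lborel. norm ((LBINT x. f x * g (x - eps n *\<^sub>R v)) * ?r v) \<le> (LBINT x. C * \<bar>f x\<bar>) * ?r v" for n
    proof (rule AE_I2)
      fix v :: "real^'n"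
      have "integrable lborel (\<lambda>x. f x * g (x - eps n *\<^sub>R v))"
        by (rule integrable_bounded_support[of _ "C*C" S])
          (use C C0 S in \<open>auto simp: abs_mult intro!: mult_mono\<close>)
      then have i: "integrable lborel (\<lambda>x. \<bar>f x * g (x - eps n *\<^sub>R v)\<bar>)" by (rule integrable_abs)
      have "\<bar>LBINT x. f x * g (x - eps n *\<^sub>R v)\<bar> \<le> (LBINT x. \<bar>f x * g (x - eps n *\<^sub>R v)\<bar>)"
        by (rule integral_abs_bound)
      also have "\<dots> \<le> (LBINT x. C * \<bar>f x\<bar>)"
      proof (rule integral_mono[OF i])
        show "\<bar>f x * g (x - eps n *\<^sub>R v)\<bar> \<le> C * \<bar>f x\<bar>" for x
          using C(2)[of "x - eps n *\<^sub>R v"] by (simp add: abs_mult mult.commute[of C] mult_left_mono)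
      qed (use fi in simp)
      finally have "\<bar>LBINT x. f x * g (x - eps n *\<^sub>R v)\<bar> \<le> (LBINT x. C * \<bar>f x\<bar>)" .
      then show "norm ((LBINT x. f x * g (x - eps n *\<^sub>R v)) * ?r v) \<le> (LBINT x. C * \<bar>f x\<bar>) * ?r v"
        using tens_bump(1)[of v] by (simp add: abs_mult mult_right_mono)
    qed
  qed (use tens_bump(4) in \<open>auto intro!: integrable_mult_right\<close>)
  ultimately show ?thesis using tens_bump(5)[where 'n='n] by simp
qed

lemma moll_bounded: "eps > 0 \<Longrightarrow> \<exists>D. \<forall>v::real^'n::finite. \<bar>moll eps v\<bar> \<le> D"
proof -
  assume e: "eps > 0"
  obtain B where B: "\<And>t. \<bar>bump t\<bar> \<le> B" using bump_bounded by blast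
  have "\<bar>moll eps (v::real^'n)\<bar> \<le> (\<Prod>i\<in>(UNIV::'n set). B / eps)" for v
    unfolding moll_def by (rule tens_abs_le) (use B e in \<open>auto simp: scaled_def divide_right_mono\<close>)
  then show ?thesis by blast
qed

section \<open>Functions with zero trace\<close>

text \<open>A continuous function that vanishes outside \<open>\<Omega>\<close>, with bounded weak gradient inside. The functions
\<open>g\<close> are defined everywhere and Borel, so that Fubini's theorem applies to them, and the weak
derivative is tested with tensor products only.\<close>

locale zero_trace =
  fixes \<Omega> :: "(real^2) set" and u :: "real^2 \<Rightarrow> real" and g :: "2 \<Rightarrow> real^2 \<Rightarrow> real" and M :: real
  assumes open_dom: "open \<Omega>" and bounded_dom: "bounded \<Omega>"
    and cont: "continuous_on UNIV u" and u_out: "\<And>x. x \<notin> \<Omega> \<Longrightarrow> u x = 0"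
    and g_meas [measurable]: "\<And>k. g k \<in> borel_measurable borel"
    and g_bound: "\<And>k x. \<bar>g k x\<bar> \<le> M" and g_out: "\<And>k x. x \<notin> \<Omega> \<Longrightarrow> g k x = 0"
    and weak: "\<And>p p' k a b. (\<And>i. smooth_real (p i)) \<Longrightarrow> (\<And>t. (p k has_real_derivative p' t) (at t)) \<Longrightarrow>
      (\<And>i t. t \<notin> {a $ i..b $ i} \<Longrightarrow> p i t = 0) \<Longrightarrow> cbox a b \<subseteq> \<Omega> \<Longrightarrow>
      (LBINT x. u x * tens (p(k := p')) x) = - (LBINT x. g k x * tens p x)"
begin

lemma u_meas [measurable]: "u \<in> borel_measurable borel"
  by (rule borel_measurable_continuous_onI[OF cont])

lemma u_bounded: "\<exists>C. \<forall>x. \<bar>u x\<bar> \<le> C"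
proof -
  have "compact (u ` closure \<Omega>)"
    using bounded_dom continuous_on_subset[OF cont] by (intro compact_continuous_image) auto
  then obtain C where "\<forall>y\<in>u ` closure \<Omega>. norm y \<le> C" using compact_imp_bounded bounded_iff by blast
  then have "\<bar>u x\<bar> \<le> max C 0" for x
    using u_out[of x] closure_subset[of \<Omega>] by (cases "x \<in> \<Omega>") (auto simp: le_max_iff_disj)
  then show ?thesis by blast
qed

lemma M_nonneg: "0 \<le> M"
  using order_trans[OF abs_ge_zero g_bound] .

lemma integral_product_bound:
  assumes [measurable]: "w \<in> borel_measurable borel" and "\<And>x. 0 \<le> w x" "integrable lborel w"
  shows "\<bar>LBINT x. g k x * w x\<bar> \<le> M * (LBINT x. w x)"
proof -
  have "\<bar>LBINT x. g k x * w x\<bar> \<le> (LBINT x. M * w x)"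
  proof (rule order_trans[OF integral_abs_bound integral_mono])
    show "\<bar>g k x * w x\<bar> \<le> M * w x" for x
      using assms(2)[of x] g_bound[of k x] by (simp add: abs_mult mult_right_mono)
    then have "norm (g k x * w x) \<le> norm (M * w x)" for x
      using order_trans[OF _ abs_ge_self, of "\<bar>g k x * w x\<bar>" "M * w x"] by simp
    then have "integrable lborel (\<lambda>x. g k x * w x)"
      by (intro Bochner_Integration.integrable_bound[OF integrable_mult_right[OF assms(3), of M]] AE_I2) simp_all
    then show "integrable lborel (\<lambda>x. \<bar>g k x * w x\<bar>)" by (rule integrable_abs)
  qed (use assms(3) in simp)
  then show ?thesis by simp
qed

text \<open>The difference of two mollifiers whose centres differ by \<open>t e\<^sub>k\<close> is the \<open>k\<close>-th partial derivative of
an explicit non-negative test function of integral at most \<open>t + eps\<close>: in the \<open>k\<close>-th variable it is a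
difference of two steps. Moving this derivative to \<open>u\<close> bounds the increment.\<close>

lemma mollified_increment:
  assumes e: "0 < eps" and t: "0 \<le> t"
    and sub: "\<And>s z. 0 \<le> s \<Longrightarrow> s \<le> t \<Longrightarrow> norm (z - (x + s *\<^sub>R axis k 1)) \<le> 2 * eps \<Longrightarrow> z \<in> \<Omega>"
  shows "\<bar>(LBINT z. u z * moll eps (x + t *\<^sub>R axis k 1 - z)) - (LBINT z. u z * moll eps (x - z))\<bar>
    \<le> M * (t + eps)"
proof -
  let ?y = "x + t *\<^sub>R axis k 1"
  define st where "st \<tau> = step ((x $ k + t - \<tau>) / eps) - step ((x $ k - \<tau>) / eps)" for \<tau>
  define bp where "bp i \<tau> = bump ((x $ i - \<tau>) / eps) / eps" for i :: 2 and \<tau>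
  define p where "p = bp(k := st)"
  define p' where "p' \<tau> = bump ((x $ k - \<tau>) / eps) / eps - bump ((x $ k + t - \<tau>) / eps) / eps" for \<tau>
  define a where "a = (\<chi> i. x $ i - eps)"
  define b where "b = (\<chi> i. x $ i + (if i = k then t else 0))"
  have smbp: "smooth_real (bp i)" for i
    using smooth_real_mult[OF smooth_real_const smooth_real_affine[OF smooth_bump], of "1/eps" "-1/eps" "x $ i / eps"]
    by (simp add: bp_def[abs_def] diff_divide_distrib)
  have smst: "smooth_real st"
  proof -
    have st: "smooth_algebra (\<lambda>\<tau>. step ((-1/eps) * \<tau> + c))" for c
      by (rule smooth_algebra.smooth[OF smooth_real_affine[OF smooth_step]])
    have "smooth_algebra (\<lambda>\<tau>. step ((-1/eps) * \<tau> + (x $ k + t) / eps) + (-1) * step ((-1/eps) * \<tau> + x $ k / eps))"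
      by (rule smooth_algebra.add[OF st smooth_algebra.mult[OF smooth_algebra.smooth[OF smooth_real_const] st]])
    then have "smooth_real (\<lambda>\<tau>. step ((-1/eps) * \<tau> + (x $ k + t) / eps) + (-1) * step ((-1/eps) * \<tau> + x $ k / eps))"
      by (rule smooth_algebra_imp_smooth)
    then show ?thesis by (simp add: st_def[abs_def] diff_divide_distrib add_divide_distrib)
  qed
  have smp: "smooth_real (p i)" for i by (simp add: p_def smbp smst)
  have dp: "(p k has_real_derivative p' \<tau>) (at \<tau>)" for \<tau>
    unfolding p_def p'_def st_def using e
    by (auto intro!: derivative_eq_intros DERIV_chain2[OF step_deriv] simp: field_simps)
  have sc: "\<tau> / eps \<le> 0 \<longleftrightarrow> \<tau> \<le> 0" "1 \<le> \<tau> / eps \<longleftrightarrow> eps \<le> \<tau>" "0 \<le> \<tau> / eps \<longleftrightarrow> 0 \<le> \<tau>" "\<tau> / eps \<le> 1 \<longleftrightarrow> \<tau> \<le> eps" for \<tau>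
    using e by (auto simp: divide_simps)
  have st0: "st \<tau> = 0" if "\<tau> \<notin> {x $ k - eps..x $ k + t}" for \<tau>
  proof (cases "\<tau> < x $ k - eps")
    case True then show ?thesis using t by (simp add: st_def step_1 sc)
  next
    case False
    then have "x $ k + t < \<tau>" using that by auto
    then show ?thesis using t by (simp add: st_def step_0 sc)
  qed
  have bp0: "bp i \<tau> = 0" if "\<tau> \<notin> {x $ i - eps..x $ i}" for i \<tau>
    using that by (auto simp: bp_def sc intro!: bump_outside)
  have p0: "p i \<tau> = 0" if "\<tau> \<notin> {a $ i..b $ i}" for i \<tau>
    using that st0 bp0[of \<tau> i] by (cases "i = k") (auto simp: p_def a_def b_def)
  have sub': "cbox a b \<subseteq> \<Omega>"
  proof
    fix z assume "z \<in> cbox a b"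
    then have z: "x $ i - eps \<le> z $ i" "z $ i \<le> x $ i + (if i = k then t else 0)" for i
      by (auto simp: mem_box_cart a_def b_def)
    define s where "s = max 0 (z $ k - x $ k)"
    have "\<bar>(z - (x + s *\<^sub>R axis k 1)) $ i\<bar> \<le> eps" for i
      using z[of i] e by (auto simp: s_def axis_def)
    then have "norm (z - (x + s *\<^sub>R axis k 1)) \<le> (\<Sum>i\<in>(UNIV::2 set). eps)"
      by (intro order_trans[OF norm_le_l1_cart] sum_mono)
    then show "z \<in> \<Omega>" using z[of k] t by (intro sub[of s]) (auto simp: s_def)
  qed
  have key: "(LBINT z. u z * tens (p(k := p')) z) = - (LBINT z. g k z * tens p z)"
    by (rule weak[of p k p' a b, OF smp dp p0 sub'])
  have tens_p': "tens (p(k := p')) z = moll eps (x - z) - moll eps (?y - z)" for z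
  proof -
    have 1: "moll eps (x - z) = bp k (z $ k) * (\<Prod>i\<in>UNIV - {k}. bp i (z $ i))"
      unfolding moll_def tens_def by (subst prod.remove[of _ k]) (auto simp: scaled_def bp_def)
    have 2: "moll eps (?y - z) = bump ((x $ k + t - z $ k) / eps) / eps * (\<Prod>i\<in>UNIV - {k}. bp i (z $ i))"
      unfolding moll_def tens_def
      by (subst prod.remove[of _ k]) (auto simp: scaled_def bp_def axis_def intro!: prod.cong)
    have "tens (p(k := p')) z = p' (z $ k) * (\<Prod>i\<in>UNIV - {k}. bp i (z $ i))"
      unfolding p_def by (simp add: tens_upd)
    then show ?thesis unfolding 1 2 by (simp add: p'_def bp_def left_diff_distrib)
  qed
  have ip: "integrable lborel (p i)" for i
    by (rule cont_compact_support(2)[OF smooth_real_continuous[OF smp] p0])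
  have p_nn: "0 \<le> p i \<tau>" for i \<tau>
    using t e by (auto simp: p_def bp_def st_def bump_nonneg intro!: step_mono divide_right_mono)
  have int_bp: "(LBINT \<tau>. bp i \<tau>) = 1" for i
  proof -
    have "(LBINT \<tau>. bp i \<tau>) = \<bar>-eps\<bar> ^ 1 * (LBINT s. bp i (x $ i + (-eps) *\<^sub>R s))"
      using integral_lborel_affine[of "bp i" "-eps" "x $ i"] e smooth_real_measurable[OF smbp] by simp
    also have "\<dots> = (LBINT s. bump s)" using e by (simp add: bp_def)
    finally show ?thesis by (simp add: integral_bump)
  qed
  have int_st: "(LBINT \<tau>. st \<tau>) \<le> t + eps"
  proof -
    have "(LBINT \<tau>. st \<tau>) \<le> (LBINT \<tau>. indicator {x $ k - eps..x $ k + t} \<tau>)"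
    proof (rule integral_mono)
      show "integrable lborel st" using ip[of k] by (simp add: p_def)
      fix \<tau>
      have "st \<tau> \<le> 1" unfolding st_def using step_bounds(1)[of "(x $ k - \<tau>) / eps"] step_bounds(2)[of "(x $ k + t - \<tau>) / eps"] by linarith
      then show "st \<tau> \<le> indicator {x $ k - eps..x $ k + t} \<tau>" using st0[of \<tau>] by (simp add: indicator_def)
      show "integrable lborel (indicator {x $ k - eps..x $ k + t} :: real \<Rightarrow> real)"
        using t e by (intro integrable_real_indicator) auto
    qed
    also have "\<dots> = t + eps" using t e by simp
    finally show ?thesis .
  qed
  have "(LBINT z. tens p z) \<le> t + eps"
  proof -
    have "(LBINT z. tens p z) = (\<Prod>i\<in>UNIV. LBINT \<tau>. p i \<tau>)"
      by (rule integral_tens[OF ip])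
    also have "\<dots> = (LBINT \<tau>. st \<tau>)"
      by (subst prod.remove[of _ k]) (auto simp: p_def int_bp intro!: prod.neutral)
    finally show ?thesis using int_st by simp
  qed
  moreover have "integrable lborel (tens p)"
  proof -
    have "\<forall>i. \<exists>C. \<forall>\<tau>. \<bar>p i \<tau>\<bar> \<le> C"
      using cont_compact_support(1)[OF smooth_real_continuous[OF smp] p0] by blast
    then obtain C where C: "\<And>i \<tau>. \<bar>p i \<tau>\<bar> \<le> C i" by metis
    show ?thesis
      by (rule integrable_bounded_support[OF _ tens_abs_le[OF C] bounded_cbox tens_outside[OF p0]])
        (auto intro: borel_measurable_tens smooth_real_measurable[OF smp])
  qed
  moreover have "0 \<le> tens p z" for z unfolding tens_def by (intro prod_nonneg) (simp add: p_nn)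
  ultimately have bound: "\<bar>LBINT z. g k z * tens p z\<bar> \<le> M * (t + eps)"
  proof -
    assume le: "(LBINT z. tens p z) \<le> t + eps" and i: "integrable lborel (tens p)" and nn: "\<And>z. 0 \<le> tens p z"
    have "\<bar>LBINT z. g k z * tens p z\<bar> \<le> M * (LBINT z. tens p z)"
      using borel_measurable_integrable[OF i] by (intro integral_product_bound nn i) simp
    also have "\<dots> \<le> M * (t + eps)" by (rule mult_left_mono[OF le M_nonneg])
    finally show ?thesis .
  qed
  obtain C where C: "\<And>x. \<bar>u x\<bar> \<le> C" using u_bounded by blast
  have im: "integrable lborel (\<lambda>z. u z * moll eps (y - z))" for y
  proof -
    obtain D where D: "\<And>v::real^2. \<bar>moll eps v\<bar> \<le> D" using moll_bounded[OF e] by blast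
    show ?thesis
    proof (rule integrable_bounded_support[OF _ _ bounded_dom])
      show "\<bar>u z * moll eps (y - z)\<bar> \<le> C * D" for z
        unfolding abs_mult using order_trans[OF abs_ge_zero C[of z]] by (intro mult_mono C D) auto
    qed (auto simp: u_out)
  qed
  have "(LBINT z. u z * tens (p(k := p')) z) =
     (LBINT z. u z * moll eps (x - z)) - (LBINT z. u z * moll eps (?y - z))"
    unfolding tens_p' right_diff_distrib by (rule Bochner_Integration.integral_diff[OF im im])
  with key bound show ?thesis by (simp add: abs_minus_commute)
qed

lemma axis_lipschitz_pos:
  assumes t: "0 \<le> t" and seg: "\<And>s. 0 \<le> s \<Longrightarrow> s \<le> t \<Longrightarrow> x + s *\<^sub>R axis k 1 \<in> \<Omega>"
  shows "\<bar>u (x + t *\<^sub>R axis k 1) - u x\<bar> \<le> M * t"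
proof -
  let ?S = "(\<lambda>s. x + s *\<^sub>R axis k 1) ` {0..t}"
  have "compact ?S" by (intro compact_continuous_image continuous_intros) auto
  moreover have "?S \<subseteq> \<Omega>" using seg by auto
  ultimately obtain r where r: "r > 0" "(\<Union>y\<in>?S. cball y r) \<subseteq> \<Omega>"
    using compact_subset_open_imp_cball_epsilon_subset[OF _ open_dom] by blast
  define eps where "eps n = (r / 2) * (1 / real (Suc n))" for n
  have e: "eps n > 0" "2 * eps n \<le> r" for n using r(1) by (auto simp: eps_def field_simps)
  have "(\<lambda>n. (r / 2) * (1 / real (Suc n))) \<longlonglongrightarrow> (r / 2) * 0"
    by (intro tendsto_mult tendsto_const LIMSEQ_Suc[OF lim_1_over_n])
  then have e0: "eps \<longlonglongrightarrow> 0" by (simp add: eps_def[abs_def])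
  obtain C where C: "\<And>x. \<bar>u x\<bar> \<le> C" using u_bounded by blast
  have "(\<lambda>n. \<bar>(LBINT z. u z * moll (eps n) (x + t *\<^sub>R axis k 1 - z)) - (LBINT z. u z * moll (eps n) (x - z))\<bar>)
     \<longlonglongrightarrow> \<bar>u (x + t *\<^sub>R axis k 1) - u x\<bar>"
    by (intro tendsto_intros moll_tendsto_point[OF cont C e0 e(1)])
  moreover have "(\<lambda>n. M * (t + eps n)) \<longlonglongrightarrow> M * (t + 0)" by (intro tendsto_intros e0)
  moreover have "\<bar>(LBINT z. u z * moll (eps n) (x + t *\<^sub>R axis k 1 - z)) - (LBINT z. u z * moll (eps n) (x - z))\<bar>
    \<le> M * (t + eps n)" for n
  proof (rule mollified_increment[OF e(1) t])
    fix s z assume "0 \<le> s" "s \<le> t" and z: "norm (z - (x + s *\<^sub>R axis k 1)) \<le> 2 * eps n"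
    then have "x + s *\<^sub>R axis k 1 \<in> ?S" by auto
    moreover have "z \<in> cball (x + s *\<^sub>R axis k 1) r"
      using z e(2)[of n] by (simp add: dist_norm norm_minus_commute)
    ultimately show "z \<in> \<Omega>" using r(2) by blast
  qed
  ultimately show ?thesis
    by (intro LIMSEQ_le[of _ _ "\<lambda>n. M * (t + eps n)" "M * t"]) auto
qed

lemma axis_lipschitz:
  assumes seg: "\<And>s. 0 \<le> s \<Longrightarrow> s \<le> 1 \<Longrightarrow> x + (s * t) *\<^sub>R axis k 1 \<in> \<Omega>"
  shows "\<bar>u (x + t *\<^sub>R axis k 1) - u x\<bar> \<le> M * \<bar>t\<bar>"
proof (cases "t \<ge> 0")
  case True
  have "x + s *\<^sub>R axis k 1 \<in> \<Omega>" if "0 \<le> s" "s \<le> t" for s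
    using seg[of "s / t"] seg[of 0] that by (cases "t = 0") auto
  with axis_lipschitz_pos[OF True, of x k] True show ?thesis by simp
next
  case False
  let ?y = "x + t *\<^sub>R axis k 1"
  have "?y + s *\<^sub>R axis k 1 \<in> \<Omega>" if "0 \<le> s" "s \<le> - t" for s
  proof -
    have "(t + s) / t * t = t + s" "0 \<le> (t + s) / t" "(t + s) / t \<le> 1"
      using that False by (auto simp: divide_simps)
    with seg[of "(t + s) / t"] show ?thesis by (simp add: scaleR_add_left add.assoc)
  qed
  with axis_lipschitz_pos[of "-t" ?y k] False show ?thesis by (simp add: abs_minus_commute)
qed

text \<open>Let \<open>q\<close> be a nearest point outside \<open>\<Omega>\<close>. A path from \<open>x\<close> towards \<open>q\<close> that first runs horizontally and
then vertically stays in the ball around \<open>x\<close> through \<open>q\<close>, hence in \<open>\<Omega>\<close>, as long as it stops short of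
\<open>q\<close>. Along it \<open>u\<close> is Lipschitz, and \<open>u q = 0\<close>.\<close>

lemma decay:
  assumes x: "x \<in> \<Omega>" and p: "p \<notin> \<Omega>"
  shows "\<bar>u x\<bar> \<le> 2 * M * norm (x - p)"
proof -
  have "closed (- \<Omega>)" "- \<Omega> \<noteq> {}" using open_dom p by auto
  then obtain q where q: "q \<notin> \<Omega>" "\<And>z. z \<notin> \<Omega> \<Longrightarrow> dist x q \<le> dist x z"
    using distance_attains_inf[of "-\<Omega>" x] by auto
  define d where "d = q - x"
  have d0: "norm d > 0" using q x by (auto simp: d_def)
  have near: "z \<in> \<Omega>" if "norm (z - x) < norm d" for z
  proof (rule ccontr)
    assume "z \<notin> \<Omega>"
    from q(2)[OF this] that show False by (simp add: d_def dist_norm norm_minus_commute)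
  qed
  have "\<bar>u (x + \<theta> *\<^sub>R d) - u x\<bar> \<le> 2 * M * norm d" if \<theta>: "0 \<le> \<theta>" "\<theta> < 1" for \<theta>
  proof -
    let ?m = "x + (\<theta> * d $ 1) *\<^sub>R axis 1 1"
    have eq: "?m + (\<theta> * d $ 2) *\<^sub>R axis 2 1 = x + \<theta> *\<^sub>R d"
      by (simp add: vec_eq_iff forall_2 axis_def)
    have small: "norm z < norm d" if "\<And>i. \<bar>z $ i\<bar> \<le> \<theta> * \<bar>d $ i\<bar>" for z
    proof -
      have "norm z \<le> norm (\<theta> *\<^sub>R d)"
        by (rule norm_le_componentwise_cart) (use that \<theta> in \<open>simp add: abs_mult\<close>)
      also have "\<dots> < norm d" using \<theta> d0 by (simp add: mult_less_cancel_right2)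
      finally show ?thesis .
    qed
    have 1: "\<bar>u ?m - u x\<bar> \<le> M * \<bar>\<theta> * d $ 1\<bar>"
    proof (rule axis_lipschitz, rule near, rule small)
      fix s :: real and i :: 2 assume s: "0 \<le> s" "s \<le> 1"
      then show "\<bar>(x + (s * (\<theta> * d $ 1)) *\<^sub>R axis 1 1 - x) $ i\<bar> \<le> \<theta> * \<bar>d $ i\<bar>"
        using \<theta> by (auto simp: axis_def abs_mult intro!: mult_left_le_one_le)
    qed
    have 2: "\<bar>u (?m + (\<theta> * d $ 2) *\<^sub>R axis 2 1) - u ?m\<bar> \<le> M * \<bar>\<theta> * d $ 2\<bar>"
    proof (rule axis_lipschitz, rule near, rule small)
      fix s :: real and i :: 2 assume s: "0 \<le> s" "s \<le> 1"
      consider "i = 1" | "i = 2" using exhaust_2 by blast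
      then show "\<bar>(?m + (s * (\<theta> * d $ 2)) *\<^sub>R axis 2 1 - x) $ i\<bar> \<le> \<theta> * \<bar>d $ i\<bar>"
        using \<theta> s by cases (auto simp: axis_def abs_mult intro!: mult_left_le_one_le)
    qed
    have "\<bar>\<theta> * d $ i\<bar> \<le> norm d" for i
      using \<theta> component_le_norm_cart[of d i] mult_mono[of \<theta> 1 "\<bar>d $ i\<bar>" "norm d"] by (simp add: abs_mult)
    then have "M * \<bar>\<theta> * d $ i\<bar> \<le> M * norm d" for i using M_nonneg by (intro mult_left_mono)
    from this[of 1] this[of 2] 1 2 show ?thesis unfolding eq by linarith
  qed
  note lt = this
  have "\<bar>u (x + (1 - 1 / real (Suc n)) *\<^sub>R d) - u x\<bar> \<le> 2 * M * norm d" for n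
    by (rule lt) simp_all
  moreover have "(\<lambda>n. \<bar>u (x + (1 - 1 / real (Suc n)) *\<^sub>R d) - u x\<bar>) \<longlonglongrightarrow> \<bar>u (x + (1 - 0) *\<^sub>R d) - u x\<bar>"
    by (intro tendsto_intros continuous_on_tendsto_compose[OF cont] LIMSEQ_Suc[OF lim_1_over_n]) auto
  ultimately have "\<bar>u (x + (1 - 0) *\<^sub>R d) - u x\<bar> \<le> 2 * M * norm d"
    by (intro LIMSEQ_le_const2) auto
  then have "\<bar>u x\<bar> \<le> 2 * M * norm d" using u_out[OF q(1)] by (simp add: d_def)
  also have "\<dots> \<le> 2 * M * norm (x - p)"
    using q(2)[OF p] M_nonneg by (intro mult_left_mono) (auto simp: d_def dist_norm norm_minus_commute)
  finally show ?thesis .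
qed

end

section \<open>Cutoffs near the boundary\<close>

definition dbump :: "real \<Rightarrow> real" where "dbump = deriv bump"

lemma bump_deriv: "(bump has_real_derivative dbump t) (at t)" and smooth_dbump: "smooth_real dbump"
proof -
  from smooth_bump obtain b where b: "\<And>t. (bump has_real_derivative b t) (at t)" "smooth_real b"
    by (cases rule: smooth_real.cases) auto
  have "dbump = b" unfolding dbump_def by (rule ext, rule DERIV_imp_deriv, rule b)
  with b show "(bump has_real_derivative dbump t) (at t)" "smooth_real dbump" by simp_all
qed

lemma measurable_dbump [measurable]: "dbump \<in> borel_measurable borel"
  by (rule smooth_real_measurable[OF smooth_dbump])

lemma dbump_outside: "t \<notin> {0..1} \<Longrightarrow> dbump t = 0"
  by (rule deriv_outside[of bump dbump 0 1, OF bump_deriv bump_outside])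

lemma dbump_bounded: "\<exists>C. \<forall>t. \<bar>dbump t\<bar> \<le> C" and integrable_dbump: "integrable lborel dbump"
  by (rule cont_compact_support[OF smooth_real_continuous[OF smooth_dbump], of 0 1], erule dbump_outside)+

lemma integral_dbump: "(LBINT t. dbump t) = 0"
  by (rule integral_deriv_compact_support(1)[OF bump_deriv smooth_real_continuous[OF smooth_dbump], of 0 1])
    (erule bump_outside)

definition dtens_bump :: "'n::finite \<Rightarrow> real^'n \<Rightarrow> real" where
  "dtens_bump k = tens ((\<lambda>_. bump)(k := dbump))"

lemma dtens_bump:
  fixes x :: "real^'n::finite"
  shows "\<exists>C. \<forall>x::real^'n. \<bar>dtens_bump k x\<bar> \<le> C"
    "x \<notin> cbox 0 1 \<Longrightarrow> dtens_bump k x = 0"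
    "dtens_bump k \<in> borel_measurable borel"
    "integrable lborel (dtens_bump k)"
    "(LBINT x. dtens_bump k x) = 0"
proof -
  obtain B D where "\<And>t. \<bar>bump t\<bar> \<le> B" "\<And>t. \<bar>dbump t\<bar> \<le> D" using bump_bounded dbump_bounded by blast
  then have C: "\<bar>dtens_bump k (x::real^'n)\<bar> \<le> (\<Prod>i\<in>UNIV. if i = k then D else B)" for x
    unfolding dtens_bump_def by (intro tens_abs_le) simp
  then show "\<exists>C. \<forall>x::real^'n. \<bar>dtens_bump k x\<bar> \<le> C" by blast
  show out: "x \<notin> cbox 0 1 \<Longrightarrow> dtens_bump k x = 0" for x :: "real^'n"
    unfolding dtens_bump_def by (rule tens_outside) (auto simp: bump_outside dbump_outside)
  show m: "dtens_bump k \<in> borel_measurable borel"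
    unfolding dtens_bump_def[abs_def] by (intro borel_measurable_tens) auto
  show "integrable lborel (dtens_bump k)"
    by (rule integrable_bounded_support[OF m C bounded_cbox out])
  have "(LBINT x. dtens_bump k x) = (\<Prod>i\<in>UNIV. LBINT t. ((\<lambda>_. bump)(k := dbump)) i t)"
    unfolding dtens_bump_def by (rule integral_tens) (auto simp: integrable_bump integrable_dbump)
  also have "\<dots> = 0" by (subst prod.remove[of _ k]) (auto simp: integral_dbump)
  finally show "(LBINT x. dtens_bump k x) = 0" .
qed

text \<open>The \<open>k\<close>-th partial derivative of \<open>moll eps\<close>.\<close>

definition dmoll :: "real \<Rightarrow> 'n::finite \<Rightarrow> real^'n \<Rightarrow> real" where
  "dmoll eps k z = tens (scaled eps ((\<lambda>_. bump)(k := dbump))) z / eps"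

lemma measurable_dmoll [measurable]: "dmoll eps k \<in> borel_measurable borel"
  unfolding dmoll_def[abs_def] by (intro borel_measurable_divide borel_measurable_tens measurable_scaled) auto

lemma dmoll_bounded: "eps > 0 \<Longrightarrow> \<exists>D. \<forall>v::real^'n::finite. \<bar>dmoll eps k v\<bar> \<le> D"
proof -
  assume e: "eps > 0"
  obtain B D where B: "\<And>t. \<bar>bump t\<bar> \<le> B" "\<And>t. \<bar>dbump t\<bar> \<le> D" using bump_bounded dbump_bounded by blast
  have "\<bar>tens (scaled eps ((\<lambda>_. bump)(k := dbump))) v\<bar> \<le> (\<Prod>i\<in>(UNIV::'n set). (if i = k then D else B) / eps)" for v
    by (rule tens_abs_le) (use B e in \<open>auto simp: scaled_def divide_right_mono\<close>)
  then have "\<bar>dmoll eps k v\<bar> \<le> (\<Prod>i\<in>(UNIV::'n set). (if i = k then D else B) / eps) / eps" for v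
    using e by (simp add: dmoll_def divide_right_mono)
  then show ?thesis by blast
qed

lemma integral_moll:
  fixes h :: "real^'n::finite \<Rightarrow> real"
  assumes "h \<in> borel_measurable borel" and e: "eps > 0"
  shows "(LBINT z. h z * moll eps (x - z)) = (LBINT v. h (x - eps *\<^sub>R v) * tens (\<lambda>_. bump) v)"
    "(LBINT z. h z * dmoll eps k (x - z)) = (LBINT v. h (x - eps *\<^sub>R v) * dtens_bump k v) / eps"
proof -
  show "(LBINT z. h z * moll eps (x - z)) = (LBINT v. h (x - eps *\<^sub>R v) * tens (\<lambda>_. bump) v)"
    unfolding moll_def by (rule integral_scaled[OF assms(1) _ e]) simp
  have "(LBINT z. h z * tens (scaled eps ((\<lambda>_. bump)(k := dbump))) (x - z))
     = (LBINT v. h (x - eps *\<^sub>R v) * dtens_bump k v)"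
    unfolding dtens_bump_def by (rule integral_scaled[OF assms(1) _ e]) simp
  then show "(LBINT z. h z * dmoll eps k (x - z)) = (LBINT v. h (x - eps *\<^sub>R v) * dtens_bump k v) / eps"
    by (simp add: dmoll_def)
qed

text \<open>The points at distance at least \<open>r\<close> from the complement of \<open>\<Omega>\<close>. The pointwise condition, unlike
an infimum of distances, is also right for an empty complement.\<close>

definition deep :: "real \<Rightarrow> 'a::metric_space set \<Rightarrow> 'a set" where
  "deep r \<Omega> = {w. \<forall>q. q \<notin> \<Omega> \<longrightarrow> r \<le> dist w q}"

lemma closed_deep: "closed (deep r \<Omega>)"
proof -
  have "deep r \<Omega> = (\<Inter>q\<in>-\<Omega>. {w. r \<le> dist w q})" by (auto simp: deep_def)
  moreover have "closed {w. r \<le> dist w q}" for q :: 'a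
    by (intro closed_Collect_le continuous_intros)
  ultimately show ?thesis by auto
qed

lemma deep_subset: "0 < r \<Longrightarrow> deep r \<Omega> \<subseteq> \<Omega>"
  by (fastforce simp: deep_def)

text \<open>The crude constant 2 (instead of the square root of 2) explains the radii \<open>3 eps\<close> and \<open>5 eps\<close> below:
a mollifier centred in \<open>deep (3 * eps) \<Omega>\<close> is supported in \<open>\<Omega>\<close>, and near a point of
\<open>deep (5 * eps) \<Omega>\<close> only such mollifiers are seen.\<close>

lemma norm_le_of_box:
  fixes v :: "real^2" assumes "\<And>i. \<bar>v $ i\<bar> \<le> eps" shows "norm v \<le> 2 * eps"
proof -
  have "norm v \<le> (\<Sum>i\<in>(UNIV::2 set). eps)"
    using assms by (intro order_trans[OF norm_le_l1_cart] sum_mono) auto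
  then show ?thesis by simp
qed

lemma deep_shift:
  fixes z v :: "real^2"
  assumes "z \<in> deep (5 * eps) \<Omega>" "v \<in> cbox 0 1" "0 < eps"
  shows "z - eps *\<^sub>R v \<in> deep (3 * eps) \<Omega>"
  unfolding deep_def
proof (intro CollectI allI impI)
  fix q assume "q \<notin> \<Omega>"
  then have "5 * eps \<le> dist z q" using assms by (auto simp: deep_def)
  moreover have "norm (eps *\<^sub>R v) \<le> 2 * eps"
  proof (rule norm_le_of_box)
    fix i show "\<bar>(eps *\<^sub>R v) $ i\<bar> \<le> eps" using assms(2)[unfolded mem_box_cart] assms(3)
      by (simp add: abs_mult mult_left_le)
  qed
  then have "dist z (z - eps *\<^sub>R v) \<le> 2 * eps" by (simp add: dist_norm)
  ultimately show "3 * eps \<le> dist (z - eps *\<^sub>R v) q"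
    using dist_triangle[of z q "z - eps *\<^sub>R v"] by linarith
qed

text \<open>Averaging mollifiers over their centres, instead of convolving inside the test function, keeps every
test function a tensor product: the average is exchanged with the integral afterwards.\<close>

definition cutoff :: "(real^2) set \<Rightarrow> real \<Rightarrow> real^2 \<Rightarrow> real" where
  "cutoff \<Omega> eps z = (LBINT w. indicator (deep (3 * eps) \<Omega>) w * moll eps (z - w))"

definition dcutoff :: "(real^2) set \<Rightarrow> real \<Rightarrow> 2 \<Rightarrow> real^2 \<Rightarrow> real" where
  "dcutoff \<Omega> eps k z = (LBINT w. indicator (deep (3 * eps) \<Omega>) w * dmoll eps k (z - w))"

lemma borel_deep [measurable]: "deep r \<Omega> \<in> sets borel"
  by (rule borel_closed[OF closed_deep])

lemma cutoff_bounds: "eps > 0 \<Longrightarrow> \<bar>cutoff \<Omega> eps z\<bar> \<le> 1"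
  "eps > 0 \<Longrightarrow> \<bar>dcutoff \<Omega> eps k z\<bar> \<le> (LBINT v. \<bar>dtens_bump k v\<bar>) / eps"
proof -
  have *: "\<bar>LBINT v. indicator W (z - eps *\<^sub>R v) * h v\<bar> \<le> (LBINT v. \<bar>h v\<bar>)"
    if h: "integrable lborel h" and W: "W \<in> sets borel" for h :: "real^2 \<Rightarrow> real" and W :: "(real^2) set"
  proof -
    note [measurable] = W
    have [measurable]: "h \<in> borel_measurable borel" using borel_measurable_integrable[OF h] by simp
    have "integrable lborel (\<lambda>v. indicator W (z - eps *\<^sub>R v) * h v)"
      by (rule Bochner_Integration.integrable_bound[OF h]) (auto simp: indicator_def)
    then show ?thesis
      using h by (intro order_trans[OF integral_abs_bound integral_mono]) (auto simp: indicator_def)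
  qed
  assume e: "eps > 0"
  show "\<bar>cutoff \<Omega> eps z\<bar> \<le> 1"
    unfolding cutoff_def using *[of "tens (\<lambda>_. bump)" "deep (3 * eps) \<Omega>"] tens_bump[where 'n=2]
    by (subst integral_moll(1)[OF _ e]) (simp_all add: abs_of_nonneg)
  show "\<bar>dcutoff \<Omega> eps k z\<bar> \<le> (LBINT v. \<bar>dtens_bump k v\<bar>) / eps"
    unfolding dcutoff_def using *[OF dtens_bump(4)[of k], of "deep (3 * eps) \<Omega>"] e
    by (subst integral_moll(2)[OF _ e]) (simp_all add: divide_right_mono)
qed

lemma cutoff_interior:
  assumes e: "eps > 0" and z: "z \<in> deep (5 * eps) \<Omega>"
  shows "cutoff \<Omega> eps z = 1" "dcutoff \<Omega> eps k z = 0"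
proof -
  have *: "indicator (deep (3 * eps) \<Omega>) (z - eps *\<^sub>R v) * h v = h v" if "\<And>v. v \<notin> cbox 0 1 \<Longrightarrow> h v = 0"
    for h :: "real^2 \<Rightarrow> real" and v
    using that[of v] deep_shift[OF z _ e, of v] by (cases "v \<in> cbox 0 1") auto
  show "cutoff \<Omega> eps z = 1"
    unfolding cutoff_def by (subst integral_moll(1)[OF _ e]) (simp_all add: *[of "tens (\<lambda>_. bump)", OF tens_bump(3)] tens_bump(5))
  show "dcutoff \<Omega> eps k z = 0"
    unfolding dcutoff_def by (subst integral_moll(2)[OF _ e]) (simp_all add: *[of "dtens_bump k", OF dtens_bump(2)] dtens_bump(5))
qed

lemma measurable_cutoff [measurable]: "cutoff \<Omega> eps \<in> borel_measurable borel" "dcutoff \<Omega> eps k \<in> borel_measurable borel"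
  unfolding cutoff_def[abs_def] dcutoff_def[abs_def] by measurable

lemma continuous_tens:
  assumes "\<And>i. smooth_real (p i)" shows "continuous_on S (tens p)"
  unfolding tens_def[abs_def]
  by (intro continuous_on_prod continuous_on_compose2[OF smooth_real_continuous[OF assms]] continuous_intros) auto

lemma tens_bounded_on:
  fixes \<Omega> :: "(real^'n::finite) set"
  assumes "\<And>i. smooth_real (p i)" "bounded \<Omega>" shows "\<exists>D\<ge>0. \<forall>x\<in>\<Omega>. \<bar>tens p x\<bar> \<le> D"
proof -
  have "compact (tens p ` closure \<Omega>)"
    using assms by (intro compact_continuous_image continuous_tens) auto
  then obtain C where "\<forall>y\<in>tens p ` closure \<Omega>. norm y \<le> C" using compact_imp_bounded bounded_iff by blast
  then have "\<forall>x\<in>\<Omega>. \<bar>tens p x\<bar> \<le> max C 0"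
    using closure_subset[of \<Omega>] by (auto simp: le_max_iff_disj)
  then show ?thesis by (intro exI[of _ "max C 0"]) auto
qed

lemma smooth_scaled:
  "smooth_real f \<Longrightarrow> smooth_real (\<lambda>\<tau>. f ((\<tau> - c) / eps) / eps)"
  "smooth_real f \<Longrightarrow> smooth_real (\<lambda>\<tau>. f ((c - \<tau>) / eps) / eps)"
  using smooth_real_mult[OF smooth_real_const smooth_real_affine, of f "1/eps" "1/eps" "-c/eps"]
    smooth_real_mult[OF smooth_real_const smooth_real_affine, of f "1/eps" "-1/eps" "c/eps"]
  by (simp_all add: diff_divide_distrib)

section \<open>Extension by zero across the boundary\<close>

context zero_trace
begin

lemma weak_cutoff_point:
  assumes p: "\<And>i. smooth_real (p i)" and d: "\<And>t. (p k has_real_derivative p' t) (at t)"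
    and e: "eps > 0" and w: "w \<in> deep (3 * eps) \<Omega>"
  shows "(LBINT z. u z * (tens (p(k := p')) z * moll eps (z - w) + tens p z * dmoll eps k (z - w)))
    = - (LBINT z. g k z * (tens p z * moll eps (z - w)))"
proof -
  define q where "q i \<tau> = p i \<tau> * (bump ((\<tau> - w $ i) / eps) / eps)" for i \<tau>
  define q' where "q' \<tau> = p' \<tau> * (bump ((\<tau> - w $ k) / eps) / eps) + p k \<tau> * (dbump ((\<tau> - w $ k) / eps) / eps / eps)" for \<tau>
  define a b where "a = w" and "b = (\<chi> i. w $ i + eps)"
  have sq: "smooth_real (q i)" for i
    unfolding q_def[abs_def] by (intro smooth_real_mult p smooth_scaled smooth_bump)
  have dq: "(q k has_real_derivative q' \<tau>) (at \<tau>)" for \<tau>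
    unfolding q_def q'_def using e
    by (auto intro!: derivative_eq_intros d DERIV_chain2[OF bump_deriv] simp: field_simps)
  have q0: "q i \<tau> = 0" if "\<tau> \<notin> {a $ i..b $ i}" for i \<tau>
  proof -
    have "(\<tau> - w $ i) / eps \<notin> {0..1}" using that e by (auto simp: a_def b_def divide_simps split: if_splits)
    then show ?thesis by (simp add: q_def bump_outside)
  qed
  have sub: "cbox a b \<subseteq> \<Omega>"
  proof
    fix z assume "z \<in> cbox a b"
    then have "\<bar>(w - z) $ i\<bar> \<le> eps" for i by (auto simp: a_def b_def mem_box_cart abs_le_iff algebra_simps)
    then have "dist w z \<le> 2 * eps" unfolding dist_norm by (rule norm_le_of_box)
    with w e show "z \<in> \<Omega>" by (force simp: deep_def)
  qed
  have 1: "tens q z = tens p z * moll eps (z - w)" for z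
    by (simp only: tens_def moll_def scaled_def q_def vector_minus_component prod.distrib)
  have 2: "tens (q(k := q')) z = tens (p(k := p')) z * moll eps (z - w) + tens p z * dmoll eps k (z - w)" for z
  proof -
    let ?P = "\<Prod>i\<in>UNIV - {k}. p i (z $ i)" and ?B = "\<Prod>i\<in>UNIV - {k}. bump ((z $ i - w $ i) / eps) / eps"
    have "tens p z = p k (z $ k) * ?P" unfolding tens_def by (subst prod.remove[of _ k]) auto
    moreover have "moll eps (z - w) = bump ((z $ k - w $ k) / eps) / eps * ?B"
      unfolding moll_def tens_def scaled_def by (subst prod.remove[of _ k]) auto
    moreover have "dmoll eps k (z - w) = dbump ((z $ k - w $ k) / eps) / eps * ?B / eps"
      unfolding dmoll_def tens_def scaled_def by (subst prod.remove[of _ k]) auto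
    moreover have "tens (q(k := q')) z = q' (z $ k) * (?P * ?B)"
      by (simp only: tens_upd q_def prod.distrib)
    ultimately show ?thesis by (simp add: tens_upd q'_def algebra_simps)
  qed
  from weak[of q k q' a b, OF sq dq q0 sub] show ?thesis unfolding 1 2 .
qed

text \<open>\<open>weak_cutoff_point\<close> integrated over all centres \<open>w\<close> at distance at least \<open>3 eps\<close> from the
complement.\<close>

lemma weak_cutoff:
  assumes p: "\<And>i. smooth_real (p i)" and d: "\<And>t. (p k has_real_derivative p' t) (at t)" and p': "smooth_real p'"
    and e: "eps > 0"
  shows "(LBINT z. u z * (tens (p(k := p')) z * cutoff \<Omega> eps z + tens p z * dcutoff \<Omega> eps k z))
    = - (LBINT z. g k z * (tens p z * cutoff \<Omega> eps z))"
proof -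
  let ?W = "deep (3 * eps) \<Omega>"
  have p'i: "smooth_real ((p(k := p')) i)" for i using p p' by simp
  obtain C where C: "\<And>x. \<bar>u x\<bar> \<le> C" using u_bounded by blast
  obtain D where D: "0 \<le> D" "\<And>x. x \<in> \<Omega> \<Longrightarrow> \<bar>tens p x\<bar> \<le> D" using tens_bounded_on[of p, OF p bounded_dom] by blast
  obtain D' where D': "0 \<le> D'" "\<And>x. x \<in> \<Omega> \<Longrightarrow> \<bar>tens (p(k := p')) x\<bar> \<le> D'" using tens_bounded_on[of "p(k := p')", OF p'i bounded_dom] by blast
  obtain E where E: "\<And>v::real^2. \<bar>moll eps v\<bar> \<le> E" using moll_bounded[OF e] by blast
  obtain E' where E': "\<And>v::real^2. \<bar>dmoll eps k v\<bar> \<le> E'" using dmoll_bounded[OF e] by blast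
  have nn: "0 \<le> C" "0 \<le> E" "0 \<le> E'"
    using order_trans[OF abs_ge_zero C] order_trans[OF abs_ge_zero E] order_trans[OF abs_ge_zero E'] by auto
  note pm [measurable] = smooth_real_measurable[OF p] smooth_real_measurable[OF p'i]
  have WO: "?W \<subseteq> \<Omega>" using e by (intro deep_subset) simp
  have swap: "(LBINT z. f z * (LBINT w. indicator ?W w * m (z - w)))
     = (LBINT w. indicator ?W w * (LBINT z. f z * m (z - w)))" and
    int: "integrable lborel (\<lambda>z. f z * m (z - w))"
    if [measurable]: "f \<in> borel_measurable borel" "m \<in> borel_measurable borel"
      and f0: "\<And>z. z \<notin> \<Omega> \<Longrightarrow> f z = 0" and fb: "\<And>z. \<bar>f z\<bar> \<le> B" and mb: "\<And>z. \<bar>m z\<bar> \<le> B'"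
    for f m :: "real^2 \<Rightarrow> real" and B B' w
  proof -
    have B: "0 \<le> B" "0 \<le> B'" using order_trans[OF abs_ge_zero fb] order_trans[OF abs_ge_zero mb] by auto
    show "integrable lborel (\<lambda>z. f z * m (z - w))"
      by (rule integrable_bounded_support[of _ "B * B'" \<Omega>])
        (use B fb mb f0 bounded_dom in \<open>auto simp: abs_mult intro!: mult_mono\<close>)
    have "(LBINT z. f z * (LBINT w. indicator ?W w * m (z - w)))
      = (LBINT z. (LBINT w. f z * (indicator ?W w * m (z - w))))" by simp
    also have "\<dots> = (LBINT w. (LBINT z. f z * (indicator ?W w * m (z - w))))"
    proof (rule lborel_pair.Fubini_integral)
      show "integrable (lborel \<Otimes>\<^sub>M lborel) (\<lambda>(w, z). f z * (indicator ?W w * m (z - w)))"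
      proof (rule integrable_pair_bounded_support[where S=\<Omega> and T=\<Omega> and C="B * B'"])
        show "\<bar>case y of (w, z) \<Rightarrow> f z * (indicator ?W w * m (z - w))\<bar> \<le> B * B'" for y
          using fb mb B by (auto simp: abs_mult indicator_def split: prod.split intro!: mult_mono)
        show "(case (w, z) of (w, z) \<Rightarrow> f z * (indicator ?W w * m (z - w))) = 0" if "w \<notin> \<Omega> \<or> z \<notin> \<Omega>" for w z
          using that f0[of z] WO by (auto simp: indicator_def)
      qed (use bounded_dom in \<open>simp_all add: split_beta\<close>)
    qed
    also have "\<dots> = (LBINT w. indicator ?W w * (LBINT z. f z * m (z - w)))"
      by (intro Bochner_Integration.integral_cong) (auto simp: indicator_def)
    finally show "(LBINT z. f z * (LBINT w. indicator ?W w * m (z - w)))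
     = (LBINT w. indicator ?W w * (LBINT z. f z * m (z - w)))" .
  qed
  have b1: "\<bar>u z * tens (p(k := p')) z\<bar> \<le> C * D'" for z
    using C[of z] D'(2)[of z] nn D' u_out[of z] by (cases "z \<in> \<Omega>") (auto simp: abs_mult intro!: mult_mono)
  have b2: "\<bar>u z * tens p z\<bar> \<le> C * D" for z
    using C[of z] D(2)[of z] nn D u_out[of z] by (cases "z \<in> \<Omega>") (auto simp: abs_mult intro!: mult_mono)
  have b3: "\<bar>g k z * tens p z\<bar> \<le> M * D" for z
    using g_bound[of k z] D(2)[of z] M_nonneg D g_out[of z k] by (cases "z \<in> \<Omega>") (auto simp: abs_mult intro!: mult_mono)
  have m1: "(\<lambda>z. u z * tens (p(k := p')) z) \<in> borel_measurable borel" "(\<lambda>z. u z * tens p z) \<in> borel_measurable borel"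
    "(\<lambda>z. g k z * tens p z) \<in> borel_measurable borel"
    by (intro borel_measurable_times borel_measurable_tens pm u_meas g_meas measurable_ident_sets refl)+
  have I1: "integrable lborel (\<lambda>z. u z * tens (p(k := p')) z * moll eps (z - w))"
    "(LBINT z. u z * tens (p(k := p')) z * (LBINT w. indicator ?W w * moll eps (z - w)))
     = (LBINT w. indicator ?W w * (LBINT z. u z * tens (p(k := p')) z * moll eps (z - w)))" for w
    by (rule int[OF m1(1) measurable_moll _ b1 E] swap[OF m1(1) measurable_moll _ b1 E], simp add: u_out g_out)+
  have I2: "integrable lborel (\<lambda>z. u z * tens p z * dmoll eps k (z - w))"
    "(LBINT z. u z * tens p z * (LBINT w. indicator ?W w * dmoll eps k (z - w)))
     = (LBINT w. indicator ?W w * (LBINT z. u z * tens p z * dmoll eps k (z - w)))" for w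
    by (rule int[OF m1(2) measurable_dmoll _ b2 E'] swap[OF m1(2) measurable_dmoll _ b2 E'], simp add: u_out g_out)+
  have I3: "integrable lborel (\<lambda>z. g k z * tens p z * moll eps (z - w))"
    "(LBINT z. g k z * tens p z * (LBINT w. indicator ?W w * moll eps (z - w)))
     = (LBINT w. indicator ?W w * (LBINT z. g k z * tens p z * moll eps (z - w)))" for w
    by (rule int[OF m1(3) measurable_moll _ b3 E] swap[OF m1(3) measurable_moll _ b3 E], simp add: u_out g_out)+
  have cb: "integrable lborel (\<lambda>z. f z * h z)"
    if "f \<in> borel_measurable borel" "h \<in> borel_measurable borel" "\<And>z. z \<notin> \<Omega> \<Longrightarrow> f z = 0" "\<And>z. \<bar>f z\<bar> \<le> B" "\<And>z. \<bar>h z\<bar> \<le> B'"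
    for f h and B B' :: real
  proof -
    have B: "0 \<le> B" using order_trans[OF abs_ge_zero that(4)] .
    show ?thesis
      by (rule integrable_bounded_support[of _ "B * B'" \<Omega>])
        (use that B bounded_dom in \<open>auto simp: abs_mult intro!: mult_mono\<close>)
  qed
  have i1: "integrable lborel (\<lambda>z. u z * tens (p(k := p')) z * cutoff \<Omega> eps z)"
    by (rule cb[OF m1(1) measurable_cutoff(1) _ b1 cutoff_bounds(1)[OF e]]) (simp add: u_out)
  have i2: "integrable lborel (\<lambda>z. u z * tens p z * dcutoff \<Omega> eps k z)"
    by (rule cb[OF m1(2) measurable_cutoff(2) _ b2 cutoff_bounds(2)[OF e]]) (simp add: u_out)
  have "(LBINT z. u z * (tens (p(k := p')) z * cutoff \<Omega> eps z + tens p z * dcutoff \<Omega> eps k z))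
    = (LBINT z. u z * tens (p(k := p')) z * cutoff \<Omega> eps z) + (LBINT z. u z * tens p z * dcutoff \<Omega> eps k z)"
    by (subst Bochner_Integration.integral_add[symmetric, OF i1 i2]) (simp only: distrib_left mult.assoc)
  also have "\<dots> = (LBINT w. indicator ?W w * (LBINT z. u z * tens (p(k := p')) z * moll eps (z - w)))
     + (LBINT w. indicator ?W w * (LBINT z. u z * tens p z * dmoll eps k (z - w)))"
    unfolding cutoff_def dcutoff_def I1(2) I2(2) ..
  also have "\<dots> = (LBINT w. indicator ?W w * (LBINT z. u z * tens (p(k := p')) z * moll eps (z - w))
     + indicator ?W w * (LBINT z. u z * tens p z * dmoll eps k (z - w)))"
  proof (rule Bochner_Integration.integral_add[symmetric])
    have *: "integrable lborel (\<lambda>w. indicator ?W w * (LBINT z. f z * m (z - w)))"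
      if [measurable]: "f \<in> borel_measurable borel" "m \<in> borel_measurable borel" and f0: "\<And>z. z \<notin> \<Omega> \<Longrightarrow> f z = 0"
       and fb: "\<And>z. \<bar>f z\<bar> \<le> B" and mb: "\<And>z. \<bar>m z\<bar> \<le> B'" for f m :: "real^2 \<Rightarrow> real" and B B'
    proof (rule integrable_bounded_support[where S=\<Omega> and C="(LBINT z. \<bar>f z\<bar> * B')"])
      have fi: "integrable lborel f" by (rule integrable_bounded_support[OF that(1) fb bounded_dom f0])
      show "\<bar>indicator ?W w * (LBINT z. f z * m (z - w))\<bar> \<le> (LBINT z. \<bar>f z\<bar> * B')" for w
      proof -
        have "\<bar>indicator ?W w * (LBINT z. f z * m (z - w))\<bar> \<le> \<bar>LBINT z. f z * m (z - w)\<bar>"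
          by (simp add: indicator_def)
        also have "\<dots> \<le> (LBINT z. \<bar>f z\<bar> * B')"
        proof (rule order_trans[OF integral_abs_bound integral_mono])
          show "integrable lborel (\<lambda>z. \<bar>f z * m (z - w)\<bar>)" by (rule integrable_abs[OF int[OF that(1,2) f0 fb mb]])
          show "integrable lborel (\<lambda>z. \<bar>f z\<bar> * B')" using fi by (intro integrable_mult_left integrable_abs)
          show "\<bar>f z * m (z - w)\<bar> \<le> \<bar>f z\<bar> * B'" for z using mb by (simp add: abs_mult mult_left_mono)
        qed
        finally show ?thesis .
      qed
    qed (use bounded_dom WO in \<open>auto simp: indicator_def\<close>)
    show "integrable lborel (\<lambda>w. indicator ?W w * (LBINT z. u z * tens (p(k := p')) z * moll eps (z - w)))"
      by (rule *[OF m1(1) measurable_moll _ b1 E]) (simp add: u_out)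
    show "integrable lborel (\<lambda>w. indicator ?W w * (LBINT z. u z * tens p z * dmoll eps k (z - w)))"
      by (rule *[OF m1(2) measurable_dmoll _ b2 E']) (simp add: u_out)
  qed
  also have "\<dots> = (LBINT w. indicator ?W w * - (LBINT z. g k z * tens p z * moll eps (z - w)))"
  proof (rule Bochner_Integration.integral_cong[OF refl])
    fix w
    show "indicator ?W w * (LBINT z. u z * tens (p(k := p')) z * moll eps (z - w))
     + indicator ?W w * (LBINT z. u z * tens p z * dmoll eps k (z - w))
     = indicator ?W w * - (LBINT z. g k z * tens p z * moll eps (z - w))"
    proof (cases "w \<in> ?W")
      case True
      have "(LBINT z. u z * tens (p(k := p')) z * moll eps (z - w)) + (LBINT z. u z * tens p z * dmoll eps k (z - w))
        = (LBINT z. u z * (tens (p(k := p')) z * moll eps (z - w) + tens p z * dmoll eps k (z - w)))"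
        by (subst Bochner_Integration.integral_add[symmetric, OF I1(1) I2(1)]) (simp only: distrib_left mult.assoc)
      with weak_cutoff_point[of p k p', OF p d e True] True show ?thesis by (simp add: mult.assoc)
    qed simp
  qed
  also have "\<dots> = - (LBINT z. g k z * (tens p z * cutoff \<Omega> eps z))"
    unfolding cutoff_def mult.assoc[symmetric] I3(2) by simp
  finally show ?thesis .
qed

text \<open>Test functions that do not vanish near the boundary are reached by letting \<open>eps\<close> tend to zero in
\<open>weak_cutoff\<close>. The term with the derivative of the cutoff is dominated, because that derivative is of order \<open>1 / eps\<close> and lives at distance less than \<open>5 eps\<close> from
the complement, where \<open>decay\<close> applies; and it tends to zero pointwise in \<open>\<Omega>\<close>.\<close>

theorem weak_global:
  assumes p: "\<And>i. smooth_real (p i)" and d: "\<And>t. (p k has_real_derivative p' t) (at t)" and p': "smooth_real p'"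
  shows "(LBINT z. u z * tens (p(k := p')) z) = - (LBINT z. g k z * tens p z)"
proof -
  define eps where "eps n = 1 / real (Suc n)" for n
  have e: "eps n > 0" for n by (simp add: eps_def)
  have e0: "eps \<longlonglongrightarrow> 0" unfolding eps_def by (rule LIMSEQ_Suc[OF lim_1_over_n])
  have p'i: "smooth_real ((p(k := p')) i)" for i using p p' by simp
  note pm [measurable] = smooth_real_measurable[OF p] smooth_real_measurable[OF p'i]
  have tm [measurable]: "tens p \<in> borel_measurable borel" "tens (p(k := p')) \<in> borel_measurable borel"
    by (intro borel_measurable_continuous_onI continuous_tens p p'i)+
  obtain C where C: "\<And>x. \<bar>u x\<bar> \<le> C" using u_bounded by blast
  obtain D where D: "0 \<le> D" "\<And>x. x \<in> \<Omega> \<Longrightarrow> \<bar>tens p x\<bar> \<le> D" using tens_bounded_on[of p, OF p bounded_dom] by blast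
  obtain D' where D': "0 \<le> D'" "\<And>x. x \<in> \<Omega> \<Longrightarrow> \<bar>tens (p(k := p')) x\<bar> \<le> D'" using tens_bounded_on[of "p(k := p')", OF p'i bounded_dom] by blast
  have C0: "0 \<le> C" using order_trans[OF abs_ge_zero C] .
  define B where "B = (LBINT v. \<bar>dtens_bump k (v::real^2)\<bar>)"
  have B0: "0 \<le> B" by (simp add: B_def)
  have ev: "\<forall>\<^sub>F n in sequentially. z \<in> deep (5 * eps n) \<Omega>" if z: "z \<in> \<Omega>" for z
  proof -
    obtain r where r: "r > 0" "ball z r \<subseteq> \<Omega>" by (rule openE[OF open_dom z])
    have "(\<lambda>n. 5 * eps n) \<longlonglongrightarrow> 5 * 0" by (intro tendsto_mult tendsto_const e0)
    then have "\<forall>\<^sub>F n in sequentially. 5 * eps n < r" using r(1) by (intro order_tendstoD(2)) auto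
    then show ?thesis
    proof eventually_elim
      case (elim n)
      show ?case unfolding deep_def
      proof (intro CollectI allI impI)
        fix q assume "q \<notin> \<Omega>"
        then have "q \<notin> ball z r" using r(2) by blast
        with elim show "5 * eps n \<le> dist z q" by simp
      qed
    qed
  qed
  have I: "integrable lborel (indicator \<Omega> :: real^2 \<Rightarrow> real)"
    using open_dom bounded_dom by (intro integrable_bounded_support[of _ 1 \<Omega>]) (auto simp: indicator_def)
  have lim1: "(\<lambda>n. LBINT z. u z * (tens (p(k := p')) z * cutoff \<Omega> (eps n) z + tens p z * dcutoff \<Omega> (eps n) k z))
     \<longlonglongrightarrow> (LBINT z. u z * tens (p(k := p')) z)"
  proof (rule integral_dominated_convergence[where w="\<lambda>z. (C * D' + D * (10 * M * B)) * indicator \<Omega> z"])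
    show "AE z in lborel. (\<lambda>n. u z * (tens (p(k := p')) z * cutoff \<Omega> (eps n) z + tens p z * dcutoff \<Omega> (eps n) k z))
       \<longlonglongrightarrow> u z * tens (p(k := p')) z"
    proof (rule AE_I2)
      fix z
      show "(\<lambda>n. u z * (tens (p(k := p')) z * cutoff \<Omega> (eps n) z + tens p z * dcutoff \<Omega> (eps n) k z))
       \<longlonglongrightarrow> u z * tens (p(k := p')) z"
      proof (cases "z \<in> \<Omega>")
        case True
        show ?thesis
          by (rule tendsto_eventually, use ev[OF True] in eventually_elim) (simp add: cutoff_interior[OF e])
      qed (simp add: u_out)
    qed
    show "AE z in lborel. norm (u z * (tens (p(k := p')) z * cutoff \<Omega> (eps n) z + tens p z * dcutoff \<Omega> (eps n) k z))
       \<le> (C * D' + D * (10 * M * B)) * indicator \<Omega> z" for n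
    proof (rule AE_I2)
      fix z
      show "norm (u z * (tens (p(k := p')) z * cutoff \<Omega> (eps n) z + tens p z * dcutoff \<Omega> (eps n) k z))
       \<le> (C * D' + D * (10 * M * B)) * indicator \<Omega> z"
      proof (cases "z \<in> \<Omega>")
        case True
        have "\<bar>u z\<bar> * \<bar>dcutoff \<Omega> (eps n) k z\<bar> \<le> 10 * M * B"
        proof (cases "z \<in> deep (5 * eps n) \<Omega>")
          case True
          then show ?thesis using M_nonneg B0 by (simp add: cutoff_interior[OF e])
        next
          case False
          then obtain q where q: "q \<notin> \<Omega>" "dist z q < 5 * eps n" unfolding deep_def by fastforce
          have "\<bar>u z\<bar> \<le> 2 * M * norm (z - q)" by (rule decay[OF \<open>z \<in> \<Omega>\<close> q(1)])
          also have "\<dots> \<le> 2 * M * (5 * eps n)" using q(2) M_nonneg by (intro mult_left_mono) (auto simp: dist_norm)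
          finally have "\<bar>u z\<bar> * \<bar>dcutoff \<Omega> (eps n) k z\<bar> \<le> (2 * M * (5 * eps n)) * (B / eps n)"
            unfolding B_def using M_nonneg e[of n] by (intro mult_mono cutoff_bounds(2)) auto
          also have "\<dots> = 10 * M * B" using e[of n] by simp
          finally show ?thesis .
        qed
        then have 2: "\<bar>tens p z\<bar> * (\<bar>u z\<bar> * \<bar>dcutoff \<Omega> (eps n) k z\<bar>) \<le> D * (10 * M * B)"
          by (rule mult_mono[OF D(2)[OF True]]) (use D in auto)
        have "\<bar>u z\<bar> * (\<bar>tens (p(k := p')) z\<bar> * \<bar>cutoff \<Omega> (eps n) z\<bar>) \<le> C * (D' * 1)"
          using C D' C0 True cutoff_bounds(1)[OF e[of n], of \<Omega> z] by (intro mult_mono) auto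
        then have "\<bar>u z * (tens (p(k := p')) z * cutoff \<Omega> (eps n) z)\<bar> + \<bar>u z * (tens p z * dcutoff \<Omega> (eps n) k z)\<bar> \<le> C * D' + D * (10 * M * B)"
          using 2 by (simp add: abs_mult mult_ac)
        then show ?thesis using True by (simp add: distrib_left)
      qed (simp add: u_out)
    qed
  qed (use I in \<open>auto intro: integrable_mult_right\<close>)
  have lim2: "(\<lambda>n. LBINT z. g k z * (tens p z * cutoff \<Omega> (eps n) z)) \<longlonglongrightarrow> (LBINT z. g k z * tens p z)"
  proof (rule integral_dominated_convergence[where w="\<lambda>z. (M * D) * indicator \<Omega> z"])
    show "AE z in lborel. (\<lambda>n. g k z * (tens p z * cutoff \<Omega> (eps n) z)) \<longlonglongrightarrow> g k z * tens p z"
    proof (rule AE_I2)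
      fix z
      show "(\<lambda>n. g k z * (tens p z * cutoff \<Omega> (eps n) z)) \<longlonglongrightarrow> g k z * tens p z"
      proof (cases "z \<in> \<Omega>")
        case True
        show ?thesis
          by (rule tendsto_eventually, use ev[OF True] in eventually_elim) (simp add: cutoff_interior[OF e])
      qed (simp add: g_out)
    qed
    show "AE z in lborel. norm (g k z * (tens p z * cutoff \<Omega> (eps n) z)) \<le> (M * D) * indicator \<Omega> z" for n
    proof (rule AE_I2)
      fix z
      show "norm (g k z * (tens p z * cutoff \<Omega> (eps n) z)) \<le> (M * D) * indicator \<Omega> z"
      proof (cases "z \<in> \<Omega>")
        case True
        have "\<bar>g k z\<bar> * (\<bar>tens p z\<bar> * \<bar>cutoff \<Omega> (eps n) z\<bar>) \<le> M * (D * 1)"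
          using g_bound D M_nonneg True cutoff_bounds(1)[OF e[of n], of \<Omega> z] by (intro mult_mono) auto
        then show ?thesis using True by (simp add: abs_mult)
      qed (simp add: g_out)
    qed
  qed (use I in \<open>auto intro: integrable_mult_right\<close>)
  have "(LBINT z. u z * (tens (p(k := p')) z * cutoff \<Omega> (eps n) z + tens p z * dcutoff \<Omega> (eps n) k z))
    = - (LBINT z. g k z * (tens p z * cutoff \<Omega> (eps n) z))" for n
    by (rule weak_cutoff[of p k p', OF p d p' e])
  then have "(\<lambda>n. - (LBINT z. g k z * (tens p z * cutoff \<Omega> (eps n) z))) \<longlonglongrightarrow> (LBINT z. u z * tens (p(k := p')) z)"
    using lim1 by simp
  with tendsto_minus[OF lim2] show ?thesis using LIMSEQ_unique by blast
qed

lemma gradient_mean_zero: "(LBINT x. g k x) = 0"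
proof -
  have 1: "tens (\<lambda>_ _. 1) z = 1" for z :: "real^2" by (simp add: tens_def)
  have 0: "tens ((\<lambda>_ _. 1)(k := \<lambda>_. 0)) z = 0" for z :: "real^2" by (simp add: tens_upd)
  from weak_global[of "\<lambda>_ _. 1" k "\<lambda>_. 0"] show ?thesis
    by (simp add: 0 1 smooth_real_const)
qed

text \<open>Mixed partial derivatives of a tensor product commute, so both sides equal the same integral of \<open>u\<close>.\<close>

lemma curl_free:
  assumes p: "\<And>i. smooth_real (p i)" and q: "\<And>i. smooth_real (q i)"
    and d: "\<And>i t. (p i has_real_derivative q i t) (at t)"
  shows "(LBINT x. g 2 x * tens (p(1 := q 1)) x) = (LBINT x. g 1 x * tens (p(2 := q 2)) x)"
proof -
  have "(LBINT x. u x * tens ((p(1 := q 1))(2 := q 2)) x) = - (LBINT x. g 2 x * tens (p(1 := q 1)) x)"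
    by (rule weak_global) (use p q d in auto)
  moreover have "(LBINT x. u x * tens ((p(2 := q 2))(1 := q 1)) x) = - (LBINT x. g 1 x * tens (p(2 := q 2)) x)"
    by (rule weak_global) (use p q d in auto)
  moreover have "(p(1 := q 1))(2 := q 2) = (p(2 := q 2))(1 := q 1)" by (rule fun_upd_twist) simp
  ultimately show ?thesis by simp
qed

lemma mollified_gradient:
  assumes e: "eps > 0"
  shows "(LBINT z. u z * dmoll eps k (x - z)) = (LBINT z. g k z * moll eps (x - z))"
proof -
  define p where "p i \<tau> = bump ((x $ i - \<tau>) / eps) / eps" for i \<tau>
  (* The variable of the test function enters the mollifier with a minus sign. *)
  define q where "q \<tau> = - (dbump ((x $ k - \<tau>) / eps) / eps / eps)" for \<tau>
  have p: "smooth_real (p i)" for i unfolding p_def[abs_def] by (intro smooth_scaled smooth_bump)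
  have q: "smooth_real q"
    using smooth_real_mult[OF smooth_real_const[of "-1/eps"] smooth_scaled(2)[OF smooth_dbump, of "x $ k" eps]]
    by (simp add: q_def[abs_def])
  have d: "(p k has_real_derivative q \<tau>) (at \<tau>)" for \<tau>
    unfolding p_def q_def using e by (auto intro!: derivative_eq_intros DERIV_chain2[OF bump_deriv])
  have 1: "tens p z = moll eps (x - z)" for z
    by (simp only: tens_def moll_def scaled_def p_def vector_minus_component)
  have 2: "tens (p(k := q)) z = - dmoll eps k (x - z)" for z
  proof -
    have "dmoll eps k (x - z) = dbump ((x $ k - z $ k) / eps) / eps * (\<Prod>i\<in>UNIV - {k}. p i (z $ i)) / eps"
      unfolding dmoll_def tens_def scaled_def p_def by (subst prod.remove[of _ k]) auto
    then show ?thesis by (simp add: tens_upd q_def)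
  qed
  from weak_global[of p k q, OF p d q] show ?thesis unfolding 1 2 by simp
qed

end

section \<open>The determinant as a null Lagrangian\<close>

text \<open>The determinant of a gradient is a divergence. Mollifying the second factor turns it into a smooth
gradient, against which the first one is tested with \<open>curl_free\<close>.\<close>

theorem null_lagrangian:
  assumes "zero_trace \<Omega> u g M" "zero_trace \<Omega> v h M"
  shows "(LBINT x. g 1 x * h 2 x) = (LBINT x. g 2 x * h 1 x)"
proof -
  interpret U: zero_trace \<Omega> u g M by fact
  interpret V: zero_trace \<Omega> v h M by fact
  obtain C where C: "\<And>x. \<bar>v x\<bar> \<le> C" using V.u_bounded by blast
  have eq: "(LBINT x. g 2 x * (LBINT z. h 1 z * moll eps (x - z)))
     = (LBINT x. g 1 x * (LBINT z. h 2 z * moll eps (x - z)))" if e: "eps > 0" for eps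
  proof -
    have swap: "(LBINT x. g k x * (LBINT z. v z * dmoll eps j (x - z)))
      = (LBINT z. v z * (LBINT x. g k x * dmoll eps j (x - z)))" for j k
    proof -
      obtain D where D: "\<And>w. \<bar>dmoll eps j (w::real^2)\<bar> \<le> D" using dmoll_bounded[OF e] by blast
      have "(LBINT x. g k x * (LBINT z. v z * dmoll eps j (x - z)))
        = (LBINT x. (LBINT z. g k x * (v z * dmoll eps j (x - z))))" by simp
      also have "\<dots> = (LBINT z. (LBINT x. g k x * (v z * dmoll eps j (x - z))))"
      proof (rule lborel_pair.Fubini_integral)
        show "integrable (lborel \<Otimes>\<^sub>M lborel) (\<lambda>(z, x). g k x * (v z * dmoll eps j (x - z)))"
        proof (rule integrable_pair_bounded_support[where S=\<Omega> and T=\<Omega> and C="M * (C * D)"])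
          show "\<bar>case y of (z, x) \<Rightarrow> g k x * (v z * dmoll eps j (x - z))\<bar> \<le> M * (C * D)" for y
          proof (cases y)
            case (Pair z x)
            have "\<bar>g k x\<bar> * (\<bar>v z\<bar> * \<bar>dmoll eps j (x - z)\<bar>) \<le> M * (C * D)"
              using U.M_nonneg order_trans[OF abs_ge_zero C]
              by (intro mult_mono U.g_bound C D mult_nonneg_nonneg abs_ge_zero)
            then show ?thesis by (simp add: Pair abs_mult)
          qed
          show "(case (z, x) of (z, x) \<Rightarrow> g k x * (v z * dmoll eps j (x - z))) = 0" if "z \<notin> \<Omega> \<or> x \<notin> \<Omega>" for z x
            using that U.g_out V.u_out by auto
        qed (use U.bounded_dom in \<open>simp_all add: split_beta\<close>)
      qed
      also have "\<dots> = (LBINT z. v z * (LBINT x. g k x * dmoll eps j (x - z)))"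
      proof (rule Bochner_Integration.integral_cong[OF refl])
        fix z
        have "(LBINT x. g k x * (v z * dmoll eps j (x - z))) = (LBINT x. v z * (g k x * dmoll eps j (x - z)))"
          by (simp only: mult.left_commute)
        then show "(LBINT x. g k x * (v z * dmoll eps j (x - z))) = v z * (LBINT x. g k x * dmoll eps j (x - z))"
          by simp
      qed
      finally show ?thesis .
    qed
    have curl: "(LBINT x. g 2 x * dmoll eps 1 (x - z)) = (LBINT x. g 1 x * dmoll eps 2 (x - z))" for z
    proof -
      define p where "p i \<tau> = bump ((\<tau> - z $ i) / eps) / eps" for i \<tau>
      define q where "q i \<tau> = dbump ((\<tau> - z $ i) / eps) / eps / eps" for i \<tau>
      have p: "smooth_real (p i)" for i unfolding p_def[abs_def] by (intro smooth_scaled smooth_bump)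
      have q: "smooth_real (q i)" for i
        using smooth_real_mult[OF smooth_real_const[of "1/eps"] smooth_scaled(1)[OF smooth_dbump, of "z $ i" eps]]
        by (simp add: q_def[abs_def])
      have d: "(p i has_real_derivative q i \<tau>) (at \<tau>)" for i \<tau>
        unfolding p_def q_def using e by (auto intro!: derivative_eq_intros DERIV_chain2[OF bump_deriv])
      have 2: "tens (p(k := q k)) x = dmoll eps k (x - z)" for x k
      proof -
        have "dmoll eps k (x - z) = dbump ((x $ k - z $ k) / eps) / eps * (\<Prod>i\<in>UNIV - {k}. p i (x $ i)) / eps"
          unfolding dmoll_def tens_def scaled_def p_def by (subst prod.remove[of _ k]) auto
        then show ?thesis by (simp add: tens_upd q_def)
      qed
      from U.curl_free[of p q, OF p q d] show ?thesis unfolding 2 .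
    qed
    have "(LBINT x. g 2 x * (LBINT z. v z * dmoll eps 1 (x - z)))
      = (LBINT x. g 1 x * (LBINT z. v z * dmoll eps 2 (x - z)))"
      unfolding swap curl ..
    then show ?thesis by (simp add: V.mollified_gradient[OF e])
  qed
  define eps where "eps n = 1 / real (Suc n)" for n
  have e: "eps n > 0" for n by (simp add: eps_def)
  have e0: "eps \<longlonglongrightarrow> 0" unfolding eps_def by (rule LIMSEQ_Suc[OF lim_1_over_n])
  have lim: "(\<lambda>n. LBINT x. g j x * (LBINT z. h k z * moll (eps n) (x - z))) \<longlonglongrightarrow> (LBINT x. g j x * h k x)" for j k
    by (rule moll_tendsto_pairing[OF U.g_meas V.g_meas U.g_bound V.g_bound U.bounded_dom U.g_out V.g_out e0 e])
  from lim[of 2 1] lim[of 1 2] show ?thesis unfolding eq[OF e] using LIMSEQ_unique by blast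
qed

section \<open>Weak-* convergent sequences are bounded\<close>

text \<open>A substitute for the essential supremum: shrinking a bound by the factor 2/3 must fail at some stage
unless the function vanishes.\<close>

lemma (in finite_measure) almost_optimal_bound:
  fixes f :: "'a \<Rightarrow> real"
  assumes "AE x in M. \<bar>f x\<bar> \<le> C"
  shows "\<exists>N. (AE x in M. \<bar>f x\<bar> \<le> N) \<and> (N \<le> 0 \<or> \<not> (AE x in M. \<bar>f x\<bar> \<le> 2 / 3 * N))"
proof (rule ccontr)
  assume "\<not> ?thesis"
  then have step: "0 < N \<and> (AE x in M. \<bar>f x\<bar> \<le> 2 / 3 * N)" if "AE x in M. \<bar>f x\<bar> \<le> N" for N
    using that by (meson not_le)
  have pow: "AE x in M. \<bar>f x\<bar> \<le> (2 / 3) ^ n * C" for n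
  proof (induction n)
    case (Suc n)
    with step[of "(2 / 3) ^ n * C"] show ?case by (simp add: mult.assoc)
  qed (use assms in simp)
  have "AE x in M. \<forall>n. \<bar>f x\<bar> \<le> (2 / 3) ^ n * C" using pow by (simp add: AE_all_countable)
  then have "AE x in M. \<bar>f x\<bar> \<le> 0"
  proof eventually_elim
    case (elim x)
    have "(\<lambda>n. (2 / 3) ^ n * C) \<longlonglongrightarrow> 0 * C" by (intro tendsto_mult tendsto_const LIMSEQ_power_zero) simp
    then have "(\<lambda>n. (2 / 3) ^ n * C) \<longlonglongrightarrow> 0" by simp
    then show ?case by (rule LIMSEQ_le_const) (use elim in blast)
  qed
  with step[of 0] show False by simp
qed

lemma (in finite_measure) near_extremal_test_function:
  fixes f :: "'a \<Rightarrow> real"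
  assumes [measurable]: "f \<in> borel_measurable M" and N: "AE x in M. \<bar>f x\<bar> \<le> N"
    and n: "\<not> (AE x in M. \<bar>f x\<bar> \<le> c)"
  shows "\<exists>\<phi>. integrable M \<phi> \<and> (LINT x|M. \<bar>\<phi> x\<bar>) = 1 \<and> c \<le> (LINT x|M. f x * \<phi> x)"
proof -
  define A where "A = {x \<in> space M. c < \<bar>f x\<bar>}"
  have [measurable]: "A \<in> sets M" unfolding A_def by measurable
  have "emeasure M A \<noteq> 0"
  proof
    assume "emeasure M A = 0"
    then have "AE x in M. x \<notin> A" by (intro AE_not_in) (auto simp: null_sets_def)
    then have "AE x in M. \<bar>f x\<bar> \<le> c" by (rule AE_mp) (auto simp: A_def intro!: AE_I2)
    with n show False by simp
  qed
  then have A: "0 < measure M A" by (simp add: emeasure_eq_measure measure_nonneg order_less_le)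
  define \<phi> where "\<phi> x = (if f x \<ge> 0 then 1 else -1) * indicator A x / measure M A" for x
  have [measurable]: "\<phi> \<in> borel_measurable M" unfolding \<phi>_def by measurable
  have abs: "\<bar>\<phi> x\<bar> = indicator A x / measure M A" for x
    using A by (simp add: \<phi>_def abs_mult)
  have i: "integrable M \<phi>"
    by (rule integrable_const_bound[of _ "1 / measure M A"]) (use A in \<open>auto simp: abs indicator_def\<close>)
  have fi: "integrable M (\<lambda>x. f x * \<phi> x)"
  proof (rule integrable_const_bound[of _ "N * (1 / measure M A)"])
    show "AE x in M. norm (f x * \<phi> x) \<le> N * (1 / measure M A)"
      using N
    proof eventually_elim
      case (elim x)
      then show ?case unfolding real_norm_def abs_mult abs
        using A by (intro mult_mono) (auto simp: indicator_def)
    qed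
  qed simp
  have "c = (LINT x|M. c * (indicator A x / measure M A))" using A by simp
  also have "\<dots> \<le> (LINT x|M. f x * \<phi> x)"
  proof (rule integral_mono)
    show "integrable M (\<lambda>x. c * (indicator A x / measure M A))"
      by (intro integrable_mult_right integrable_divide_zero integrable_real_indicator) (auto simp: less_top[symmetric])
    fix x
    show "c * (indicator A x / measure M A) \<le> f x * \<phi> x"
      using A by (auto simp: \<phi>_def A_def indicator_def divide_right_mono)
  qed (use fi in simp)
  finally have "c \<le> (LINT x|M. f x * \<phi> x)" .
  moreover have "(LINT x|M. \<bar>\<phi> x\<bar>) = 1" using A by (simp add: abs)
  ultimately show ?thesis using i by blast
qed

lemma L1_summable:
  fixes d :: "nat \<Rightarrow> 'a \<Rightarrow> real"
  assumes i: "\<And>m. integrable M (d m)" and s: "summable (\<lambda>m. LINT x|M. \<bar>d m x\<bar>)"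
  shows "AE x in M. summable (\<lambda>m. \<bar>d m x\<bar>)"
proof -
  have [measurable]: "d m \<in> borel_measurable M" for m using i by (rule borel_measurable_integrable)
  have "(\<integral>\<^sup>+x. (\<Sum>m. ennreal \<bar>d m x\<bar>) \<partial>M) = (\<Sum>m. \<integral>\<^sup>+x. ennreal \<bar>d m x\<bar> \<partial>M)"
    by (rule nn_integral_suminf) simp
  also have "\<dots> = (\<Sum>m. ennreal (LINT x|M. \<bar>d m x\<bar>))"
    by (subst nn_integral_eq_integral) (auto intro!: integrable_abs i)
  also have "\<dots> < \<infinity>"
    using s by (simp add: suminf_ennreal2 less_top[symmetric] ennreal_suminf_neq_top)
  finally have "AE x in M. (\<Sum>m. ennreal \<bar>d m x\<bar>) \<noteq> \<infinity>"
    by (intro nn_integral_PInf_AE) auto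
  then show ?thesis
    by eventually_elim (rule summable_suminf_not_top, auto)
qed

text \<open>The uniform boundedness principle for \<open>L\<^sup>\<infinity>\<close> as the dual of \<open>L\<^sup>1\<close>, by Sokal's elementary argument.
If the norms \<open>N (j n)\<close> exceed \<open>4\<^sup>n\<close>, a series \<open>h = \<Sum> \<plusminus> 3\<^sup>-\<^sup>n \<phi>\<^sub>n\<close> of almost extremal functions
is built. Since \<open>max |T (s + \<xi>)| |T (s - \<xi>)| \<ge> |T \<xi>|\<close>, the sign can be chosen so that the
\<open>n\<close>-th functional is at least \<open>3\<^sup>-\<^sup>n 2/3 N (j n)\<close> on the partial sum; the tail of the series can
undo at most \<open>3\<^sup>-\<^sup>n 1/2 N (j n)\<close> of it. What remains is at least \<open>(4/3)\<^sup>n / 6\<close>, so the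
pairings with \<open>h\<close> are unbounded.\<close>

theorem (in finite_measure) uniformly_bounded_of_pairings:
  fixes f :: "nat \<Rightarrow> 'a \<Rightarrow> real"
  assumes m [measurable]: "\<And>j. f j \<in> borel_measurable M" and b: "\<And>j. \<exists>C. AE x in M. \<bar>f j x\<bar> \<le> C"
    and conv: "\<And>h. integrable M h \<Longrightarrow> \<exists>B. \<forall>j. \<bar>LINT x|M. f j x * h x\<bar> \<le> B"
  shows "\<exists>C. \<forall>j. AE x in M. \<bar>f j x\<bar> \<le> C"
proof (rule ccontr)
  assume contra: "\<not> ?thesis"
  have "\<forall>j. \<exists>N. (AE x in M. \<bar>f j x\<bar> \<le> N) \<and> (N \<le> 0 \<or> \<not> (AE x in M. \<bar>f j x\<bar> \<le> 2 / 3 * N))"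
    using b almost_optimal_bound by blast
  then obtain N where N: "\<And>j. AE x in M. \<bar>f j x\<bar> \<le> N j"
    and opt: "\<And>j. N j \<le> 0 \<or> \<not> (AE x in M. \<bar>f j x\<bar> \<le> 2 / 3 * N j)" by metis
  have "\<exists>j. 4 ^ n < N j" for n :: nat
  proof (rule ccontr)
    assume "\<nexists>j. 4 ^ n < N j"
    then have "AE x in M. \<bar>f j x\<bar> \<le> 4 ^ n" for j
      using N[of j] by (auto elim!: eventually_mono simp: not_less intro: order_trans)
    with contra show False by blast
  qed
  then obtain j where j: "\<And>n. 4 ^ n < N (j n)" by metis
  have pos: "0 < N (j n)" for n using j[of n] by (meson less_trans zero_less_numeral zero_less_power)
  have "\<exists>\<phi>. integrable M \<phi> \<and> (LINT x|M. \<bar>\<phi> x\<bar>) = 1 \<and> 2 / 3 * N (j n) \<le> (LINT x|M. f (j n) x * \<phi> x)" for n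
    using opt[of "j n"] pos[of n] by (intro near_extremal_test_function[OF m N]) auto
  then obtain \<phi> where \<phi>: "\<And>n. integrable M (\<phi> n)" "\<And>n. (LINT x|M. \<bar>\<phi> n x\<bar>) = 1"
    "\<And>n. 2 / 3 * N (j n) \<le> (LINT x|M. f (j n) x * \<phi> n x)" by metis
  define T where "T i h = (LINT x|M. f i x * h x)" for i h
  have fh: "integrable M (\<lambda>x. f i x * h x)" "\<bar>T i h\<bar> \<le> N i * (LINT x|M. \<bar>h x\<bar>)" if h: "integrable M h" for i h
  proof -
    have [measurable]: "h \<in> borel_measurable M" using h by (rule borel_measurable_integrable)
    have le: "AE x in M. \<bar>f i x * h x\<bar> \<le> N i * \<bar>h x\<bar>"
      using N[of i] by eventually_elim (simp add: abs_mult mult_right_mono)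
    show i: "integrable M (\<lambda>x. f i x * h x)"
    proof (rule Bochner_Integration.integrable_bound)
      show "integrable M (\<lambda>x. N i * \<bar>h x\<bar>)" using h by (intro integrable_mult_right integrable_abs)
      show "AE x in M. norm (f i x * h x) \<le> norm (N i * \<bar>h x\<bar>)"
        using le by eventually_elim (simp add: order_trans[OF _ abs_ge_self])
    qed simp
    have "\<bar>T i h\<bar> \<le> (LINT x|M. \<bar>f i x * h x\<bar>)" unfolding T_def by (rule integral_abs_bound)
    also have "\<dots> \<le> (LINT x|M. N i * \<bar>h x\<bar>)"
      by (rule integral_mono_AE) (use i h le in auto)
    finally show "\<bar>T i h\<bar> \<le> N i * (LINT x|M. \<bar>h x\<bar>)" by simp
  qed
  (* The summand with the plus sign is taken whenever it is large enough; otherwise the minus sign works. *)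
  define S where "S = rec_nat (\<lambda>x. 0::real) (\<lambda>n s.
    if (1/3) ^ n * (2 / 3 * N (j n)) \<le> \<bar>T (j n) (\<lambda>x. s x + (1/3) ^ n * \<phi> n x)\<bar>
    then (\<lambda>x. s x + (1/3) ^ n * \<phi> n x) else (\<lambda>x. s x - (1/3) ^ n * \<phi> n x))"
  have S0: "S 0 = (\<lambda>x. 0)" by (simp add: S_def)
  have SS: "S (Suc n) = (if (1/3) ^ n * (2 / 3 * N (j n)) \<le> \<bar>T (j n) (\<lambda>x. S n x + (1/3) ^ n * \<phi> n x)\<bar>
    then (\<lambda>x. S n x + (1/3) ^ n * \<phi> n x) else (\<lambda>x. S n x - (1/3) ^ n * \<phi> n x))" for n
    by (simp add: S_def)
  have Si: "integrable M (S n)" for n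
    by (induction n) (auto simp: S0 SS intro!: Bochner_Integration.integrable_add Bochner_Integration.integrable_diff integrable_mult_right \<phi>(1))
  define d where "d n x = S (Suc n) x - S n x" for n x
  have d_abs: "\<bar>d n x\<bar> = (1/3) ^ n * \<bar>\<phi> n x\<bar>" for n x
    by (simp add: d_def SS abs_mult)
  have di: "integrable M (d n)" for n
    unfolding d_def using Si by (intro Bochner_Integration.integrable_diff)
  have d1: "(LINT x|M. \<bar>d n x\<bar>) = (1/3) ^ n" for n
    by (simp add: d_abs \<phi>(2))
  have TS: "(1/3) ^ n * (2 / 3 * N (j n)) \<le> \<bar>T (j n) (S (Suc n))\<bar>" for n
  proof (cases "(1/3) ^ n * (2 / 3 * N (j n)) \<le> \<bar>T (j n) (\<lambda>x. S n x + (1/3) ^ n * \<phi> n x)\<bar>")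
    case True
    then show ?thesis by (simp add: SS)
  next
    case False
    have i: "integrable M (\<lambda>x. f (j n) x * S n x)" "integrable M (\<lambda>x. f (j n) x * ((1/3) ^ n * \<phi> n x))"
      by (intro fh(1) Si integrable_mult_right \<phi>(1))+
    have "T (j n) (\<lambda>x. S n x + (1/3) ^ n * \<phi> n x) = T (j n) (S n) + T (j n) (\<lambda>x. (1/3) ^ n * \<phi> n x)"
      "T (j n) (\<lambda>x. S n x - (1/3) ^ n * \<phi> n x) = T (j n) (S n) - T (j n) (\<lambda>x. (1/3) ^ n * \<phi> n x)"
      unfolding T_def using i by (simp_all only: distrib_left right_diff_distrib Bochner_Integration.integral_add Bochner_Integration.integral_diff)
    moreover have "T (j n) (\<lambda>x. (1/3) ^ n * \<phi> n x) = (1/3) ^ n * (LINT x|M. f (j n) x * \<phi> n x)"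
      unfolding T_def by (subst integral_mult_right_zero[symmetric]) (simp only: mult.left_commute)
    moreover have "(1/3) ^ n * (2 / 3 * N (j n)) \<le> (1/3) ^ n * (LINT x|M. f (j n) x * \<phi> n x)"
      using \<phi>(3)[of n] by (intro mult_left_mono) auto
    ultimately have "(1/3) ^ n * (2 / 3 * N (j n)) \<le> \<bar>T (j n) (\<lambda>x. S n x - (1/3) ^ n * \<phi> n x)\<bar>"
      using False by linarith
    with False show ?thesis by (simp add: SS)
  qed
  have geo: "summable (\<lambda>n. (1/3::real) ^ n)" by (rule summable_geometric) simp
  have sumd: "summable (\<lambda>n. LINT x|M. \<bar>d n x\<bar>)" unfolding d1 by (rule geo)
  define h where "h x = (\<Sum>n. d n x)" for x
  have hi: "integrable M h"
    unfolding h_def by (rule integrable_suminf[OF di]) (use L1_summable[OF di sumd] sumd in simp_all)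
  obtain B where B: "\<And>i. \<bar>T i h\<bar> \<le> B" using conv[OF hi] unfolding T_def by blast
  have Th: "(\<lambda>m. T i (d m)) sums T i h" for i
  proof -
    have fd: "integrable M (\<lambda>x. f i x * d m x)" for m by (rule fh(1)[OF di])
    have le: "(LINT x|M. \<bar>f i x * d m x\<bar>) \<le> N i * (1/3) ^ m" for m
    proof -
      have "(LINT x|M. \<bar>f i x * d m x\<bar>) \<le> (LINT x|M. N i * \<bar>d m x\<bar>)"
      proof (rule integral_mono_AE)
        show "integrable M (\<lambda>x. \<bar>f i x * d m x\<bar>)" by (rule integrable_abs[OF fd])
        show "integrable M (\<lambda>x. N i * \<bar>d m x\<bar>)" by (intro integrable_mult_right integrable_abs di)
        show "AE x in M. \<bar>f i x * d m x\<bar> \<le> N i * \<bar>d m x\<bar>"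
          using N[of i] by eventually_elim (simp add: abs_mult mult_right_mono)
      qed
      then show ?thesis by (simp add: d1)
    qed
    have sm: "summable (\<lambda>m. LINT x|M. \<bar>f i x * d m x\<bar>)"
      by (rule summable_comparison_test[OF _ summable_mult[OF geo, of "N i"]]) (use le in \<open>auto simp: integral_nonneg\<close>)
    have "(\<lambda>m. LINT x|M. f i x * d m x) sums (LINT x|M. (\<Sum>m. f i x * d m x))"
      by (rule sums_integral[OF fd]) (use L1_summable[OF fd sm] sm in simp_all)
    moreover have "(LINT x|M. (\<Sum>m. f i x * d m x)) = T i h"
      unfolding T_def h_def
    proof (rule integral_cong_AE)
      show "AE x in M. (\<Sum>m. f i x * d m x) = f i x * (\<Sum>m. d m x)"
        using L1_summable[OF di sumd] by eventually_elim (rule suminf_mult, rule summable_rabs_cancel)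
      show "(\<lambda>x. f i x * (\<Sum>m. d m x)) \<in> borel_measurable M"
        using borel_measurable_integrable[OF hi] by (simp add: h_def[abs_def])
      show "(\<lambda>x. \<Sum>m. f i x * d m x) \<in> borel_measurable M"
        using borel_measurable_integrable[OF fd] by (intro borel_measurable_suminf)
    qed
    ultimately show ?thesis by (simp add: T_def)
  qed
  have Tsum: "T i (S n) = (\<Sum>m<n. T i (d m))" for i n
  proof (induction n)
    case (Suc n)
    have "T i (S (Suc n)) = (LINT x|M. f i x * S n x + f i x * d n x)"
      by (simp add: T_def d_def right_diff_distrib)
    also have "\<dots> = T i (S n) + T i (d n)"
      unfolding T_def by (rule Bochner_Integration.integral_add[OF fh(1)[OF Si] fh(1)[OF di]])
    finally show ?case using Suc by simp
  qed (simp add: S0 T_def)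
  have big: "(4/3) ^ n / 6 \<le> B" for n
  proof -
    let ?i = "j n"
    have "(\<lambda>m. T ?i (d (m + Suc n))) sums (T ?i h - (\<Sum>m<Suc n. T ?i (d m)))"
      using Th[of ?i] by (rule sums_split_initial_segment)
    then have tail: "T ?i h - T ?i (S (Suc n)) = (\<Sum>m. T ?i (d (m + Suc n)))"
      unfolding Tsum by (rule sums_unique)
    have "\<bar>T ?i (d (m + Suc n))\<bar> \<le> N ?i * (1/3) ^ Suc n * (1/3) ^ m" for m
      using fh(2)[OF di, of ?i "m + Suc n"] by (simp add: d1 power_add mult_ac)
    moreover have "(\<lambda>m. N ?i * (1/3) ^ Suc n * (1/3) ^ m) sums (N ?i * (1/3) ^ Suc n * (1 / (1 - 1/3)))"
      by (intro sums_mult geometric_sums) simp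
    ultimately have "\<bar>\<Sum>m. T ?i (d (m + Suc n))\<bar> \<le> N ?i * (1/3) ^ Suc n * (1 / (1 - 1/3))"
      by (metis norm_suminf_le real_norm_def sums_iff)
    then have "\<bar>T ?i h - T ?i (S (Suc n))\<bar> \<le> N ?i * (1/3) ^ n * (1/2)" unfolding tail by simp
    with TS[of n] B[of ?i] have "(1/3) ^ n * (2 / 3 * N ?i) - N ?i * (1/3) ^ n * (1/2) \<le> B" by linarith
    then have "(1/3) ^ n * N ?i / 6 \<le> B" by (simp add: field_simps)
    moreover have "(1/3) ^ n * 4 ^ n \<le> (1/3) ^ n * N ?i" using j[of n] by (intro mult_left_mono) auto
    moreover have "(1/3 :: real) ^ n * 4 ^ n = (4/3) ^ n" by (simp add: power_mult_distrib[symmetric])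
    ultimately show ?thesis by linarith
  qed
  obtain n where "6 * B < (4/3 :: real) ^ n" using real_arch_pow[of "4/3" "6 * B"] by auto
  with big[of n] show False by simp
qed

section \<open>From weak gradients to zero-trace functions\<close>

lemma AE_lebesgue_on_iff:
  fixes \<Omega> :: "'a::euclidean_space set"
  assumes "\<Omega> \<in> sets lebesgue"
  shows "(AE x in lebesgue_on \<Omega>. P x) \<longleftrightarrow> (AE x in lebesgue. x \<in> \<Omega> \<longrightarrow> P x)"
  by (rule AE_restrict_space_iff) (use assms in simp)

text \<open>Lebesgue measurable data are replaced by Borel functions once and for all, because the exchange of
integrals takes place for the product of Borel measures.\<close>

lemma borel_representative:
  fixes f :: "'a::euclidean_space \<Rightarrow> real"
  assumes O: "open \<Omega>" and f: "f \<in> borel_measurable (lebesgue_on \<Omega>)" and C: "AE x in lebesgue_on \<Omega>. \<bar>f x\<bar> \<le> C"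
    and C0: "0 \<le> C"
  shows "\<exists>g. g \<in> borel_measurable borel \<and> (\<forall>x. \<bar>g x\<bar> \<le> C) \<and> (\<forall>x. x \<notin> \<Omega> \<longrightarrow> g x = 0) \<and>
    (AE x in lebesgue_on \<Omega>. f x = g x)"
proof -
  have OL: "\<Omega> \<in> sets lebesgue" using O by auto
  have "(\<lambda>x. indicator \<Omega> x *\<^sub>R f x) \<in> borel_measurable lebesgue"
    using f OL by (subst (asm) borel_measurable_restrict_space_iff) (auto simp: mult.commute)
  then obtain g where g: "g \<in> borel_measurable lborel" "AE x in lborel. indicator \<Omega> x *\<^sub>R f x = g x"
    using completion_ex_borel_measurable_real by blast
  define g' where "g' x = indicator \<Omega> x * max (-C) (min C (g x))" for x
  have "AE x in lebesgue. indicator \<Omega> x *\<^sub>R f x = g x" using g(2) by (rule AE_completion)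
  moreover have "AE x in lebesgue. x \<in> \<Omega> \<longrightarrow> \<bar>f x\<bar> \<le> C" using C unfolding AE_lebesgue_on_iff[OF OL] .
  ultimately have "AE x in lebesgue. x \<in> \<Omega> \<longrightarrow> f x = g' x"
    by eventually_elim (auto simp: g'_def)
  then have "AE x in lebesgue_on \<Omega>. f x = g' x" unfolding AE_lebesgue_on_iff[OF OL] .
  moreover have "g' \<in> borel_measurable borel"
    unfolding g'_def using g(1) O by (intro borel_measurable_times borel_measurable_indicator borel_measurable_max borel_measurable_min) auto
  ultimately show ?thesis
    using C0 by (intro exI[of _ g']) (auto simp: g'_def indicator_def)
qed

lemma integral_lebesgue_on_eq_lborel:
  fixes f :: "'a::euclidean_space \<Rightarrow> real"
  assumes O: "open \<Omega>" and f: "f \<in> borel_measurable (lebesgue_on \<Omega>)" and h: "h \<in> borel_measurable borel"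
    and eq: "AE x in lebesgue_on \<Omega>. f x = h x" and h0: "\<And>x. x \<notin> \<Omega> \<Longrightarrow> h x = 0"
  shows "(LINT x|lebesgue_on \<Omega>. f x) = (LBINT x. h x)"
proof -
  have OL: "\<Omega> \<in> sets lebesgue" using O by auto
  have hl: "h \<in> borel_measurable lebesgue" using h by (simp add: measurable_completion)
  have "(LINT x|lebesgue_on \<Omega>. f x) = (LINT x|lebesgue_on \<Omega>. h x)"
    by (rule integral_cong_AE[OF f _ eq]) (rule measurable_restrict_space1[OF hl])
  also have "\<dots> = (LINT x|lebesgue. indicator \<Omega> x *\<^sub>R h x)"
    using OL by (intro integral_restrict_space) auto
  also have "(\<lambda>x. indicator \<Omega> x *\<^sub>R h x) = h" using h0 by (auto simp: fun_eq_iff indicator_def)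
  also have "(LINT x|lebesgue. h x) = (LBINT x. h x)"
    using h by (intro integral_completion) simp
  finally show ?thesis .
qed

text \<open>Integration by parts against the linear map \<open>F x\<close>, one coordinate at a time.\<close>

lemma linear_against_derivative:
  fixes a b :: "real^'n::finite"
  assumes p: "\<And>i. smooth_real (p i)" and d: "\<And>t. (p k has_real_derivative p' t) (at t)"
    and p': "smooth_real p'" and 0: "\<And>i t. t \<notin> {a $ i..b $ i} \<Longrightarrow> p i t = 0"
  shows "(LBINT x. x $ l * tens (p(k := p')) x) = (if l = k then - (LBINT x. tens p x) else 0)"
    and "integrable lborel (\<lambda>x. x $ l * tens (p(k := p')) x)"
proof -
  define r where "r = p(k := p')"
  have r: "smooth_real (r i)" for i using p p' by (simp add: r_def)
  have p'0: "p' t = 0" if "t \<notin> {a $ k..b $ k}" for t by (rule deriv_outside[OF d 0 that])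
  have r0: "r i t = 0" if "t \<notin> {a $ i..b $ i}" for i t using 0[OF that] p'0 that by (auto simp: r_def)
  define s where "s = r(l := \<lambda>t. t * r l t)"
  have sc: "continuous_on UNIV (s i)" for i
    using smooth_real_continuous[OF r] by (auto simp: s_def intro!: continuous_intros)
  have s0: "s i t = 0" if "t \<notin> {a $ i..b $ i}" for i t
    using r0[OF that] by (cases "i = l") (auto simp: s_def)
  have si: "integrable lborel (s i)" for i by (rule cont_compact_support(2)[OF sc s0])
  have eq: "x $ l * tens r x = tens s x" for x
    unfolding s_def tens_upd by (simp add: tens_def prod.remove[of UNIV l] mult.assoc)
  have "\<forall>i. \<exists>C. \<forall>t. \<bar>s i t\<bar> \<le> C" using cont_compact_support(1)[OF sc s0] by blast
  then obtain C where C: "\<And>i t. \<bar>s i t\<bar> \<le> C i" by metis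
  have "s i \<in> borel_measurable borel" for i by (rule borel_measurable_continuous_onI[OF sc])
  then have sm: "tens s \<in> borel_measurable borel"
    using borel_measurable_tens[of s "\<lambda>x. x" borel] by simp
  show "integrable lborel (\<lambda>x. x $ l * tens (p(k := p')) x)"
    unfolding r_def[symmetric] eq
    by (rule integrable_bounded_support[OF sm tens_abs_le[OF C] bounded_cbox tens_outside[OF s0]])
  have int: "(LBINT x. x $ l * tens r x) = (\<Prod>i\<in>UNIV. LBINT t. s i t)"
    unfolding eq by (rule integral_tens[OF si])
  note parts = integral_deriv_compact_support[OF d smooth_real_continuous[OF p'] 0]
  show "(LBINT x. x $ l * tens (p(k := p')) x) = (if l = k then - (LBINT x. tens p x) else 0)"
  proof (cases "l = k")
    case True
    have pi: "integrable lborel (p i)" for i by (rule cont_compact_support(2)[OF smooth_real_continuous[OF p] 0])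
    have sk: "(LBINT t. s k t) = - (LBINT t. p k t)" using parts(2) True by (simp add: s_def r_def)
    have "(\<Prod>i\<in>UNIV. LBINT t. s i t) = - (\<Prod>i\<in>UNIV. LBINT t. p i t)"
      using True sk by (simp add: prod.remove[of UNIV k]) (simp add: s_def r_def)
    then show ?thesis using True int integral_tens[of p, OF pi] by (simp add: r_def)
  next
    case False
    have "(\<Prod>i\<in>UNIV. LBINT t. s i t) = 0"
      using parts(1) False by (intro prod_zero) (auto simp: s_def r_def intro!: bexI[of _ k])
    then show ?thesis using False int by (simp add: r_def)
  qed
qed

lemma has_weak_gradient_weak_gradient: "u \<in> W1_infty \<Omega> \<Longrightarrow> has_weak_gradient \<Omega> u (weak_gradient \<Omega> u)"
  unfolding weak_gradient_def by (rule someI_ex[of "has_weak_gradient \<Omega> u"]) (simp add: W1_infty_def)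

lemma smooth_derivatives:
  assumes "\<And>i. smooth_real (p i)"
  shows "\<exists>P. (\<forall>i. smooth_real (P i)) \<and> (\<forall>i t. (p i has_real_derivative P i t) (at t))"
proof -
  have "\<forall>i. \<exists>q. smooth_real q \<and> (\<forall>t. (p i has_real_derivative q t) (at t))"
    using assms by (metis smooth_real.cases)
  then show ?thesis by metis
qed

lemma L_infty_component:
  fixes u :: "real^'n::finite \<Rightarrow> 'b::euclidean_space^'m::finite"
  assumes "u \<in> L_infty \<Omega>" shows "(\<lambda>x. u x $ i) \<in> borel_measurable (lebesgue_on \<Omega>)"
proof -
  have 1: "u \<in> borel_measurable (lebesgue_on \<Omega>)" using assms by (simp add: L_infty_def)
  have 2: "(\<lambda>x::'b^'m. x $ i) \<in> borel_measurable borel"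
    by (intro borel_measurable_continuous_onI linear_continuous_on bounded_linear_vec_nth)
  show ?thesis by (rule measurable_compose[OF 1 2])
qed

text \<open>The \<open>i\<close>-th component of \<open>y - F x\<close>. Its continuous representative vanishes on the frontier, so it
extends continuously by zero.\<close>

theorem zero_trace_of_admissible:
  fixes F :: "real^2^2" and y :: "real^2 \<Rightarrow> real^2"
  assumes O: "open \<Omega>" "bounded \<Omega>" and y: "y \<in> admissible \<Omega> F"
    and C: "AE x in lebesgue_on \<Omega>. norm (weak_gradient \<Omega> y x) \<le> C" "0 \<le> C"
  shows "\<exists>u g. zero_trace \<Omega> u g (C + norm F) \<and>
    (\<forall>k. AE x in lebesgue_on \<Omega>. weak_gradient \<Omega> y x $ i $ k - F $ i $ k = g k x)"
proof -
  define G where "G = weak_gradient \<Omega> y"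
  have yW: "y \<in> W1_infty \<Omega>" using y by (simp add: admissible_def)
  obtain v where v: "continuous_on (closure \<Omega>) v" "AE x in lebesgue_on \<Omega>. y x = v x"
    "\<And>x. x \<in> frontier \<Omega> \<Longrightarrow> v x = F *v x" using y by (auto simp: admissible_def)
  have wg: "has_weak_gradient \<Omega> y G" unfolding G_def by (rule has_weak_gradient_weak_gradient[OF yW])
  have GL: "G \<in> L_infty \<Omega>" using yW by (simp add: W1_infty_def G_def)
  have yL: "y \<in> L_infty \<Omega>" using yW by (simp add: W1_infty_def)
  have entry: "\<bar>A $ i $ k\<bar> \<le> norm A" for A :: "real^2^2" and k
    using component_le_norm_cart[of "A $ i" k] Finite_Cartesian_Product.norm_nth_le[of A i] by linarith
  have Gm: "(\<lambda>x. G x $ i $ k) \<in> borel_measurable (lebesgue_on \<Omega>)" for k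
    using measurable_vec_nth[OF L_infty_component[OF GL, of i], of k] .
  have rep: "\<forall>k. \<exists>g. g \<in> borel_measurable borel \<and> (\<forall>x. \<bar>g x\<bar> \<le> C + norm F) \<and> (\<forall>x. x \<notin> \<Omega> \<longrightarrow> g x = 0) \<and>
    (AE x in lebesgue_on \<Omega>. G x $ i $ k - F $ i $ k = g x)"
  proof (rule allI, rule borel_representative[OF O(1)])
    fix k
    show "(\<lambda>x. G x $ i $ k - F $ i $ k) \<in> borel_measurable (lebesgue_on \<Omega>)" using Gm by simp
    show "AE x in lebesgue_on \<Omega>. \<bar>G x $ i $ k - F $ i $ k\<bar> \<le> C + norm F"
      using C(1) unfolding G_def
    proof eventually_elim
      case (elim x)
      then show ?case using entry[of "weak_gradient \<Omega> y x" k] entry[of F k] by linarith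
    qed
  qed (use C(2) in simp)
  obtain g where g: "\<And>k. g k \<in> borel_measurable borel" "\<And>k x. \<bar>g k x\<bar> \<le> C + norm F"
    "\<And>k x. x \<notin> \<Omega> \<Longrightarrow> g k x = 0" "\<And>k. AE x in lebesgue_on \<Omega>. G x $ i $ k - F $ i $ k = g k x"
    using choice[OF rep] by blast
  define u where "u x = (if x \<in> closure \<Omega> then v x $ i - (F *v x) $ i else 0)" for x
  have u_out: "u x = 0" if "x \<notin> \<Omega>" for x
    using v(3)[of x] that O(1) by (auto simp: u_def frontier_def interior_open)
  have cont: "continuous_on UNIV u"
  proof -
    have "continuous_on (closure \<Omega>) u"
      by (subst continuous_on_cong[OF refl, of _ _ "\<lambda>x. v x $ i - (F *v x) $ i"])
        (auto simp: u_def intro!: continuous_on_diff continuous_on_component v(1)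
          linear_continuous_on[OF matrix_vector_mul_bounded_linear])
    moreover have "continuous_on (- \<Omega>) u"
      by (subst continuous_on_cong[OF refl, of _ _ "\<lambda>x. 0"]) (auto simp: u_out)
    ultimately have "continuous_on (closure \<Omega> \<union> - \<Omega>) u"
      using O(1) by (intro continuous_on_closed_Un) auto
    moreover have "closure \<Omega> \<union> - \<Omega> = UNIV" using closure_subset by auto
    ultimately show ?thesis by simp
  qed
  have um: "u \<in> borel_measurable borel" by (rule borel_measurable_continuous_onI[OF cont])
  have uy: "AE x in lebesgue_on \<Omega>. y x $ i = u x + (F *v x) $ i"
  proof -
    have "AE x in lebesgue_on \<Omega>. x \<in> \<Omega>" by (rule AE_I2) simp
    with v(2) show ?thesis
    proof eventually_elim
      case (elim x)
      then have "x \<in> closure \<Omega>" using closure_subset by blast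
      with elim show ?case by (simp add: u_def)
    qed
  qed
  have "zero_trace \<Omega> u g (C + norm F)"
  proof
    fix p p' k and a b :: "real^2"
    assume p: "\<And>i. smooth_real (p i)" and d: "\<And>t. (p k has_real_derivative p' t) (at t)"
      and 0: "\<And>i t. t \<notin> {a $ i..b $ i} \<Longrightarrow> p i t = 0" and sub: "cbox a b \<subseteq> \<Omega>"
    obtain P where P: "\<And>i. smooth_real (P i)" "\<And>i t. (p i has_real_derivative P i t) (at t)"
      using smooth_derivatives[of p] p by blast
    have Pk: "P k = p'" using DERIV_unique[OF P(2) d] by blast
    have p': "smooth_real p'" using P(1)[of k] Pk by simp
    have pd: "partial_deriv k (tens p) = tens (p(k := p'))" using partial_deriv_tens[of p P k] P(2) Pk by simp
    have tf: "tens p \<in> test_functions \<Omega>" by (rule tens_test_function[OF p 0 sub])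
    have T0: "tens p x = 0" if "x \<notin> \<Omega>" for x
      by (rule tens_outside[OF 0]) (use that sub in auto)
    have p'0: "p' t = 0" if "t \<notin> {a $ k..b $ k}" for t by (rule deriv_outside[OF d 0 that])
    have pk0: "(p(k := p')) i t = 0" if "t \<notin> {a $ i..b $ i}" for i t using 0[OF that] p'0 that by auto
    have T'0: "tens (p(k := p')) x = 0" if "x \<notin> \<Omega>" for x
      by (rule tens_outside[OF pk0]) (use that sub in auto)
    have p'i: "smooth_real ((p(k := p')) i)" for i using p p' by simp
    have Tm: "tens p \<in> borel_measurable borel" "tens (p(k := p')) \<in> borel_measurable borel"
      by (intro borel_measurable_continuous_onI continuous_tens p p'i)+
    have mr: "f \<in> borel_measurable (lebesgue_on \<Omega>)" if "f \<in> borel_measurable borel" for f :: "real^2 \<Rightarrow> real"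
      by (rule measurable_restrict_space1) (simp add: measurable_completion that)
    obtain D where D: "0 \<le> D" "\<And>x. x \<in> \<Omega> \<Longrightarrow> \<bar>tens p x\<bar> \<le> D" using tens_bounded_on[of p, OF p O(2)] by blast
    obtain D' where D': "0 \<le> D'" "\<And>x. x \<in> \<Omega> \<Longrightarrow> \<bar>tens (p(k := p')) x\<bar> \<le> D'"
      using tens_bounded_on[of "p(k := p')", OF p'i O(2)] by blast
    have T_int: "integrable lborel (tens p)"
      by (rule integrable_bounded_support[of _ D \<Omega>]) (use D T0 Tm O(2) in \<open>fastforce+\<close>)
    have gT: "integrable lborel (\<lambda>x. g k x * tens p x)"
    proof (rule integrable_bounded_support[of _ "(C + norm F) * D" \<Omega>])
      show "\<bar>g k x * tens p x\<bar> \<le> (C + norm F) * D" for x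
        using g(2)[of k x] D T0[of x] C(2) by (cases "x \<in> \<Omega>") (auto simp: abs_mult intro!: mult_mono)
    qed (use g(1)[of k] T0 Tm O(2) in auto)
    have lin: "(LBINT x. (F *v x) $ i * tens (p(k := p')) x) = - F $ i $ k * (LBINT x. tens p x)"
      and lin_int: "integrable lborel (\<lambda>x. (F *v x) $ i * tens (p(k := p')) x)"
    proof -
      have eq: "(F *v x) $ i * tens (p(k := p')) x = (\<Sum>l\<in>UNIV. F $ i $ l * (x $ l * tens (p(k := p')) x))" for x
        by (simp add: matrix_vector_mult_def sum_distrib_right mult.assoc)
      have la1: "(LBINT x. x $ l * tens (p(k := p')) x) = (if l = k then - (LBINT x. tens p x) else 0)" for l
        by (rule linear_against_derivative(1)[of p k p' a b, OF p d p' 0])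
      have la2: "integrable lborel (\<lambda>x. x $ l * tens (p(k := p')) x)" for l
        by (rule linear_against_derivative(2)[of p k p' a b, OF p d p' 0])
      show "integrable lborel (\<lambda>x. (F *v x) $ i * tens (p(k := p')) x)"
        unfolding eq by (intro Bochner_Integration.integrable_sum integrable_mult_right la2)
      have "(LBINT x. (F *v x) $ i * tens (p(k := p')) x)
        = (\<Sum>l\<in>UNIV. F $ i $ l * (LBINT x. x $ l * tens (p(k := p')) x))"
        unfolding eq by (subst Bochner_Integration.integral_sum) (auto intro!: integrable_mult_right la2)
      also have "\<dots> = (\<Sum>l\<in>UNIV. if l = k then - F $ i $ k * (LBINT x. tens p x) else 0)"
        by (intro sum.cong refl) (simp add: la1)
      finally show "(LBINT x. (F *v x) $ i * tens (p(k := p')) x) = - F $ i $ k * (LBINT x. tens p x)"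
        by simp
    qed
    have uT: "integrable lborel (\<lambda>x. u x * tens (p(k := p')) x)"
    proof -
      have "compact (u ` closure \<Omega>)"
        using O(2) continuous_on_subset[OF cont] by (intro compact_continuous_image) auto
      then obtain B where B: "\<forall>y\<in>u ` closure \<Omega>. norm y \<le> B" using compact_imp_bounded bounded_iff by blast
      show ?thesis
      proof (rule integrable_bounded_support[of _ "max B 0 * D'" \<Omega>])
        show "\<bar>u x * tens (p(k := p')) x\<bar> \<le> max B 0 * D'" for x
        proof (cases "x \<in> \<Omega>")
          case True
          then have "\<bar>u x\<bar> \<le> max B 0" using B closure_subset[of \<Omega>] by (auto simp: le_max_iff_disj)
          then show ?thesis unfolding abs_mult using D' True by (intro mult_mono) auto
        qed (use u_out D' in simp)
      qed (use um Tm u_out O(2) in auto)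
    qed
    have "(LINT x|lebesgue_on \<Omega>. y x $ i * partial_deriv k (tens p) x)
        = - (LINT x|lebesgue_on \<Omega>. G x $ i $ k * tens p x)"
      using wg tf unfolding has_weak_gradient_def by blast
    moreover have "(LINT x|lebesgue_on \<Omega>. y x $ i * partial_deriv k (tens p) x)
      = (LBINT x. u x * tens (p(k := p')) x + (F *v x) $ i * tens (p(k := p')) x)"
      unfolding pd
    proof (rule integral_lebesgue_on_eq_lborel[OF O(1)])
      show "(\<lambda>x. y x $ i * tens (p(k := p')) x) \<in> borel_measurable (lebesgue_on \<Omega>)"
        using L_infty_component[OF yL, of i] mr[OF Tm(2)] by simp
      show "(\<lambda>x. u x * tens (p(k := p')) x + (F *v x) $ i * tens (p(k := p')) x) \<in> borel_measurable borel"
        using borel_measurable_integrable[OF uT] borel_measurable_integrable[OF lin_int] by simp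
      show "AE x in lebesgue_on \<Omega>. y x $ i * tens (p(k := p')) x = u x * tens (p(k := p')) x + (F *v x) $ i * tens (p(k := p')) x"
        using uy by eventually_elim (simp add: distrib_right)
    qed (simp add: T'0)
    moreover have "(LINT x|lebesgue_on \<Omega>. G x $ i $ k * tens p x) = (LBINT x. g k x * tens p x + F $ i $ k * tens p x)"
    proof (rule integral_lebesgue_on_eq_lborel[OF O(1)])
      show "(\<lambda>x. G x $ i $ k * tens p x) \<in> borel_measurable (lebesgue_on \<Omega>)"
        using Gm[of k] mr[OF Tm(1)] by simp
      show "(\<lambda>x. g k x * tens p x + F $ i $ k * tens p x) \<in> borel_measurable borel" using g(1)[of k] Tm by simp
      show "AE x in lebesgue_on \<Omega>. G x $ i $ k * tens p x = g k x * tens p x + F $ i $ k * tens p x"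
        using g(4)[of k] by eventually_elim (simp add: distrib_right[symmetric])
    qed (simp add: T0)
    moreover have "(LBINT x. u x * tens (p(k := p')) x + (F *v x) $ i * tens (p(k := p')) x) =
       (LBINT x. u x * tens (p(k := p')) x) - F $ i $ k * (LBINT x. tens p x)"
      by (subst Bochner_Integration.integral_add[OF uT lin_int]) (simp add: lin)
    moreover have "(LBINT x. g k x * tens p x + F $ i $ k * tens p x)
      = (LBINT x. g k x * tens p x) + F $ i $ k * (LBINT x. tens p x)"
      using gT T_int by (subst Bochner_Integration.integral_add) auto
    ultimately show "(LBINT x. u x * tens (p(k := p')) x) = - (LBINT x. g k x * tens p x)"
      by simp
  qed (use O cont u_out g in auto)
  with g(4) show ?thesis unfolding G_def by blast
qed

section \<open>Minors of admissible gradients\<close>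

text \<open>The determinant as a polynomial in the entries, for which continuity and bounds are immediate.\<close>

definition det2 :: "real^2^2 \<Rightarrow> real" where
  "det2 A = A $ 1 $ 1 * A $ 2 $ 2 - A $ 1 $ 2 * A $ 2 $ 1"

lemma measure_lebesgue_on_open:
  "open \<Omega> \<Longrightarrow> (LBINT x. indicator \<Omega> x) = measure lebesgue (\<Omega> :: (real^2) set)"
  by simp

lemma measurable_lebesgue_on_of_borel:
  "f \<in> borel_measurable borel \<Longrightarrow> f \<in> borel_measurable (lebesgue_on \<Omega>)"
  by (rule measurable_restrict_space1) (simp add: measurable_completion)

text \<open>With \<open>\<nabla>y = F + g\<close> the first two identities say that the integrals of \<open>g\<close> and of the determinant of
\<open>g\<close> vanish; the terms that are mixed in the determinant are linear in \<open>g\<close>.\<close>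

lemma admissible_minors:
  fixes F :: "real^2^2" and y :: "real^2 \<Rightarrow> real^2"
  assumes O: "open \<Omega>" "bounded \<Omega>" and y: "y \<in> admissible \<Omega> F"
    and C: "AE x in lebesgue_on \<Omega>. norm (weak_gradient \<Omega> y x) \<le> C" "0 \<le> C"
  shows "(LINT x|lebesgue_on \<Omega>. weak_gradient \<Omega> y x $ i $ k) = F $ i $ k * measure lebesgue \<Omega>"
    and "(LINT x|lebesgue_on \<Omega>. det2 (weak_gradient \<Omega> y x)) = det2 F * measure lebesgue \<Omega>"
    and "\<lbrakk>\<And>i. smooth_real (p i); \<And>i. smooth_real (q i); \<And>i t. (p i has_real_derivative q i t) (at t)\<rbrakk> \<Longrightarrow>
      (LINT x|lebesgue_on \<Omega>. (weak_gradient \<Omega> y x $ i $ 2 - F $ i $ 2) * tens (p(1 := q 1)) x) =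
      (LINT x|lebesgue_on \<Omega>. (weak_gradient \<Omega> y x $ i $ 1 - F $ i $ 1) * tens (p(2 := q 2)) x)"
proof -
  let ?G = "weak_gradient \<Omega> y"
  let ?m = "measure lebesgue \<Omega>"
  define M where "M = C + norm F"
  have GL: "?G \<in> L_infty \<Omega>" using y by (simp add: admissible_def W1_infty_def)
  have Gm [measurable]: "(\<lambda>x. ?G x $ i $ k) \<in> borel_measurable (lebesgue_on \<Omega>)" for i k
    using measurable_vec_nth[OF L_infty_component[OF GL, of i], of k] .
  have "\<forall>i. \<exists>ug. zero_trace \<Omega> (fst ug) (snd ug) M \<and> (\<forall>k. AE x in lebesgue_on \<Omega>. ?G x $ i $ k - F $ i $ k = snd ug k x)"
    using zero_trace_of_admissible[OF O y C] unfolding M_def by simp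
  from choice[OF this] obtain ug where ug: "\<And>i. zero_trace \<Omega> (fst (ug i)) (snd (ug i)) M"
    "\<And>i k. AE x in lebesgue_on \<Omega>. ?G x $ i $ k - F $ i $ k = snd (ug i) k x" by blast
  define g where "g i = snd (ug i)" for i
  have zt: "zero_trace \<Omega> (fst (ug i)) (g i) M" for i using ug(1) by (simp add: g_def)
  have eq: "AE x in lebesgue_on \<Omega>. ?G x $ i $ k = g i k x + F $ i $ k" for i k
    using ug(2)[of i k] by eventually_elim (simp add: g_def algebra_simps)
  have M0: "0 \<le> M" using C(2) by (simp add: M_def)
  have gm [measurable]: "g i k \<in> borel_measurable borel" for i k by (rule zero_trace.g_meas[OF zt])
  have gb: "\<bar>g i k x\<bar> \<le> M" for i k x by (rule zero_trace.g_bound[OF zt])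
  have g0: "x \<notin> \<Omega> \<Longrightarrow> g i k x = 0" for i k x by (rule zero_trace.g_out[OF zt])
  have gi: "integrable lborel (g i k)" for i k
    by (rule integrable_bounded_support[OF gm gb O(2) g0])
  have ggi: "integrable lborel (\<lambda>x. g i k x * g j l x)" for i k j l
  proof (rule integrable_bounded_support[OF _ _ O(2)])
    show "\<bar>g i k x * g j l x\<bar> \<le> M * M" for x unfolding abs_mult by (intro mult_mono gb M0 abs_ge_zero)
  qed (use g0 in auto)
  have ii: "integrable lborel (indicator \<Omega> :: real^2 \<Rightarrow> real)"
    using O by (intro integrable_bounded_support[of _ 1 \<Omega>]) (auto simp: indicator_def)
  have im: "(LBINT x. indicator \<Omega> x) = ?m" by (rule measure_lebesgue_on_open[OF O(1)])
  have Om [measurable]: "\<Omega> \<in> sets borel" using O(1) by simp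
  have mean: "(LBINT x. g i k x) = 0" for i k by (rule zero_trace.gradient_mean_zero[OF zt])
  have inO: "AE x in lebesgue_on \<Omega>. x \<in> \<Omega>" by (rule AE_I2) simp
  have "(LINT x|lebesgue_on \<Omega>. ?G x $ i $ k) = (LBINT x. g i k x + F $ i $ k * indicator \<Omega> x)"
  proof (rule integral_lebesgue_on_eq_lborel[OF O(1) Gm])
    show "AE x in lebesgue_on \<Omega>. ?G x $ i $ k = g i k x + F $ i $ k * indicator \<Omega> x"
      using eq inO by eventually_elim simp
  qed (use g0 in auto)
  also have "\<dots> = F $ i $ k * ?m"
    by (subst Bochner_Integration.integral_add[OF gi]) (use ii mean im in auto)
  finally show "(LINT x|lebesgue_on \<Omega>. ?G x $ i $ k) = F $ i $ k * ?m" .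
  have "(LINT x|lebesgue_on \<Omega>. det2 (?G x)) = (LBINT x. (g 1 1 x * g 2 2 x - g 1 2 x * g 2 1 x)
      + (F $ 1 $ 1 * g 2 2 x + F $ 2 $ 2 * g 1 1 x - F $ 1 $ 2 * g 2 1 x - F $ 2 $ 1 * g 1 2 x) + det2 F * indicator \<Omega> x)"
  proof (rule integral_lebesgue_on_eq_lborel[OF O(1)])
    show "(\<lambda>x. det2 (?G x)) \<in> borel_measurable (lebesgue_on \<Omega>)" unfolding det2_def by measurable
    show "AE x in lebesgue_on \<Omega>. det2 (?G x) = (g 1 1 x * g 2 2 x - g 1 2 x * g 2 1 x)
      + (F $ 1 $ 1 * g 2 2 x + F $ 2 $ 2 * g 1 1 x - F $ 1 $ 2 * g 2 1 x - F $ 2 $ 1 * g 1 2 x) + det2 F * indicator \<Omega> x"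
      using eq[of 1 1] eq[of 1 2] eq[of 2 1] eq[of 2 2] inO
    proof eventually_elim
      case (elim x)
      then show ?case by (simp add: det2_def) (simp add: algebra_simps)
    qed
  qed (use g0 in auto)
  also have "\<dots> = det2 F * ?m"
    using gi ggi ii zero_trace.gradient_mean_zero[OF zt] null_lagrangian[OF zt zt, of 1 2] im
    by simp
  finally show "(LINT x|lebesgue_on \<Omega>. det2 (?G x)) = det2 F * ?m" .
  assume p: "\<And>i. smooth_real (p i)" and q: "\<And>i. smooth_real (q i)"
    and d: "\<And>i t. (p i has_real_derivative q i t) (at t)"
  have "smooth_real ((p(k := q k)) i)" for i k using p q by simp
  then have Tm: "tens (p(k := q k)) \<in> borel_measurable borel" for k
    by (intro borel_measurable_continuous_onI continuous_tens)
  have conv: "(LINT x|lebesgue_on \<Omega>. (?G x $ i $ k - F $ i $ k) * tens (p(l := q l)) x) = (LBINT x. g i k x * tens (p(l := q l)) x)" for k l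
  proof (rule integral_lebesgue_on_eq_lborel[OF O(1)])
    show "(\<lambda>x. (?G x $ i $ k - F $ i $ k) * tens (p(l := q l)) x) \<in> borel_measurable (lebesgue_on \<Omega>)"
      using measurable_lebesgue_on_of_borel[OF Tm[of l]] by measurable
    show "AE x in lebesgue_on \<Omega>. (?G x $ i $ k - F $ i $ k) * tens (p(l := q l)) x = g i k x * tens (p(l := q l)) x"
      using eq[of i k] by eventually_elim simp
  qed (use g0 Tm[of l] in auto)
  show "(LINT x|lebesgue_on \<Omega>. (?G x $ i $ 2 - F $ i $ 2) * tens (p(1 := q 1)) x) =
      (LINT x|lebesgue_on \<Omega>. (?G x $ i $ 1 - F $ i $ 1) * tens (p(2 := q 2)) x)"
    unfolding conv by (rule zero_trace.curl_free[OF zt, of p q, OF p q d])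
qed

text \<open>Mollifiers are derivatives in the first direction, of a step in the first variable times a bump in the
second, although this primitive is not compactly supported. So all mollifications of \<open>f\<close> vanish, and
pairing them with \<open>f\<close> gives that the integral of its square is zero.\<close>

lemma vanishing_of_directional_tests:
  fixes f :: "real^2 \<Rightarrow> real"
  assumes O: "open \<Omega>" "bounded \<Omega>" and f: "f \<in> borel_measurable (lebesgue_on \<Omega>)"
    and C: "AE x in lebesgue_on \<Omega>. \<bar>f x\<bar> \<le> C" "0 \<le> C"
    and test: "\<And>p q. \<lbrakk>\<And>i. smooth_real (p i); \<And>i. smooth_real (q i);
        \<And>i t. (p i has_real_derivative q i t) (at t)\<rbrakk> \<Longrightarrow> (LINT x|lebesgue_on \<Omega>. f x * tens (p(1 := q 1)) x) = 0"
  shows "AE x in lebesgue_on \<Omega>. f x = 0"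
proof -
  from borel_representative[OF O(1) f C] obtain g where g [measurable]: "g \<in> borel_measurable borel"
    and gb: "\<And>x. \<bar>g x\<bar> \<le> C" and g0: "\<And>x. x \<notin> \<Omega> \<Longrightarrow> g x = 0" and eq: "AE x in lebesgue_on \<Omega>. f x = g x" by blast
  have zero: "(LBINT z. g z * moll eps (x - z)) = 0" if e: "eps > 0" for eps x
  proof -
    define p where "p = (\<lambda>i \<tau>. bump ((x $ i - \<tau>) / eps) / eps)(1 := \<lambda>\<tau>. - step ((x $ 1 - \<tau>) / eps))"
    have sp: "smooth_real (p i)" for i
      using smooth_real_mult[OF smooth_real_const[of "-eps"] smooth_scaled(2)[OF smooth_step, of "x $ 1" eps]] e
      by (auto simp: p_def intro: smooth_scaled smooth_bump)
    obtain q where q: "\<And>i. smooth_real (q i)" "\<And>i t. (p i has_real_derivative q i t) (at t)"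
      using smooth_derivatives[of p] sp by blast
    have "(p 1 has_real_derivative bump ((x $ 1 - \<tau>) / eps) / eps) (at \<tau>)" for \<tau>
      unfolding p_def using e by (auto intro!: derivative_eq_intros DERIV_chain2[OF step_deriv])
    then have q1: "q 1 = (\<lambda>\<tau>. bump ((x $ 1 - \<tau>) / eps) / eps)" using DERIV_unique[OF q(2)[of 1]] by blast
    have T: "tens (p(1 := q 1)) z = moll eps (x - z)" for z
    proof -
      have "p(1 := q 1) = (\<lambda>i \<tau>. bump ((x $ i - \<tau>) / eps) / eps)" by (auto simp: p_def q1 fun_eq_iff)
      then show ?thesis by (simp only: tens_def moll_def scaled_def vector_minus_component)
    qed
    have mm: "(\<lambda>z. moll eps (x - z)) \<in> borel_measurable borel" by measurable
    have "(LBINT z. g z * moll eps (x - z)) = (LINT z|lebesgue_on \<Omega>. f z * moll eps (x - z))"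
    proof (rule integral_lebesgue_on_eq_lborel[OF O(1), symmetric])
      show "(\<lambda>z. f z * moll eps (x - z)) \<in> borel_measurable (lebesgue_on \<Omega>)"
        using f measurable_lebesgue_on_of_borel[OF mm] by simp
      show "AE z in lebesgue_on \<Omega>. f z * moll eps (x - z) = g z * moll eps (x - z)"
        using eq by eventually_elim simp
    qed (use g0 in auto)
    also have "\<dots> = 0" using test[of p q, OF sp q] unfolding T .
    finally show ?thesis .
  qed
  define eps where "eps n = 1 / real (Suc n)" for n
  have e: "eps n > 0" for n by (simp add: eps_def)
  have e0: "eps \<longlonglongrightarrow> 0" unfolding eps_def by (rule LIMSEQ_Suc[OF lim_1_over_n])
  have "(\<lambda>n. LBINT x. g x * (LBINT z. g z * moll (eps n) (x - z))) \<longlonglongrightarrow> (LBINT x. g x * g x)"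
    by (rule moll_tendsto_pairing[OF g g gb gb O(2) g0 g0 e0 e])
  then have sq: "(LBINT x. g x * g x) = 0" unfolding zero[OF e] by (simp add: LIMSEQ_const_iff)
  have "integrable lborel (\<lambda>x. g x * g x)"
  proof (rule integrable_bounded_support[OF _ _ O(2)])
    show "\<bar>g x * g x\<bar> \<le> C * C" for x unfolding abs_mult by (intro mult_mono gb C(2) abs_ge_zero)
  qed (use g0 in auto)
  then have "AE x in lborel. g x * g x = 0"
    using sq by (subst (asm) integral_nonneg_eq_0_iff_AE) auto
  then have "AE x in lebesgue. g x = 0" by (intro AE_completion) simp
  then have "AE x in lebesgue_on \<Omega>. g x = 0"
    using O(1) by (subst AE_lebesgue_on_iff) (auto elim!: eventually_mono)
  with eq show ?thesis by eventually_elim simp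
qed

section \<open>Passing to the limit in Young measures\<close>

text \<open>Multiplication by a continuous cutoff that is 1 on the ball of radius \<open>R\<close> makes \<open>f\<close> an admissible
test function for a Young measure.\<close>

definition truncate :: "real \<Rightarrow> ('b::real_normed_vector \<Rightarrow> real) \<Rightarrow> 'b \<Rightarrow> real" where
  "truncate R f A = f A * max 0 (min 1 (R + 1 - norm A))"

lemma truncate_inside: "norm A \<le> R \<Longrightarrow> truncate R f A = f A"
  by (simp add: truncate_def)

lemma continuous_truncate: "continuous_on UNIV f \<Longrightarrow> continuous_on UNIV (truncate R f)"
  unfolding truncate_def[abs_def] by (intro continuous_intros)

lemma truncate_at_infinity: "(truncate R f \<longlongrightarrow> 0) at_infinity"
proof (rule tendsto_eventually)
  have "truncate R f A = 0" if "norm A \<ge> R + 1" for A using that by (simp add: truncate_def)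
  then show "\<forall>\<^sub>F A in at_infinity. truncate R f A = 0" unfolding eventually_at_infinity by blast
qed

lemma young_measure_limit:
  fixes z :: "nat \<Rightarrow> real^'n::finite \<Rightarrow> 'b::euclidean_space" and f :: "'b \<Rightarrow> real"
  assumes Y: "generates_young_measure \<Omega> z \<nu>" and zm: "\<And>j. z j \<in> borel_measurable (lebesgue_on \<Omega>)"
    and R: "\<And>j. AE x in lebesgue_on \<Omega>. norm (z j x) \<le> R" and f: "continuous_on UNIV f"
    and h: "integrable (lebesgue_on \<Omega>) h"
  shows "(\<lambda>j. LINT x|lebesgue_on \<Omega>. f (z j x) * h x) \<longlonglongrightarrow> (LINT x|lebesgue_on \<Omega>. (LINT A|\<nu> x. truncate R f A) * h x)"
proof -
  have ws: "weak_star_L_infty \<Omega> (\<lambda>j x. truncate R f (z j x)) (\<lambda>x. LINT A|\<nu> x. truncate R f A)"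
    using Y continuous_truncate[OF f] truncate_at_infinity unfolding generates_young_measure_def by blast
  then have "(\<lambda>j. LINT x|lebesgue_on \<Omega>. truncate R f (z j x) * h x) \<longlonglongrightarrow>
     (LINT x|lebesgue_on \<Omega>. (LINT A|\<nu> x. truncate R f A) * h x)"
    using h unfolding weak_star_L_infty_def by simp
  moreover have "(LINT x|lebesgue_on \<Omega>. truncate R f (z j x) * h x) = (LINT x|lebesgue_on \<Omega>. f (z j x) * h x)" for j
  proof (rule integral_cong_AE)
    have hm: "h \<in> borel_measurable (lebesgue_on \<Omega>)" using h by (rule borel_measurable_integrable)
    have fm: "(\<lambda>x. f (z j x)) \<in> borel_measurable (lebesgue_on \<Omega>)"
      by (rule measurable_compose[OF zm borel_measurable_continuous_onI[OF f]])
    have tm: "(\<lambda>x. truncate R f (z j x)) \<in> borel_measurable (lebesgue_on \<Omega>)"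
      by (rule measurable_compose[OF zm borel_measurable_continuous_onI[OF continuous_truncate[OF f]]])
    show "(\<lambda>x. truncate R f (z j x) * h x) \<in> borel_measurable (lebesgue_on \<Omega>)" using tm hm by simp
    show "(\<lambda>x. f (z j x) * h x) \<in> borel_measurable (lebesgue_on \<Omega>)" using fm hm by simp
    show "AE x in lebesgue_on \<Omega>. truncate R f (z j x) * h x = f (z j x) * h x"
      using R[of j] by eventually_elim (simp add: truncate_inside)
  qed
  ultimately show ?thesis by simp
qed

lemma young_limit_L_infty:
  assumes "generates_young_measure \<Omega> z \<nu>" "continuous_on UNIV f"
  shows "(\<lambda>x. LINT A|\<nu> x. truncate R f A) \<in> L_infty \<Omega>"
  using assms continuous_truncate[of f R] truncate_at_infinity[of R f]
  unfolding generates_young_measure_def weak_star_L_infty_def by blast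

text \<open>In a second countable space the union of all open null sets is a countable union of such sets.\<close>

lemma AE_in_support:
  fixes \<mu> :: "'b::second_countable_topology measure"
  assumes s: "sets \<mu> = sets borel"
  shows "AE A in \<mu>. A \<in> measure_support \<mu>"
proof -
  define \<U> where "\<U> = {U. open U \<and> emeasure \<mu> U = 0}"
  obtain \<V> where V: "\<V> \<subseteq> \<U>" "countable \<V>" "\<Union>\<V> = \<Union>\<U>"
    using Lindelof[of \<U>] by (auto simp: \<U>_def)
  have "U \<in> null_sets \<mu>" if "U \<in> \<V>" for U
    using that V(1) s by (auto simp: \<U>_def null_sets_def)
  then have "\<Union>\<V> \<in> null_sets \<mu>" using V(2) null_sets_UN'[of \<V> "\<lambda>U. U" \<mu>] by simp
  then have "AE A in \<mu>. A \<notin> \<Union>\<V>" by (rule AE_not_in)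
  then show ?thesis
  proof eventually_elim
    case (elim A)
    then show ?case unfolding V(3) by (auto simp: \<U>_def measure_support_def)
  qed
qed

text \<open>The uniform boundedness principle is applied to each coordinate, where convergence of the pairings
bounds them.\<close>

lemma weak_star_L_infty_bounded:
  fixes f :: "nat \<Rightarrow> real^'n::finite \<Rightarrow> 'b::euclidean_space"
  assumes O: "open \<Omega>" "bounded \<Omega>" and ws: "weak_star_L_infty \<Omega> f g"
  shows "\<exists>C\<ge>0. \<forall>j. AE x in lebesgue_on \<Omega>. norm (f j x) \<le> C"
proof -
  interpret finite_measure "lebesgue_on \<Omega>"
    using O by (intro finite_measure_lebesgue_on lmeasurable_open)
  have fL: "f j \<in> L_infty \<Omega>" for j using ws by (simp add: weak_star_L_infty_def)
  then have fm: "f j \<in> borel_measurable (lebesgue_on \<Omega>)" for j by (simp add: L_infty_def)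
  have "\<exists>C. \<forall>j. AE x in lebesgue_on \<Omega>. \<bar>f j x \<bullet> b\<bar> \<le> C" if b: "b \<in> Basis" for b
  proof (rule uniformly_bounded_of_pairings)
    show "(\<lambda>x. f j x \<bullet> b) \<in> borel_measurable (lebesgue_on \<Omega>)" for j using fm by simp
    show "\<exists>C. AE x in lebesgue_on \<Omega>. \<bar>f j x \<bullet> b\<bar> \<le> C" for j
    proof -
      obtain C where "AE x in lebesgue_on \<Omega>. norm (f j x) \<le> C" using fL[of j] by (auto simp: L_infty_def)
      then have "AE x in lebesgue_on \<Omega>. \<bar>f j x \<bullet> b\<bar> \<le> C"
        by eventually_elim (rule order_trans[OF Basis_le_norm[OF b]])
      then show ?thesis by blast
    qed
    show "\<exists>B. \<forall>j. \<bar>LINT x|lebesgue_on \<Omega>. f j x \<bullet> b * h x\<bar> \<le> B" if h: "integrable (lebesgue_on \<Omega>) h" for h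
    proof -
      have "integrable (lebesgue_on \<Omega>) (\<lambda>x. h x *\<^sub>R b)" using h by simp
      then have "(\<lambda>j. LINT x|lebesgue_on \<Omega>. f j x \<bullet> (h x *\<^sub>R b)) \<longlonglongrightarrow> (LINT x|lebesgue_on \<Omega>. g x \<bullet> (h x *\<^sub>R b))"
        using ws unfolding weak_star_L_infty_def by blast
      then have "Bseq (\<lambda>j. LINT x|lebesgue_on \<Omega>. f j x \<bullet> (h x *\<^sub>R b))"
        by (intro convergent_imp_Bseq) (auto simp: convergent_def)
      then obtain B where "\<And>j. norm (LINT x|lebesgue_on \<Omega>. f j x \<bullet> (h x *\<^sub>R b)) \<le> B"
        by (auto simp: Bseq_def)
      then show ?thesis by (intro exI[of _ B]) (simp add: mult.commute)
    qed
  qed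
  then obtain C where C: "\<And>b j. b \<in> Basis \<Longrightarrow> AE x in lebesgue_on \<Omega>. \<bar>f j x \<bullet> b\<bar> \<le> C b" by metis
  have "AE x in lebesgue_on \<Omega>. norm (f j x) \<le> max 0 (\<Sum>b\<in>Basis. C b)" for j
  proof -
    have "AE x in lebesgue_on \<Omega>. \<forall>b\<in>Basis. \<bar>f j x \<bullet> b\<bar> \<le> C b"
      using C by (intro AE_finite_allI) auto
    then show ?thesis
    proof eventually_elim
      case (elim x)
      have "norm (f j x) \<le> (\<Sum>b\<in>Basis. \<bar>f j x \<bullet> b\<bar>)" by (rule norm_le_l1)
      also have "\<dots> \<le> (\<Sum>b\<in>Basis. C b)" using elim by (intro sum_mono) auto
      finally show ?case by simp
    qed
  qed
  then show ?thesis by (intro exI[of _ "max 0 (\<Sum>b\<in>Basis. C b)"]) simp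
qed

section \<open>The two wells\<close>

lemma SO2_iff: "Q \<in> SO2 \<longleftrightarrow> (\<exists>a b. a\<^sup>2 + b\<^sup>2 = 1 \<and> Q = vector [vector [a, - b], vector [b, a]])"
proof
  assume "Q \<in> SO2"
  then have o: "orthogonal_matrix Q" and d: "det Q = 1" by (auto simp: SO2_def rotation_matrix_def)
  define a b c e where "a = Q $ 1 $ 1" and "b = Q $ 2 $ 1" and "c = Q $ 1 $ 2" and "e = Q $ 2 $ 2"
  have "transpose Q ** Q = mat 1" using o by (simp add: orthogonal_matrix)
  then have eq: "\<And>i j. (transpose Q ** Q) $ i $ j = (mat 1 :: real^2^2) $ i $ j" by simp
  have 1: "a * a + b * b = 1" "a * c + b * e = 0" "c * c + e * e = 1"
    using eq[of 1 1] eq[of 1 2] eq[of 2 2]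
    by (simp_all add: matrix_matrix_mult_def transpose_def mat_def sum_2 a_def b_def c_def e_def)
  have 2: "a * e - c * b = 1" using d by (simp add: det_2 a_def b_def c_def e_def)
  have "(a * a + b * b) * e = a * (a * e - c * b) + b * (a * c + b * e)" by (simp add: algebra_simps)
  then have e: "e = a" using 1 2 by simp
  have "(a * a + b * b) * c = a * (a * c + b * e) - b * (a * e - c * b)" by (simp add: algebra_simps)
  then have c: "c = - b" using 1 2 by simp
  have "Q = vector [vector [a, - b], vector [b, a]]"
    using e c by (simp add: vec_eq_iff forall_2 a_def b_def c_def e_def)
  then show "\<exists>a b. a\<^sup>2 + b\<^sup>2 = 1 \<and> Q = vector [vector [a, - b], vector [b, a]]"
    using 1 by (auto simp: power2_eq_square)
next
  assume "\<exists>a b. a\<^sup>2 + b\<^sup>2 = 1 \<and> Q = vector [vector [a, - b], vector [b, a]]"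
  then obtain a b where ab: "a * a + b * b = 1" "Q = vector [vector [a, - b], vector [b, a]]"
    by (auto simp: power2_eq_square)
  have "transpose Q ** Q = mat 1"
    using ab by (simp add: vec_eq_iff forall_2 matrix_matrix_mult_def transpose_def mat_def sum_2 algebra_simps)
  moreover have "det Q = 1" using ab by (simp add: det_2)
  ultimately show "Q \<in> SO2" by (simp add: SO2_def rotation_matrix_def orthogonal_matrix)
qed

definition rot :: "real \<Rightarrow> real \<Rightarrow> real^2^2" where "rot a b = vector [vector [a, - b], vector [b, a]]"

lemma rot_well:
  "(rot a b ** well_F1 \<delta>) $ 1 $ 1 = a" "(rot a b ** well_F1 \<delta>) $ 2 $ 1 = b"
  "(rot a b ** well_F1 \<delta>) $ 1 $ 2 = - b * (1 + \<delta>)" "(rot a b ** well_F1 \<delta>) $ 2 $ 2 = a * (1 + \<delta>)"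
  "(rot a b ** well_F2 \<delta>) $ 1 $ 1 = a" "(rot a b ** well_F2 \<delta>) $ 2 $ 1 = b"
  "(rot a b ** well_F2 \<delta>) $ 1 $ 2 = - b * (1 - \<delta>)" "(rot a b ** well_F2 \<delta>) $ 2 $ 2 = a * (1 - \<delta>)"
  by (simp_all add: rot_def well_F1_def well_F2_def matrix_matrix_mult_def sum_2)

lemma wells_cases:
  assumes "A \<in> wells \<delta>"
  obtains a b where "a\<^sup>2 + b\<^sup>2 = 1" "A = rot a b ** well_F1 \<delta> \<or> A = rot a b ** well_F2 \<delta>"
proof -
  obtain Q where Q: "Q \<in> SO2" "A = Q ** well_F1 \<delta> \<or> A = Q ** well_F2 \<delta>"
    using assms by (auto simp: wells_def)
  obtain a b where "a\<^sup>2 + b\<^sup>2 = 1" "Q = rot a b" using Q(1) unfolding SO2_iff rot_def by blast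
  with Q(2) show ?thesis using that by blast
qed

text \<open>A crude bound: four entries, each at most 2 in absolute value.\<close>

lemma wells_norm_le:
  assumes "A \<in> wells \<delta>" "\<bar>\<delta>\<bar> \<le> 1" shows "norm A \<le> 8"
proof -
  obtain a b where ab: "a\<^sup>2 + b\<^sup>2 = 1" "A = rot a b ** well_F1 \<delta> \<or> A = rot a b ** well_F2 \<delta>"
    using assms(1) by (rule wells_cases)
  have "\<bar>a\<bar> \<le> 1" "\<bar>b\<bar> \<le> 1"
    using ab(1) by (simp_all add: abs_square_le_1[symmetric] sum_power2_ge_zero) (metis le_add_same_cancel1 le_add_same_cancel2 zero_le_power2)+
  then have ent: "\<bar>A $ i $ k\<bar> \<le> 2" for i k
  proof -
    have *: "\<bar>x * y\<bar> \<le> 2" if "\<bar>x\<bar> \<le> 1" "\<bar>y\<bar> \<le> 2" for x y :: real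
      using mult_mono[OF that(1) that(2)] by (simp add: abs_mult)
    have s: "\<bar>1 + \<delta>\<bar> \<le> 2" "\<bar>1 - \<delta>\<bar> \<le> 2" using assms(2) by auto
    have "\<bar>- b * (1 + \<delta>)\<bar> \<le> 2" "\<bar>a * (1 + \<delta>)\<bar> \<le> 2" "\<bar>- b * (1 - \<delta>)\<bar> \<le> 2" "\<bar>a * (1 - \<delta>)\<bar> \<le> 2"
      using \<open>\<bar>a\<bar> \<le> 1\<close> \<open>\<bar>b\<bar> \<le> 1\<close> s by (auto intro!: *)
    then show ?thesis
      using exhaust_2[of i] exhaust_2[of k] ab(2) \<open>\<bar>a\<bar> \<le> 1\<close> \<open>\<bar>b\<bar> \<le> 1\<close> by (auto simp: rot_well)
  qed
  have "norm (A $ i) \<le> 4" for i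
  proof -
    have "norm (A $ i) \<le> (\<Sum>k\<in>UNIV. \<bar>A $ i $ k\<bar>)" by (rule norm_le_l1_cart)
    also have "\<dots> \<le> 4" using ent[of i 1] ent[of i 2] by (simp add: sum_2)
    finally show ?thesis .
  qed
  then have "(\<Sum>i\<in>UNIV. norm (A $ i)) \<le> 8" by (simp add: sum_2) (metis add_mono numeral_Bit0)
  moreover have "norm A \<le> (\<Sum>i\<in>UNIV. norm (A $ i))" unfolding norm_vec_def by (rule L2_set_le_sum) simp
  ultimately show ?thesis by linarith
qed

lemma two_wells_distinct: "\<delta> \<noteq> 0 \<Longrightarrow> a\<^sup>2 + b\<^sup>2 = 1 \<Longrightarrow> rot a b ** well_F1 \<delta> \<noteq> rot a b ** well_F2 \<delta>"
proof
  assume d: "\<delta> \<noteq> 0" "a\<^sup>2 + b\<^sup>2 = 1" and eq: "rot a b ** well_F1 \<delta> = rot a b ** well_F2 \<delta>"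
  have "- b * (1 + \<delta>) = - b * (1 - \<delta>)" "a * (1 + \<delta>) = a * (1 - \<delta>)"
    using rot_well[of a b \<delta>] eq by metis+
  then have "b = 0" "a = 0" using d(1) by (auto simp: algebra_simps)
  with d(2) show False by simp
qed

section \<open>Measures on two points\<close>

text \<open>The form in which the convex combination of two Dirac masses is written in the main result.\<close>

definition two_point :: "real \<Rightarrow> 'b::topological_space \<Rightarrow> 'b \<Rightarrow> 'b measure" where
  "two_point lam P P' = add_measure (scale_measure (ennreal lam) (dirac P)) (scale_measure (ennreal (1 - lam)) (dirac P'))"

lemma sets_two_point [simp]: "sets (two_point lam P P') = sets borel"
  by (simp add: two_point_def)

lemma emeasure_two_point:
  assumes "B \<in> sets borel"
  shows "emeasure (two_point lam P P') B = ennreal lam * indicator B P + ennreal (1 - lam) * indicator B P'"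
  unfolding two_point_def using assms by (subst emeasure_add_measure) simp_all

lemma
  fixes \<mu> :: "'b::t1_space measure"
  assumes s: "sets \<mu> = sets borel" and p: "prob_space \<mu>" and AE: "AE A in \<mu>. A = P \<or> A = P'" and ne: "P \<noteq> P'"
  shows two_point_eq: "\<mu> = two_point (measure \<mu> {P}) P P'"
    and integral_two_point: "\<And>f :: 'b \<Rightarrow> real. f \<in> borel_measurable borel \<Longrightarrow>
      (LINT A|\<mu>. f A) = measure \<mu> {P} * f P + (1 - measure \<mu> {P}) * f P'"
proof -
  interpret prob_space \<mu> by fact
  have [measurable]: "{P} \<in> sets \<mu>" "{P'} \<in> sets \<mu>" by (simp_all add: s)
  have sp: "space \<mu> = UNIV" using sets_eq_imp_space_eq[OF s] by simp
  have P': "measure \<mu> {P'} = 1 - measure \<mu> {P}"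
  proof -
    have "measure \<mu> {P, P'} = 1"
      using AE by (subst prob_eq_1) (auto simp: s)
    moreover have "measure \<mu> {P, P'} = measure \<mu> {P} + measure \<mu> {P'}"
      using ne finite_measure_Union[of "{P}" "{P'}"] by (simp add: insert_commute)
    ultimately show ?thesis by simp
  qed
  show "\<mu> = two_point (measure \<mu> {P}) P P'"
  proof (rule measure_eqI)
    fix B assume B: "B \<in> sets \<mu>"
    have [measurable]: "B \<inter> {P} \<in> sets \<mu>" "B \<inter> {P'} \<in> sets \<mu>" using B by auto
    have "emeasure \<mu> B = emeasure \<mu> ((B \<inter> {P}) \<union> (B \<inter> {P'}))"
      by (rule emeasure_eq_AE) (use AE B in \<open>auto elim!: eventually_mono\<close>)
    also have "\<dots> = emeasure \<mu> (B \<inter> {P}) + emeasure \<mu> (B \<inter> {P'})"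
      using ne by (subst plus_emeasure) auto
    also have "emeasure \<mu> (B \<inter> {P}) = ennreal (measure \<mu> {P}) * indicator B P"
      by (cases "P \<in> B") (auto simp: emeasure_eq_measure)
    also have "emeasure \<mu> (B \<inter> {P'}) = ennreal (1 - measure \<mu> {P}) * indicator B P'"
      by (cases "P' \<in> B") (auto simp: emeasure_eq_measure P')
    finally show "emeasure \<mu> B = emeasure (two_point (measure \<mu> {P}) P P') B"
      using B s by (simp add: emeasure_two_point)
  qed (simp add: s)
  fix f :: "'b \<Rightarrow> real" assume f: "f \<in> borel_measurable borel"
  have fm: "f \<in> borel_measurable \<mu>" using f s measurable_cong_sets by blast
  have "(LINT A|\<mu>. f A) = (LINT A|\<mu>. indicator {P} A * f P + indicator {P'} A * f P')"
    by (rule integral_cong_AE) (use fm AE ne in \<open>auto elim!: eventually_mono\<close>)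
  also have "\<dots> = measure \<mu> {P} * f P + measure \<mu> {P'} * f P'"
    by (subst Bochner_Integration.integral_add) (auto simp: sp less_top[symmetric])
  finally show "(LINT A|\<mu>. f A) = measure \<mu> {P} * f P + (1 - measure \<mu> {P}) * f P'" by (simp add: P')
qed

text \<open>The first column of a matrix in the wells is the first column of its rotation and is the same for both
atoms, so the set of matrices with that first column has full measure for one representation and
measure zero for the other unless the rotations agree. Then the mass of the first atom gives the weight.\<close>

lemma two_point_wells_unique:
  assumes d: "\<delta> \<noteq> 0" and Q: "Q \<in> SO2" "lam \<in> {0..1}" and Q': "Q' \<in> SO2" "lam' \<in> {0..1}"
    and eq: "two_point lam (Q ** well_F1 \<delta>) (Q ** well_F2 \<delta>) = two_point lam' (Q' ** well_F1 \<delta>) (Q' ** well_F2 \<delta>)"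
  shows "Q' = Q \<and> lam' = lam"
proof -
  obtain a b where ab: "a\<^sup>2 + b\<^sup>2 = 1" "Q = rot a b" using Q(1) unfolding SO2_iff rot_def by blast
  obtain a' b' where ab': "a'\<^sup>2 + b'\<^sup>2 = 1" "Q' = rot a' b'" using Q'(1) unfolding SO2_iff rot_def by blast
  define S where "S = {A::real^2^2. A $ 1 $ 1 = a \<and> A $ 2 $ 1 = b}"
  have "closed S" unfolding S_def by (intro closed_Collect_conj closed_Collect_eq continuous_intros)
  then have S: "S \<in> sets borel" by (rule borel_closed)
  have "emeasure (two_point lam (Q ** well_F1 \<delta>) (Q ** well_F2 \<delta>)) S = ennreal lam + ennreal (1 - lam)"
    using S by (simp add: emeasure_two_point S_def ab rot_well)
  also have "\<dots> = 1" using Q(2) by (simp flip: ennreal_plus)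
  finally have 1: "emeasure (two_point lam' (Q' ** well_F1 \<delta>) (Q' ** well_F2 \<delta>)) S = 1" by (simp add: eq)
  have "a' = a \<and> b' = b"
  proof (rule ccontr)
    assume "\<not> ?thesis"
    then have "Q' ** well_F1 \<delta> \<notin> S" "Q' ** well_F2 \<delta> \<notin> S" by (auto simp: S_def ab' rot_well)
    with 1 S show False by (simp add: emeasure_two_point)
  qed
  then have QQ: "Q' = Q" by (simp add: ab ab')
  let ?P = "Q ** well_F1 \<delta>"
  have ne: "Q ** well_F2 \<delta> \<noteq> ?P" using two_wells_distinct[OF d ab(1)] ab by simp
  have "emeasure (two_point lam ?P (Q ** well_F2 \<delta>)) {?P} = emeasure (two_point lam' ?P (Q ** well_F2 \<delta>)) {?P}"
    using eq QQ by simp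
  then have "ennreal lam = ennreal lam'" using ne by (simp add: emeasure_two_point)
  then show ?thesis using QQ Q(2) Q'(2) by simp
qed

text \<open>By \<open>g = s (1 - (F11 a + F21 b))\<close> this is the equality case of the Cauchy-Schwarz inequality: a unit
vector \<open>(a, b)\<close> and a vector \<open>(F11, F21)\<close> of length at most 1 have inner product 1 only if they are
equal. The bound 4 only serves integrability.\<close>

lemma wells_sign:
  assumes A: "A \<in> wells \<delta>" and d: "\<bar>\<delta>\<bar> < 1" and F: "F11\<^sup>2 + F21\<^sup>2 \<le> 1"
  defines "g \<equiv> det2 A - F11 * A $ 2 $ 2 + F21 * A $ 1 $ 2"
  shows "0 \<le> g" "g \<le> 4"
    and "g = 0 \<Longrightarrow> F11\<^sup>2 + F21\<^sup>2 = 1 \<and> (A = rot F11 F21 ** well_F1 \<delta> \<or> A = rot F11 F21 ** well_F2 \<delta>)"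
proof -
  obtain a b where ab: "a\<^sup>2 + b\<^sup>2 = 1" "A = rot a b ** well_F1 \<delta> \<or> A = rot a b ** well_F2 \<delta>"
    using A by (rule wells_cases)
  define s where "s = det2 A"
  have s: "0 < s" "s \<le> 2" and gs: "g = s * (1 - (F11 * a + F21 * b))"
  proof -
    have "det2 A = (1 + \<delta>) * (a\<^sup>2 + b\<^sup>2) \<and> g = (1 + \<delta>) * ((a\<^sup>2 + b\<^sup>2) - (F11 * a + F21 * b)) \<or>
      det2 A = (1 - \<delta>) * (a\<^sup>2 + b\<^sup>2) \<and> g = (1 - \<delta>) * ((a\<^sup>2 + b\<^sup>2) - (F11 * a + F21 * b))"
      using ab(2) by (auto simp: det2_def g_def rot_well algebra_simps power2_eq_square)
    then show "0 < s" "s \<le> 2" "g = s * (1 - (F11 * a + F21 * b))"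
      using d ab(1) by (auto simp: s_def)
  qed
  have sq: "(F11 - a)\<^sup>2 + (F21 - b)\<^sup>2 = (F11\<^sup>2 + F21\<^sup>2) + 1 - 2 * (F11 * a + F21 * b)"
    "(F11 + a)\<^sup>2 + (F21 + b)\<^sup>2 = (F11\<^sup>2 + F21\<^sup>2) + 1 + 2 * (F11 * a + F21 * b)"
    using ab(1) by (simp_all add: power2_eq_square algebra_simps)
  have "0 \<le> (F11\<^sup>2 + F21\<^sup>2) + 1 - 2 * (F11 * a + F21 * b)"
    unfolding sq(1)[symmetric] by (rule sum_power2_ge_zero)
  moreover have "0 \<le> (F11\<^sup>2 + F21\<^sup>2) + 1 + 2 * (F11 * a + F21 * b)"
    unfolding sq(2)[symmetric] by (rule sum_power2_ge_zero)
  ultimately have le: "F11 * a + F21 * b \<le> 1" "-1 \<le> F11 * a + F21 * b" using F by simp_all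
  then show "0 \<le> g" unfolding gs using s by simp
  have "s * (1 - (F11 * a + F21 * b)) \<le> 2 * 2" using s le by (intro mult_mono) auto
  then show "g \<le> 4" by (simp add: gs)
  assume "g = 0"
  then have one: "F11 * a + F21 * b = 1" using gs s by simp
  then have "(F11 - a)\<^sup>2 + (F21 - b)\<^sup>2 \<le> 0" using sq(1) F by simp
  then have "F11 = a" "F21 = b" using sum_power2_le_zero_iff[of "F11 - a" "F21 - b"] by auto
  then show "F11\<^sup>2 + F21\<^sup>2 = 1 \<and> (A = rot F11 F21 ** well_F1 \<delta> \<or> A = rot F11 F21 ** well_F2 \<delta>)"
    using ab by auto
qed

text \<open>Used to see that \<open>(F11, F21)\<close>, as an average of unit vectors, has length at most 1.\<close>

lemma wells_first_column:
  assumes A: "A \<in> wells \<delta>"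
  shows "\<bar>F11 * A $ 1 $ 1 + F21 * A $ 2 $ 1\<bar> \<le> sqrt (F11\<^sup>2 + F21\<^sup>2)"
proof -
  obtain a b where ab: "a\<^sup>2 + b\<^sup>2 = 1" "A = rot a b ** well_F1 \<delta> \<or> A = rot a b ** well_F2 \<delta>"
    using A by (rule wells_cases)
  have "(F11 * a + F21 * b)\<^sup>2 + (F11 * b - F21 * a)\<^sup>2 = (F11\<^sup>2 + F21\<^sup>2) * (a\<^sup>2 + b\<^sup>2)"
    by (simp add: power2_eq_square algebra_simps)
  then have "(F11 * a + F21 * b)\<^sup>2 \<le> F11\<^sup>2 + F21\<^sup>2"
    using ab(1) zero_le_power2[of "F11 * b - F21 * a"] by (simp only: mult_1_right)
  then have "sqrt ((F11 * a + F21 * b)\<^sup>2) \<le> sqrt (F11\<^sup>2 + F21\<^sup>2)" by (rule real_sqrt_le_mono)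
  then show ?thesis using ab(2) by (auto simp: rot_well)
qed

section \<open>Rigidity of the Young measure\<close>

theorem proposition8p4:
  fixes \<delta> :: real and \<Omega> :: "(real^2) set" and F :: "real^2^2"
    and y :: "nat \<Rightarrow> real^2 \<Rightarrow> real^2" and y_lim :: "real^2 \<Rightarrow> real^2"
    and \<nu> :: "real^2 \<Rightarrow> (real^2^2) measure"
  assumes "\<delta> \<in> {-1<..<1} - {0}"
    and "open \<Omega>" and "bounded \<Omega>" and "lipschitz_boundary \<Omega>" and "\<Omega> \<noteq> {}"
    and "weak_star_W1_infty \<Omega> y y_lim"
    and "\<And>j. y j \<in> admissible \<Omega> F"
    and "gradient_young_measure \<Omega> y \<nu>"
    and "AE x in lebesgue_on \<Omega>. measure_support (\<nu> x) \<subseteq> wells \<delta>"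
  shows "\<exists>!(Q, lam). Q \<in> SO2 \<and> lam \<in> {0..1} \<and>
    (AE x in lebesgue_on \<Omega>. \<nu> x =
       add_measure (scale_measure (ennreal lam) (dirac (Q ** well_F1 \<delta>)))
                   (scale_measure (ennreal (1 - lam)) (dirac (Q ** well_F2 \<delta>))))"
proof -
  have d: "\<delta> \<noteq> 0" "\<bar>\<delta>\<bar> < 1" using assms(1) by auto
  note O = assms(2,3)
  interpret finite_measure "lebesgue_on \<Omega>"
    using O by (intro finite_measure_lebesgue_on lmeasurable_open)
  define m where "m = measure lebesgue \<Omega>"
  have m1: "(LINT x|lebesgue_on \<Omega>. 1) = m"
    unfolding m_def measure_lebesgue_on_open[OF O(1), symmetric]
    by (rule integral_lebesgue_on_eq_lborel[OF O(1)]) (use O(1) in \<open>auto intro!: AE_I2\<close>)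
  have m_pos: "0 < m"
  proof -
    have "\<not> negligible \<Omega>" using open_not_negligible[OF O(1) assms(5)] .
    then have "m \<noteq> 0" using lmeasurable_open[OF O(2,1)] by (simp add: m_def negligible_iff_measure)
    then show ?thesis by (simp add: m_def order_less_le)
  qed
  have ex: "\<exists>x. P x" if "AE x in lebesgue_on \<Omega>. P x" for P
  proof (rule ccontr)
    assume "\<nexists>x. P x"
    with that have "AE x in lebesgue_on \<Omega>. (1::real) = 0" by simp
    then have "(LINT x|lebesgue_on \<Omega>. (1::real)) = (LINT x|lebesgue_on \<Omega>. 0)" by (intro integral_cong_AE) auto
    with m1 m_pos show False by simp
  qed
  obtain r where Y: "generates_young_measure \<Omega> (\<lambda>j. weak_gradient \<Omega> (y (r j))) \<nu>"
    using assms(8) by (auto simp: gradient_young_measure_def)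
  define z where "z j = weak_gradient \<Omega> (y (r j))" for j
  have Yz: "generates_young_measure \<Omega> z \<nu>" using Y by (simp add: z_def[abs_def])
  have "weak_star_L_infty \<Omega> (\<lambda>j. weak_gradient \<Omega> (y j)) (weak_gradient \<Omega> y_lim)"
    using assms(6) by (simp add: weak_star_W1_infty_def)
  from weak_star_L_infty_bounded[OF O this] obtain C
    where C: "0 \<le> C" "\<And>j. AE x in lebesgue_on \<Omega>. norm (weak_gradient \<Omega> (y j) x) \<le> C" by blast
  (* A ball of radius R contains the values of all gradients and both wells. *)
  define R where "R = max C 8"
  have zC: "AE x in lebesgue_on \<Omega>. norm (z j x) \<le> C" for j using C(2)[of "r j"] by (simp add: z_def)
  have zR: "AE x in lebesgue_on \<Omega>. norm (z j x) \<le> R" for j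
    using zC[of j] by eventually_elim (simp add: R_def)
  have zL: "z j \<in> L_infty \<Omega>" for j using assms(7)[of "r j"] by (simp add: admissible_def W1_infty_def z_def)
  have zm: "z j \<in> borel_measurable (lebesgue_on \<Omega>)" for j using zL[of j] by (simp add: L_infty_def)
  have zem [measurable]: "(\<lambda>x. z j x $ i $ k) \<in> borel_measurable (lebesgue_on \<Omega>)" for i j k
    using measurable_vec_nth[OF L_infty_component[OF zL, of j i], of k] .
  have entry: "\<bar>A $ i $ k\<bar> \<le> norm A" for A :: "real^2^2" and i k
    using component_le_norm_cart[of "A $ i" k] Finite_Cartesian_Product.norm_nth_le[of A i] by linarith
  have mean: "(LINT x|lebesgue_on \<Omega>. z j x $ i $ k) = F $ i $ k * m" for i j k
    unfolding z_def m_def by (rule admissible_minors(1)[OF O assms(7) C(2) C(1)])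
  have det: "(LINT x|lebesgue_on \<Omega>. det2 (z j x)) = det2 F * m" for j
    unfolding z_def m_def by (rule admissible_minors(2)[OF O assms(7) C(2) C(1)])
  have int_e: "integrable (lebesgue_on \<Omega>) (\<lambda>x. z j x $ i $ k)" for i j k
  proof (rule integrable_const_bound[of _ C])
    show "AE x in lebesgue_on \<Omega>. norm (z j x $ i $ k) \<le> C"
      using zC[of j] by eventually_elim (simp add: order_trans[OF entry])
  qed simp
  have int_det: "integrable (lebesgue_on \<Omega>) (\<lambda>x. det2 (z j x))" for j
  proof (rule integrable_const_bound[of _ "C * C + C * C"])
    show "AE x in lebesgue_on \<Omega>. norm (det2 (z j x)) \<le> C * C + C * C"
      using zC[of j]
    proof eventually_elim
      case (elim x)
      then have "\<bar>z j x $ i $ k\<bar> \<le> C" for i k using entry[of "z j x" i k] by linarith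
      then have "\<bar>z j x $ i $ k * z j x $ i' $ k'\<bar> \<le> C * C" for i k i' k'
        unfolding abs_mult using C(1) by (intro mult_mono) auto
      from this[of 1 1 2 2] this[of 1 2 2 1] show ?case unfolding det2_def real_norm_def by linarith
    qed
    show "(\<lambda>x. det2 (z j x)) \<in> borel_measurable (lebesgue_on \<Omega>)" unfolding det2_def by measurable
  qed

  define L where "L f x = (LINT A|\<nu> x. truncate R f A)" for f x
  have lim: "(\<lambda>j. LINT x|lebesgue_on \<Omega>. f (z j x) * h x) \<longlonglongrightarrow> (LINT x|lebesgue_on \<Omega>. L f x * h x)"
    if "continuous_on UNIV f" "integrable (lebesgue_on \<Omega>) h" for f h
    unfolding L_def by (rule young_measure_limit[OF Yz zm zR that])
  have L_Linf: "L f \<in> L_infty \<Omega>" if "continuous_on UNIV f" for f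
    using young_limit_L_infty[OF Yz that, of R] by (simp add: L_def[abs_def])
  have L_meas: "L f \<in> borel_measurable (lebesgue_on \<Omega>)"
    and L_bound: "\<exists>B\<ge>0. AE x in lebesgue_on \<Omega>. \<bar>L f x\<bar> \<le> B"
    and L_int: "integrable (lebesgue_on \<Omega>) (L f)" if f: "continuous_on UNIV f" for f
  proof -
    show meas: "L f \<in> borel_measurable (lebesgue_on \<Omega>)" using L_Linf[OF f] by (simp add: L_infty_def)
    obtain B where B: "AE x in lebesgue_on \<Omega>. norm (L f x) \<le> B" using L_Linf[OF f] by (auto simp: L_infty_def)
    then have "AE x in lebesgue_on \<Omega>. \<bar>L f x\<bar> \<le> max B 0" by eventually_elim simp
    then show "\<exists>B\<ge>0. AE x in lebesgue_on \<Omega>. \<bar>L f x\<bar> \<le> B" by (intro exI[of _ "max B 0"]) simp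
    show "integrable (lebesgue_on \<Omega>) (L f)" by (rule integrable_const_bound[OF B meas])
  qed
  have lim_const: "(LINT x|lebesgue_on \<Omega>. L f x) = c"
    if f: "continuous_on UNIV f" and c: "\<And>j. (LINT x|lebesgue_on \<Omega>. f (z j x)) = c" for f c
    using lim[OF f, of "\<lambda>_. 1"] c by (simp add: LIMSEQ_const_iff)
  have cont_e: "continuous_on UNIV (\<lambda>A::real^2^2. A $ i $ k)" for i k by (intro continuous_intros)

  have good: "AE x in lebesgue_on \<Omega>. sets (\<nu> x) = sets borel \<and> prob_space (\<nu> x) \<and> (AE A in \<nu> x. A \<in> wells \<delta>)"
  proof -
    have "AE x in lebesgue_on \<Omega>. sets (\<nu> x) = sets borel \<and> prob_space (\<nu> x)"
      using Yz by (simp add: generates_young_measure_def)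
    with assms(9) show ?thesis
    proof eventually_elim
      case (elim x)
      then show ?case using AE_in_support[of "\<nu> x"] by (auto elim!: eventually_mono)
    qed
  qed
  have L_eq: "L f x = (LINT A|\<nu> x. f A)"
    if f: "continuous_on UNIV f" and s: "sets (\<nu> x) = sets borel" and w: "AE A in \<nu> x. A \<in> wells \<delta>" for f x
    unfolding L_def
  proof (rule integral_cong_AE)
    have mb: "h \<in> borel_measurable (\<nu> x)" if "continuous_on UNIV h" for h :: "real^2^2 \<Rightarrow> real"
      using borel_measurable_continuous_onI[OF that] measurable_cong_sets[OF s refl] by blast
    show "truncate R f \<in> borel_measurable (\<nu> x)" by (rule mb[OF continuous_truncate[OF f]])
    show "f \<in> borel_measurable (\<nu> x)" by (rule mb[OF f])
    show "AE A in \<nu> x. truncate R f A = f A"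
      using w
    proof eventually_elim
      case (elim A)
      have "norm A \<le> R" using wells_norm_le[OF elim] d(2) by (simp add: R_def)
      then show ?case by (rule truncate_inside)
    qed
  qed
  have integrable_bd: "integrable (\<nu> x) f"
    if f: "continuous_on UNIV f" and s: "sets (\<nu> x) = sets borel" and p: "prob_space (\<nu> x)"
      and b: "AE A in \<nu> x. \<bar>f A\<bar> \<le> B" for f :: "real^2^2 \<Rightarrow> real" and x and B :: real
  proof -
    interpret P: prob_space "\<nu> x" by fact
    have "f \<in> borel_measurable (\<nu> x)"
      using borel_measurable_continuous_onI[OF f] measurable_cong_sets[OF s refl] by blast
    then show ?thesis using b by (intro P.integrable_const_bound[of _ B]) simp_all
  qed

  define n2 where "n2 = (F $ 1 $ 1)\<^sup>2 + (F $ 2 $ 1)\<^sup>2"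
  define N where "N A = F $ 1 $ 1 * A $ 1 $ 1 + F $ 2 $ 1 * A $ 2 $ 1" for A :: "real^2^2"
  have cN: "continuous_on UNIV N" unfolding N_def[abs_def] by (intro continuous_intros)
  have n2_le: "n2 \<le> 1"
  proof -
    have "(LINT x|lebesgue_on \<Omega>. N (z j x)) = n2 * m" for j
      unfolding N_def using int_e by (simp add: mean n2_def power2_eq_square algebra_simps)
    then have "n2 * m = (LINT x|lebesgue_on \<Omega>. L N x)" using lim_const[OF cN] by simp
    also have "\<dots> \<le> (LINT x|lebesgue_on \<Omega>. sqrt n2)"
    proof (rule integral_mono_AE[OF L_int[OF cN]])
      show "AE x in lebesgue_on \<Omega>. L N x \<le> sqrt n2"
        using good
      proof eventually_elim
        case (elim x)
        then interpret P: prob_space "\<nu> x" by simp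
        have b: "AE A in \<nu> x. \<bar>N A\<bar> \<le> sqrt n2"
          using elim unfolding N_def n2_def by (auto elim!: eventually_mono intro: wells_first_column)
        have "(LINT A|\<nu> x. N A) \<le> sqrt n2"
          by (rule P.integral_le_const[OF integrable_bd[OF cN _ _ b]]) (use elim b in \<open>auto elim!: eventually_mono\<close>)
        then show ?case using L_eq[OF cN, of x] elim by simp
      qed
    qed simp
    also have "\<dots> = sqrt n2 * m" using m1 by simp
    finally have "n2 \<le> sqrt n2" using m_pos by simp
    moreover have "0 \<le> n2" by (simp add: n2_def)
    ultimately have "n2 * n2 \<le> n2" using mult_mono[of n2 "sqrt n2" n2 "sqrt n2"] by simp
    show ?thesis
    proof (rule ccontr)
      assume "\<not> n2 \<le> 1"
      then have "n2 * 1 < n2 * n2" by (intro mult_strict_left_mono) auto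
      with \<open>n2 * n2 \<le> n2\<close> show False by simp
    qed
  qed

  define P1 where "P1 = rot (F $ 1 $ 1) (F $ 2 $ 1) ** well_F1 \<delta>"
  define P2 where "P2 = rot (F $ 1 $ 1) (F $ 2 $ 1) ** well_F2 \<delta>"
  define g where "g A = det2 A - F $ 1 $ 1 * A $ 2 $ 2 + F $ 2 $ 1 * A $ 1 $ 2" for A :: "real^2^2"
  have cg: "continuous_on UNIV g" unfolding g_def[abs_def] det2_def by (intro continuous_intros)
  have g_int: "(LINT x|lebesgue_on \<Omega>. L g x) = 0"
  proof (rule lim_const[OF cg])
    fix j
    have "(LINT x|lebesgue_on \<Omega>. g (z j x)) = det2 F * m - F $ 1 $ 1 * (F $ 2 $ 2 * m) + F $ 2 $ 1 * (F $ 1 $ 2 * m)"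
      unfolding g_def using int_e int_det by (simp add: mean det)
    then show "(LINT x|lebesgue_on \<Omega>. g (z j x)) = 0" by (simp add: det2_def algebra_simps)
  qed
  have g_wells: "0 \<le> g A" "g A \<le> 4" "g A = 0 \<Longrightarrow> n2 = 1 \<and> (A = P1 \<or> A = P2)" if "A \<in> wells \<delta>" for A
    using wells_sign[OF that d(2), of "F $ 1 $ 1" "F $ 2 $ 1"] n2_le unfolding g_def n2_def P1_def P2_def by simp_all
  have g_prob: "integrable (\<nu> x) g" "AE A in \<nu> x. 0 \<le> g A" "L g x = (LINT A|\<nu> x. g A)"
    if "sets (\<nu> x) = sets borel \<and> prob_space (\<nu> x) \<and> (AE A in \<nu> x. A \<in> wells \<delta>)" for x
  proof -
    from that have s: "sets (\<nu> x) = sets borel" and p: "prob_space (\<nu> x)" and w: "AE A in \<nu> x. A \<in> wells \<delta>" by auto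
    have "AE A in \<nu> x. \<bar>g A\<bar> \<le> 4" using w by eventually_elim (simp add: g_wells)
    then show "integrable (\<nu> x) g" by (rule integrable_bd[OF cg s p])
    show "AE A in \<nu> x. 0 \<le> g A" using w by eventually_elim (rule g_wells)
    show "L g x = (LINT A|\<nu> x. g A)" by (rule L_eq[OF cg s w])
  qed
  have "AE x in lebesgue_on \<Omega>. 0 \<le> L g x"
    using good by eventually_elim (simp add: g_prob integral_nonneg_AE)
  then have g0: "AE x in lebesgue_on \<Omega>. L g x = 0"
    using g_int integral_nonneg_eq_0_iff_AE[OF L_int[OF cg]] by simp
  have two: "AE x in lebesgue_on \<Omega>. n2 = 1 \<and> sets (\<nu> x) = sets borel \<and> prob_space (\<nu> x) \<and>
     (AE A in \<nu> x. A \<in> wells \<delta>) \<and> (AE A in \<nu> x. A = P1 \<or> A = P2)"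
    using good g0
  proof eventually_elim
    case (elim x)
    then interpret P: prob_space "\<nu> x" by simp
    have "(LINT A|\<nu> x. g A) = 0" using g_prob(3)[of x] elim by simp
    then have "AE A in \<nu> x. g A = 0"
      using integral_nonneg_eq_0_iff_AE[of "\<nu> x" g] g_prob(1,2)[of x] elim by simp
    moreover have "AE A in \<nu> x. A \<in> wells \<delta>" using elim by simp
    ultimately have *: "AE A in \<nu> x. n2 = 1 \<and> (A = P1 \<or> A = P2)"
      by eventually_elim (rule g_wells(3))
    then have "AE A in \<nu> x. n2 = 1" by eventually_elim simp
    moreover from * have "AE A in \<nu> x. A = P1 \<or> A = P2" by eventually_elim simp
    ultimately show ?case using elim by simp
  qed
  have n2: "n2 = 1" using ex[OF two] by blast
  have ne: "P1 \<noteq> P2" unfolding P1_def P2_def using n2 by (intro two_wells_distinct d(1)) (simp add: n2_def)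

  define l where "l x = measure (\<nu> x) {P1}" for x
  have mean_two: "AE x in lebesgue_on \<Omega>. L f x = l x * f P1 + (1 - l x) * f P2" if f: "continuous_on UNIV f" for f
    using two
  proof eventually_elim
    case (elim x)
    then show ?case
      using L_eq[OF f, of x] integral_two_point[of "\<nu> x" P1 P2 f] ne borel_measurable_continuous_onI[OF f]
      by (simp add: l_def)
  qed
  (* The first column of the limit field vanishes, so the curl identity leaves only the second one. *)
  have const: "AE x in lebesgue_on \<Omega>. L (\<lambda>A. A $ i $ 2 - F $ i $ 2) x = 0" for i
  proof -
    have cf: "continuous_on UNIV (\<lambda>A::real^2^2. A $ i $ k - F $ i $ k)" for k by (intro continuous_intros)
    obtain B where B: "0 \<le> B" "AE x in lebesgue_on \<Omega>. \<bar>L (\<lambda>A. A $ i $ 2 - F $ i $ 2) x\<bar> \<le> B"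
      using L_bound[OF cf] by blast
    have first: "AE x in lebesgue_on \<Omega>. L (\<lambda>A. A $ i $ 1 - F $ i $ 1) x = 0"
      using mean_two[OF cf[of 1]]
    proof eventually_elim
      case (elim x)
      have "P1 $ i $ 1 = F $ i $ 1" "P2 $ i $ 1 = F $ i $ 1"
        using exhaust_2[of i] by (auto simp: P1_def P2_def rot_well)
      with elim show ?case by simp
    qed
    show ?thesis
    proof (rule vanishing_of_directional_tests[OF O L_meas[OF cf] B(2,1)])
      fix p q :: "2 \<Rightarrow> real \<Rightarrow> real"
      assume p: "\<And>i. smooth_real (p i)" and q: "\<And>i. smooth_real (q i)"
        and pq: "\<And>i t. (p i has_real_derivative q i t) (at t)"
      have Ti: "integrable (lebesgue_on \<Omega>) (tens (p(k := q k)))" for k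
      proof -
        have sm: "smooth_real ((p(k := q k)) i)" for i using p q by simp
        obtain D where D: "\<And>x. x \<in> \<Omega> \<Longrightarrow> \<bar>tens (p(k := q k)) x\<bar> \<le> D"
          using tens_bounded_on[of "p(k := q k)", OF sm O(2)] by blast
        show ?thesis
        proof (rule integrable_const_bound[of _ D])
          show "AE x in lebesgue_on \<Omega>. norm (tens (p(k := q k)) x) \<le> D" by (rule AE_I2) (simp add: D)
          show "tens (p(k := q k)) \<in> borel_measurable (lebesgue_on \<Omega>)"
            by (intro measurable_lebesgue_on_of_borel borel_measurable_continuous_onI continuous_tens sm)
        qed
      qed
      have curl: "(LINT x|lebesgue_on \<Omega>. (z j x $ i $ 2 - F $ i $ 2) * tens (p(1 := q 1)) x) =
        (LINT x|lebesgue_on \<Omega>. (z j x $ i $ 1 - F $ i $ 1) * tens (p(2 := q 2)) x)" for j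
        unfolding z_def by (rule admissible_minors(3)[OF O assms(7) C(2) C(1) p q pq])
      have "(LINT x|lebesgue_on \<Omega>. L (\<lambda>A. A $ i $ 2 - F $ i $ 2) x * tens (p(1 := q 1)) x) =
        (LINT x|lebesgue_on \<Omega>. L (\<lambda>A. A $ i $ 1 - F $ i $ 1) x * tens (p(2 := q 2)) x)"
        using lim[OF cf[of 2] Ti[of 1]] lim[OF cf[of 1] Ti[of 2]] unfolding curl by (rule LIMSEQ_unique)
      also have "\<dots> = (LINT x|lebesgue_on \<Omega>. 0)"
      proof (rule integral_cong_AE)
        show "(\<lambda>x. L (\<lambda>A. A $ i $ 1 - F $ i $ 1) x * tens (p(2 := q 2)) x) \<in> borel_measurable (lebesgue_on \<Omega>)"
          using L_meas[OF cf[of 1]] borel_measurable_integrable[OF Ti[of 2]] by simp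
        show "AE x in lebesgue_on \<Omega>. L (\<lambda>A. A $ i $ 1 - F $ i $ 1) x * tens (p(2 := q 2)) x = 0"
          using first by eventually_elim simp
      qed simp
      finally show "(LINT x|lebesgue_on \<Omega>. L (\<lambda>A. A $ i $ 2 - F $ i $ 2) x * tens (p(1 := q 1)) x) = 0" by simp
    qed
  qed
  have cont_shift: "continuous_on UNIV (\<lambda>A::real^2^2. A $ i $ 2 - F $ i $ 2)" for i by (intro continuous_intros)
  (* The weight for which the average of the determinants 1 + \<delta> and 1 - \<delta> is det F. *)
  define lam where "lam = (det2 F - 1 + \<delta>) / (2 * \<delta>)"
  have l_lam: "AE x in lebesgue_on \<Omega>. l x = lam"
    using mean_two[OF cont_shift[of 1]] mean_two[OF cont_shift[of 2]] const[of 1] const[of 2]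
  proof eventually_elim
    case (elim x)
    let ?s = "1 - \<delta> + 2 * \<delta> * l x"
    have e: "F $ 1 $ 2 = - F $ 2 $ 1 * ?s" "F $ 2 $ 2 = F $ 1 $ 1 * ?s"
      using elim by (simp_all add: P1_def P2_def rot_well algebra_simps)
    have "det2 F = F $ 1 $ 1 * (F $ 1 $ 1 * ?s) - (- F $ 2 $ 1 * ?s) * F $ 2 $ 1"
      by (simp only: det2_def e)
    also have "\<dots> = n2 * ?s" unfolding n2_def power2_eq_square by (simp add: algebra_simps)
    finally have "det2 F = n2 * ?s" .
    then have "det2 F = ?s" by (simp add: n2)
    then show ?case unfolding lam_def using d(1) by (simp add: field_simps)
  qed
  let ?Q = "rot (F $ 1 $ 1) (F $ 2 $ 1)"
  have Q: "?Q \<in> SO2" using n2 unfolding SO2_iff rot_def n2_def by blast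
  have repr: "AE x in lebesgue_on \<Omega>. \<nu> x = two_point lam P1 P2 \<and> lam \<in> {0..1}"
    using two l_lam
  proof eventually_elim
    case (elim x)
    then interpret P: prob_space "\<nu> x" by simp
    have "\<nu> x = two_point (l x) P1 P2" unfolding l_def by (rule two_point_eq) (use elim ne in auto)
    moreover have "l x \<in> {0..1}" by (simp add: l_def P.prob_le_1)
    ultimately show ?case using elim by simp
  qed
  have lam: "lam \<in> {0..1}" using ex[OF repr] by blast
  have rep: "AE x in lebesgue_on \<Omega>. \<nu> x = two_point lam P1 P2" using repr by eventually_elim simp
  show ?thesis unfolding two_point_def[symmetric]
  proof (rule ex1I[of _ "(?Q, lam)"])
    show "case (?Q, lam) of (Q, lam) \<Rightarrow> Q \<in> SO2 \<and> lam \<in> {0..1} \<and>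
        (AE x in lebesgue_on \<Omega>. \<nu> x = two_point lam (Q ** well_F1 \<delta>) (Q ** well_F2 \<delta>))"
      using Q lam rep by (simp add: P1_def P2_def)
    fix Ql :: "(real^2^2) \<times> real"
    assume Ql: "case Ql of (Q, lam) \<Rightarrow> Q \<in> SO2 \<and> lam \<in> {0..1} \<and>
        (AE x in lebesgue_on \<Omega>. \<nu> x = two_point lam (Q ** well_F1 \<delta>) (Q ** well_F2 \<delta>))"
    obtain Q' lam' where eq: "Ql = (Q', lam')" by (cases Ql)
    from Ql eq have Q': "Q' \<in> SO2" "lam' \<in> {0..1}"
      and "AE x in lebesgue_on \<Omega>. \<nu> x = two_point lam' (Q' ** well_F1 \<delta>) (Q' ** well_F2 \<delta>)" by auto
    from this(3) rep have "AE x in lebesgue_on \<Omega>. two_point lam P1 P2 = two_point lam' (Q' ** well_F1 \<delta>) (Q' ** well_F2 \<delta>)"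
      by eventually_elim simp
    then have "two_point lam P1 P2 = two_point lam' (Q' ** well_F1 \<delta>) (Q' ** well_F2 \<delta>)" using ex by blast
    then show "Ql = (?Q, lam)"
      using two_point_wells_unique[OF d(1) Q lam Q'] unfolding eq P1_def P2_def by simp
  qed
qed

end
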